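(* Consider the system $\dot{\mathbf x}=f(\mathbf x)+g(\mathbf x)u$ with state $\mathbf x=(\mathbf x_1,\mathbf x_2,\mathbf x_3,\mathbf x_4)=(q_u,q_a,\dot q_u,\dot q_a)$, where $(\mathbf x_1,\mathbf x_2)\in\mathbb S\times\mathbb R$, scalar input $u\in\mathbb R$, and $$f(\mathbf x)=\begin{bmatrix}\mathbf x_3\\ \mathbf x_4\\ -\frac{1}{m_{uu}(\mathbf x_1)}\big(\bar c_u(\mathbf x_1)\mathbf x_4^2+c_a(\mathbf x_1)\mathbf x_3^2+\nabla_uV_u(\mathbf x_1,\mathbf x_2)\big)\\ 0\end{bmatrix},\qquad g(\mathbf x)=\begin{bmatrix}0\\0\\-\frac{m_{au}(\mathbf x_1)}{m_{uu}(\mathbf x_1)}\\1\end{bmatrix},$$ obtained by partial feedback linearization of a two-degree-of-freedom underactuated mechanical system as described in the context. Assume: (A1) The inertia matrix depends only on the unactuated variable $q_u$, i.e. $M(q_u)=\begin{bmatrix}m_{uu}(q_u)&m_{au}(q_u)\\ m_{au}(q_u)&m_{aa}(q_u)\end{bmatrix}$, and it is positive definite (so $m_{uu},m_{aa}$ are positive functions). (A2) $m_{uu}(\mathbf x_1)$ is bounded, and $m_{au}(\mathbf x_1)$ and $\bar c_u(\mathbf x_1)$ are not equal to zero in the set $\mathbb S$. (A3) There exist two smooth, bounded and non-zero functions $\mathfrak s(\mathbf x_1)$ and $\mathcal K(\mathbf x_1)$, with $\mathfrak s(\mathbf x_1)\neq 0$ for all $\mathbf x_1$, such that: (a) $\mathcal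 K'(\mathbf x_1)=\dfrac{\mathfrak s(\mathbf x_1)-m_{uu}(\mathbf x_1)}{m_{au}(\mathbf x_1)}$, equivalently $\mathfrak s=m_{uu}+m_{au}\mathcal K'$; (b) the function $m(\mathbf x_1)=\exp\left(-2\int_0^{\mathbf x_1}\beta(s)\,ds\right)$ is positive on $\mathbb S$, where $$\beta(\mathbf x_1)=-\frac{\bar c_u(\mathbf x_1)\mathcal K'(\mathbf x_1)^2+c_a(\mathbf x_1)+m_{au}(\mathbf x_1)\mathcal K''(\mathbf x_1)}{\mathfrak s(\mathbf x_1)};$$ (c) the function $U(\mathbf x_1)=-\int_0^{\mathbf x_1}\rho(s)m(s)\,ds$, with $\rho(\mathbf x_1)=-\dfrac{\nabla_uV_u(\mathbf x_1,\mathcal K(\mathbf x_1))}{\mathfrak s(\mathbf x_1)}$, has a single isolated minimum point (around which periodic oscillations are to be generated). Let $$\phi(\mathbf x)=\begin{bmatrix}\phi_1(\mathbf x)\\ \phi_2(\mathbf x)\end{bmatrix}=\begin{bmatrix}\mathbf x_2-\mathcal K(\mathbf x_1)\\ \mathbf x_4-\mathcal K'(\mathbf x_1)\mathbf x_3\end{bmatrix},$$ let $\gamma_1,\gamma_2>0$ be arbitrary gains, and let the controller be $$u(\mathbf x)=-\frac{\mathcal K'(\mathbf x_1)\big(\mathbf x_4^2\,\bar c_u(\mathbf x_1)+\mathbf x_3^2\,c_a(\mathbf x_1)\big)-m_{uu}(\mathbf x_1)\mathcal K''(\mathbf x_1)\mathbf x_3^2}{\mathfrak s(\mathbf x_1)}-\frac{\mathcal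 K'(\mathbf x_1)\nabla_uV_u(\mathbf x_1,\mathbf x_2)+m_{uu}(\mathbf x_1)\big(\gamma_1\phi_1(\mathbf x)+\gamma_2\phi_2(\mathbf x)\big)}{\mathfrak s(\mathbf x_1)}.$$ Then this controller solves the orbital stabilization problem with non-trivial orbits: the closed-loop system $\dot{\mathbf x}=f(\mathbf x)+g(\mathbf x)u(\mathbf x)$ has a non-trivial periodic solution $X(t)$, with orbit $\{\mathbf x : \mathbf x=X(t),\ 0\le t\le T\}$ for some period $T>0$, that is orbitally attractive (in the sense given in the context), and the closed-loop state is bounded.
   Context: Mechanical system. The underlying system is the Euler–Lagrange system $M(q)\ddot q+C(q,\dot q)\dot q+\nabla V(q)=G\tau$, with $q=(q_u,q_a)\in\mathbb S\times\mathbb R$ ($\mathbb S$ the unit circle), $q_u$ the unactuated and $q_a$ the actuated coordinate, $G=[0\ \ 1]^\top$, scalar input $\tau$, inertia matrix $M>0$, Coriolis/centrifugal term $C(q,\dot q)\dot q$ and potential energy $V$ (also written $V_u$). When $M$ depends only on $q_u$, the equations have the form $$m_{uu}(q_u)\ddot q_u+c_a(q_u)\dot q_u^2+\bar c_u(q_u)\dot q_a^2+\nabla_uV_u(q)=0,$$ $$m_{au}(q_u)\ddot q_u+m_{aa}(q_u)\ddot q_a+c_p(q_u)\dot q_a\dot q_u+c_s(q_u)\dot q_a^2+\nabla_aV_u(q)=\tau,$$ where $c_a,\bar c_u,c_p,c_s$ are real-valued functions of $q_u$, and $\nabla_uV_u(q)=\partial V_u/\partial q_u$, $\nabla_aV_u(q)=\partial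 V_u/\partial q_a$. After a collocated partial linearizing feedback $\tau=u_{\tt PL}(q,\dot q)$ (which contains the new input $u$), the dynamics become $$\ddot q_a=u,\qquad m_{uu}(q_u)\ddot q_u+\bar c_u(q_u)\dot q_a^2+c_a(q_u)\dot q_u^2+\nabla_uV_u(q)=-m_{au}(q_u)u,$$ which is the system $\dot{\mathbf x}=f(\mathbf x)+g(\mathbf x)u$ of the claim. Conventions. All mappings are assumed $C^2$. Primes denote derivatives with respect to the scalar argument. $\nabla_uV_u(\mathbf x_1,\mathcal K(\mathbf x_1))$ means $\partial V_u/\partial q_u$ evaluated at $(q_u,q_a)=(\mathbf x_1,\mathcal K(\mathbf x_1))$. The variable $\mathbf x_1$ is an angle in $\mathbb S$. Meaning of orbital stabilization. "Orbital stabilization" here means generation of attractive oscillations with a family of feasible orbits, not convergence to one particular prescribed orbit. The family consists of the images under $$\pi(\xi)=\big(\xi_1,\ \mathcal K(\xi_1),\ \xi_2,\ \mathcal K'(\xi_1)\xi_2\big)$$ of the non-trivial (non-constant) periodic orbits of the target dynamics $$\dot\xi_1=\xi_2,\qquad \dot\xi_2=\rho(\xi_1)+\beta(\xi_1)\xi_2^2.$$ These lie on the manifold $\{\mathbf x:\phi(\mathbf x)=0\}=\{\mathbf x:\mathbf x=\pi(\xi)\}$. The periodic solution $X$ belongs to this family. "Orbitally attractive" means that closed-loop trajectories starting near the orbit satisfy $\phi(\mathbf x(t))\to0$ as $t\to\infty$ and converge to one of the periodic orbits of the family, which one depending on the initial condition $\mathbf x(0)$. *)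

theory Defs
  imports "HOL-Analysis.Analysis" "HOL-Library.Periodic_Fun"
begin

text \<open>
  Angles are represented by real lifts: a function on the unit circle is a function on the reals
  of period \<open>2 * pi\<close>, and a trajectory on the cylinder is given by a lift of its angular
  component. Distances, periodicity, orbits and boundedness are always taken on the cylinder,
  that is, after applying \<open>cis\<close> to the angle (see \<open>cyl\<close> and \<open>cyl2\<close> below).
\<close>

definition C2 :: "('a::real_normed_vector \<Rightarrow> 'b::real_normed_vector) \<Rightarrow> bool" where
  "C2 f \<longleftrightarrow> (\<exists>(f' :: 'a \<Rightarrow> 'a \<Rightarrow>\<^sub>L 'b) (f'' :: 'a \<Rightarrow> 'a \<Rightarrow>\<^sub>L ('a \<Rightarrow>\<^sub>L 'b)).
     (\<forall>x. (f has_derivative blinfun_apply (f' x)) (at x)) \<and>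
     (\<forall>x. (f' has_derivative blinfun_apply (f'' x)) (at x)) \<and>
     continuous_on UNIV f'')"

definition positive_definite :: "real ^ 'n ^ 'n \<Rightarrow> bool" where
  "positive_definite A \<longleftrightarrow> transpose A = A \<and> (\<forall>v. v \<noteq> 0 \<longrightarrow> v \<bullet> (A *v v) > 0)"

definition strict_local_min :: "(real \<Rightarrow> real) \<Rightarrow> real \<Rightarrow> bool" where
  "strict_local_min h x \<longleftrightarrow> (\<forall>\<^sub>F y in at x. h x < h y)"

text \<open>Uniqueness is that of a point of the circle, i.e. modulo \<open>2 * pi\<close>.\<close>

definition single_isolated_min :: "(real \<Rightarrow> real) \<Rightarrow> bool" where
  "single_isolated_min h \<longleftrightarrow>
     (\<exists>x. strict_local_min h x \<and> (\<forall>y. strict_local_min h y \<longrightarrow> cis y = cis x))"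


subsection \<open>The partially linearized mechanical system\<close>

text \<open>
  The coefficients \<open>c_a\<close> and \<open>c_u\<close> (the latter is written with a bar in the equations of motion)
  are arbitrary functions of the unactuated angle. They are deliberately not tied to the
  derivatives of the inertia matrix: with Christoffel symbols one would have
  \<open>c_u = - m_aa' / 2\<close>, which has a zero on the circle.
\<close>

record plant =
  m_uu :: "real \<Rightarrow> real"
  m_au :: "real \<Rightarrow> real"
  m_aa :: "real \<Rightarrow> real"
  c_a :: "real \<Rightarrow> real"
  c_u :: "real \<Rightarrow> real"
  V :: "real \<times> real \<Rightarrow> real"

definition inertia :: "plant \<Rightarrow> real \<Rightarrow> real ^ 2 ^ 2" where
  "inertia P q = vector [vector [m_uu P q, m_au P q], vector [m_au P q, m_aa P q]]"

definition grad_u :: "plant \<Rightarrow> real \<Rightarrow> real \<Rightarrow> real" where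
  "grad_u P q_u q_a = deriv (\<lambda>q. V P (q, q_a)) q_u"

type_synonym state = "real \<times> real \<times> real \<times> real"

definition drift :: "plant \<Rightarrow> state \<Rightarrow> state" where
  "drift P = (\<lambda>(x1, x2, x3, x4).
     (x3,
      x4,
      - (1 / m_uu P x1) * (c_u P x1 * x4\<^sup>2 + c_a P x1 * x3\<^sup>2 + grad_u P x1 x2),
      0))"

definition input_field :: "plant \<Rightarrow> state \<Rightarrow> state" where
  "input_field P = (\<lambda>(x1, x2, x3, x4). (0, 0, - (m_au P x1 / m_uu P x1), 1))"


subsection \<open>Target dynamics\<close>

definition beta :: "plant \<Rightarrow> (real \<Rightarrow> real) \<Rightarrow> (real \<Rightarrow> real) \<Rightarrow> real \<Rightarrow> real" where
  "beta P s K x = - ((c_u P x * (deriv K x)\<^sup>2 + c_a P x + m_au P x * deriv (deriv K) x) / s x)"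

definition rho :: "plant \<Rightarrow> (real \<Rightarrow> real) \<Rightarrow> (real \<Rightarrow> real) \<Rightarrow> real \<Rightarrow> real" where
  "rho P s K x = - (grad_u P x (K x) / s x)"

definition m_target :: "plant \<Rightarrow> (real \<Rightarrow> real) \<Rightarrow> (real \<Rightarrow> real) \<Rightarrow> real \<Rightarrow> real" where
  "m_target P s K x = exp (- 2 * (LBINT r=0..ereal x. beta P s K r))"

definition U_target :: "plant \<Rightarrow> (real \<Rightarrow> real) \<Rightarrow> (real \<Rightarrow> real) \<Rightarrow> real \<Rightarrow> real" where
  "U_target P s K x = - (LBINT r=0..ereal x. rho P s K r * m_target P s K r)"

definition target_field ::
  "plant \<Rightarrow> (real \<Rightarrow> real) \<Rightarrow> (real \<Rightarrow> real) \<Rightarrow> real \<times> real \<Rightarrow> real \<times> real" where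
  "target_field P s K = (\<lambda>(\<xi>1, \<xi>2). (\<xi>2, rho P s K \<xi>1 + beta P s K \<xi>1 * \<xi>2\<^sup>2))"

definition pi_map :: "(real \<Rightarrow> real) \<Rightarrow> real \<times> real \<Rightarrow> state" where
  "pi_map K = (\<lambda>(\<xi>1, \<xi>2). (\<xi>1, K \<xi>1, \<xi>2, deriv K \<xi>1 * \<xi>2))"


subsection \<open>Controller and closed loop\<close>

definition phi1 :: "(real \<Rightarrow> real) \<Rightarrow> state \<Rightarrow> real" where
  "phi1 K = (\<lambda>(x1, x2, x3, x4). x2 - K x1)"

definition phi2 :: "(real \<Rightarrow> real) \<Rightarrow> state \<Rightarrow> real" where
  "phi2 K = (\<lambda>(x1, x2, x3, x4). x4 - deriv K x1 * x3)"

definition phi :: "(real \<Rightarrow> real) \<Rightarrow> state \<Rightarrow> real \<times> real" where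
  "phi K x = (phi1 K x, phi2 K x)"

definition controller ::
  "plant \<Rightarrow> (real \<Rightarrow> real) \<Rightarrow> (real \<Rightarrow> real) \<Rightarrow> real \<Rightarrow> real \<Rightarrow> state \<Rightarrow> real" where
  "controller P s K \<gamma>1 \<gamma>2 = (\<lambda>(x1, x2, x3, x4).
     - ((deriv K x1 * (x4\<^sup>2 * c_u P x1 + x3\<^sup>2 * c_a P x1)
          - m_uu P x1 * deriv (deriv K) x1 * x3\<^sup>2) / s x1)
     - (deriv K x1 * grad_u P x1 x2
          + m_uu P x1 * (\<gamma>1 * phi1 K (x1, x2, x3, x4) + \<gamma>2 * phi2 K (x1, x2, x3, x4))) / s x1)"

definition closed_loop ::
  "plant \<Rightarrow> (real \<Rightarrow> real) \<Rightarrow> (real \<Rightarrow> real) \<Rightarrow> real \<Rightarrow> real \<Rightarrow> state \<Rightarrow> state" where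
  "closed_loop P s K \<gamma>1 \<gamma>2 x = drift P x + controller P s K \<gamma>1 \<gamma>2 x *\<^sub>R input_field P x"


subsection \<open>Trajectories, orbits, attractivity\<close>

definition solution :: "('a::real_normed_vector \<Rightarrow> 'a) \<Rightarrow> real set \<Rightarrow> (real \<Rightarrow> 'a) \<Rightarrow> bool" where
  "solution F J x \<longleftrightarrow> (\<forall>t\<in>J. (x has_vector_derivative F (x t)) (at t within J))"

type_synonym cstate = "complex \<times> real \<times> real \<times> real"

definition cyl :: "state \<Rightarrow> cstate" where
  "cyl = (\<lambda>(x1, x2, x3, x4). (cis x1, x2, x3, x4))"

definition cyl2 :: "real \<times> real \<Rightarrow> complex \<times> real" where
  "cyl2 = (\<lambda>(\<xi>1, \<xi>2). (cis \<xi>1, \<xi>2))"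

text \<open>\<open>e\<close> is the projection of lifted states to the cylinder.\<close>

definition nontrivial_periodic_solution ::
  "('a::real_normed_vector \<Rightarrow> 'a) \<Rightarrow> ('a \<Rightarrow> 'b) \<Rightarrow> (real \<Rightarrow> 'a) \<Rightarrow> real \<Rightarrow> bool" where
  "nontrivial_periodic_solution F e X T \<longleftrightarrow>
     0 < T \<and> solution F UNIV X \<and> (\<forall>t. e (X (t + T)) = e (X t)) \<and>
     \<not> (\<lambda>t. e (X t)) constant_on UNIV"

definition orbit :: "(real \<Rightarrow> state) \<Rightarrow> real \<Rightarrow> cstate set" where
  "orbit X T = {cyl (X t) | t. 0 \<le> t \<and> t \<le> T}"

definition orbit_family ::
  "plant \<Rightarrow> (real \<Rightarrow> real) \<Rightarrow> (real \<Rightarrow> real) \<Rightarrow> cstate set set" where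
  "orbit_family P s K =
     {orbit (pi_map K \<circ> \<xi>) T | \<xi> T. nontrivial_periodic_solution (target_field P s K) cyl2 \<xi> T}"

definition orbitally_attractive ::
  "(state \<Rightarrow> state) \<Rightarrow> (state \<Rightarrow> real \<times> real) \<Rightarrow> cstate set set \<Rightarrow> cstate set \<Rightarrow> bool" where
  "orbitally_attractive F \<Phi> \<F> A \<longleftrightarrow>
     (\<exists>\<delta>>0. \<forall>x0. infdist (cyl x0) A < \<delta> \<longrightarrow>
        (\<exists>x. solution F {0..} x \<and> x 0 = x0) \<and>
        (\<forall>x. solution F {0..} x \<and> x 0 = x0 \<longrightarrow>
           ((\<lambda>t. \<Phi> (x t)) \<longlongrightarrow> 0) at_top \<and>
           (\<exists>B\<in>\<F>. ((\<lambda>t. infdist (cyl (x t)) B) \<longlongrightarrow> 0) at_top)))"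

definition bounded_from :: "(state \<Rightarrow> state) \<Rightarrow> state set \<Rightarrow> bool" where
  "bounded_from F D \<longleftrightarrow>
     (\<forall>x0\<in>D. (\<exists>x. solution F {0..} x \<and> x 0 = x0) \<and>
        (\<forall>x. solution F {0..} x \<and> x 0 = x0 \<longrightarrow> bounded ((\<lambda>t. cyl (x t)) ` {0..})))"

end

theory Submission
  imports Defs
begin

text \<open>
  Write \<open>\<phi> = (x2 - K x1, x4 - K' x1 * x3)\<close>. The matching condition \<open>s = m_uu + m_au * K'\<close> makes the
  closed loop read \<open>\<phi>1' = \<phi>2\<close>, \<open>\<phi>2' = - \<gamma>1 * \<phi>1 - \<gamma>2 * \<phi>2\<close>, so \<open>\<phi>\<close> decays exponentially, and
  \<open>x3' = \<rho> x1 + \<beta> x1 * x3\<^sup>2 + p\<close> with \<open>|p| \<le> C * |\<phi>| * (1 + |x3|)\<close>. The energy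
  \<open>H = m x1 * x3\<^sup>2 / 2 + U x1\<close> is conserved by the target dynamics, and \<open>H' = m x1 * x3 * p\<close> along the
  closed loop; hence \<open>H\<close> converges. Near the strict minimum of \<open>U\<close> there is a level at which \<open>U\<close>
  has a well with non-critical end points; the same holds for all neighbouring levels, and over each
  such well the level curve of \<open>H\<close> is a periodic orbit of the target dynamics. A trajectory starting
  near one of these orbits is confined by \<open>H\<close> to the well and converges to the orbit at the limit
  level.
\<close>

subsection \<open>Global solutions of Lipschitz equations\<close>

text \<open>The minimum of \<open>U\<close> may be degenerate, so a linearization at it says nothing
  about nearby orbits. What matters is a level at which \<open>U'\<close> is non-zero at both
  turning points: then a revolution takes finite time and the well survives small changes of level.
  This persistence is essential, since the transient of \<open>phi\<close> shifts the energy and a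
  trajectory settles on a level depending on its initial state; hence attraction is to the family
  and not to one orbit. Nothing in the hypotheses makes \<open>m\<close> and \<open>U\<close>
  periodic: they come from integrals along the line, which may pick up an increment over each turn.
  The energy is thus a function of the lifted angle. Confinement is argued on one strip of the lift
  and carried to the cylinder by translations through multiples of 2 pi, and boundedness from every
  initial state is claimed only for periodic \<open>m\<close> and \<open>U\<close>. The closed loop
  contains squares of velocities, so in general it is not globally Lipschitz. Trajectories are
  obtained for a truncated field, and a priori bounds show that the truncation is never
  felt.\<close>

lemma integral_has_vector_derivative_atLeast:
  fixes g :: "real \<Rightarrow> 'a::banach"
  assumes g: "continuous_on {0..} g" and t: "0 \<le> t"
  shows "((\<lambda>t. integral {0..t} g) has_vector_derivative g t) (at t within {0..})"
proof -
  have "((\<lambda>t. integral {0..t} g) has_vector_derivative g t) (at t within {0..t + 1})"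
    using t by (intro integral_has_vector_derivative continuous_on_subset[OF g]) auto
  moreover have "at t within {0..t + 1} = at t within {0..}"
    by (rule at_within_nhd[where S = "{..<t + 1}"]) (use t in auto)
  ultimately show ?thesis
    by simp
qed

text \<open>The weight \<open>exp (l * s)\<close> integrates to at most
  \<open>exp (l * t) / l\<close>; the gain \<open>1 / l\<close> turns a Lipschitz constant
  \<open>L\<close> into the contraction constant \<open>L / l\<close>.\<close>

lemma exp_weighted_integral_bound:
  fixes g :: "real \<Rightarrow> 'a::banach"
  assumes g: "continuous_on {0..t} g" and t: "0 \<le> t" and l: "0 < l" and D: "0 \<le> D"
    and bound: "\<And>s. 0 \<le> s \<Longrightarrow> s \<le> t \<Longrightarrow> norm (g s) \<le> D * exp (l * s)"
  shows "norm (exp (- l * t) *\<^sub>R integral {0..t} g) \<le> D / l"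
proof -
  have "((\<lambda>s. D * exp (l * s)) has_integral D / l * exp (l * t) - D / l * exp (l * 0)) {0..t}"
    using l t by (intro fundamental_theorem_of_calculus)
      (auto intro!: derivative_eq_intros simp flip: has_real_derivative_iff_has_vector_derivative)
  then have I: "((\<lambda>s. D * exp (l * s)) has_integral D / l * (exp (l * t) - 1)) {0..t}"
    by (simp add: algebra_simps)
  have "norm (integral {0..t} g) \<le> integral {0..t} (\<lambda>s. D * exp (l * s))"
    using bound by (intro integral_norm_bound_integral integrable_continuous_real g continuous_intros) auto
  also have "\<dots> = D / l * (exp (l * t) - 1)"
    using I by (rule integral_unique)
  also have "\<dots> \<le> D / l * exp (l * t)"
    using l D by (intro mult_left_mono) auto
  finally have "exp (- l * t) * norm (integral {0..t} g) \<le> exp (- l * t) * (D / l * exp (l * t))"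
    by (intro mult_left_mono) auto
  then show ?thesis
    by (simp add: exp_minus field_simps)
qed

text \<open>Banach's fixed point theorem on \<open>[0, \<infinity>)\<close> in the norm with weight \<open>exp (- l * t)\<close>, \<open>l > L\<close>.\<close>

theorem global_solution_lipschitz:
  fixes F :: "'a::banach \<Rightarrow> 'a"
  assumes L: "L-lipschitz_on UNIV F"
  shows "\<exists>x. solution F {0..} x \<and> x 0 = x0"
proof -
  \<comment> \<open>This gives \<open>L / l < 1 / 2\<close>; the summand 1 keeps \<open>l\<close>
    positive for \<open>L = 0\<close>.\<close>
  define l where "l = 2 * L + 1"
  have L0: "0 \<le> L" using L by (rule lipschitz_on_nonneg)
  then have l: "0 < l" by (simp add: l_def)
  have F_cont: "continuous_on UNIV F" using L by (rule lipschitz_on_continuous_on)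
  \<comment> \<open>The unknown \<open>y\<close> stands for
    \<open>exp (- l * t) *\<^sub>R (x t - x0)\<close>, which stays bounded even if \<open>x\<close>
    grows exponentially; \<open>g y\<close> is \<open>F\<close> along the trajectory so
    encoded.\<close>
  define g where "g y s = F (x0 + exp (l * s) *\<^sub>R apply_bcontfun y s)" for y :: "real \<Rightarrow>\<^sub>C 'a" and s
  have g_cont [continuous_intros]: "continuous_on A (g y)" for y A
    unfolding g_def by (intro continuous_on_compose2[OF F_cont] continuous_intros) auto
  \<comment> \<open>\<open>max 0 t\<close> extends the operator by 0 to negative times, since the
    bounded continuous functions live on the whole line.\<close>
  define T where "T y t = exp (- l * max 0 t) *\<^sub>R integral {0..max 0 t} (g y)"
    for y :: "real \<Rightarrow>\<^sub>C 'a" and t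
  have I_cont: "continuous_on {0..} (\<lambda>t. integral {0..t} (g y))" for y
    using integral_has_vector_derivative_atLeast[OF g_cont]
    by (auto simp: continuous_on_eq_continuous_within intro: has_vector_derivative_continuous)
  have T_cont: "continuous_on UNIV (T y)" for y
    unfolding T_def by (intro continuous_intros continuous_on_compose2[OF I_cont]) auto
  have T_bcont: "T y \<in> bcontfun" for y
  proof -
    have "norm (T y t) \<le> (norm (F x0) + L * norm y) / l" for t
      unfolding T_def
    proof (rule exp_weighted_integral_bound)
      fix s :: real assume s: "0 \<le> s"
      have "norm (g y s) \<le> norm (F x0) + dist (g y s) (F x0)"
        by (metis dist_norm norm_triangle_sub)
      also have "dist (g y s) (F x0) \<le> L * (exp (l * s) * norm (apply_bcontfun y s))"
        unfolding g_def using lipschitz_onD[OF L, of "x0 + exp (l * s) *\<^sub>R apply_bcontfun y s" x0]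
        by (simp add: dist_norm)
      also have "\<dots> \<le> L * (exp (l * s) * norm y)"
        using L0 by (intro mult_left_mono norm_bounded) auto
      also have "norm (F x0) \<le> norm (F x0) * exp (l * s)"
        using l s by (simp add: mult_le_cancel_left1)
      finally show "norm (g y s) \<le> (norm (F x0) + L * norm y) * exp (l * s)"
        by (simp add: algebra_simps)
    qed (use L0 l in \<open>auto intro!: g_cont\<close>)
    then show ?thesis
      using T_cont by (intro bcontfun_normI) auto
  qed
  have "dist (Bcontfun (T y)) (Bcontfun (T z)) \<le> L / l * dist y z" for y z
  proof (rule dist_bound)
    fix t
    have "T y t - T z t = exp (- l * max 0 t) *\<^sub>R integral {0..max 0 t} (\<lambda>s. g y s - g z s)"
      unfolding T_def
      by (subst integral_diff) (auto intro!: integrable_continuous_real g_cont simp: scaleR_diff_right)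
    also have "norm \<dots> \<le> (L * dist y z) / l"
    proof (rule exp_weighted_integral_bound)
      fix s :: real
      have "norm (g y s - g z s) \<le> L * (exp (l * s) * dist (apply_bcontfun y s) (apply_bcontfun z s))"
        unfolding g_def using lipschitz_onD[OF L, of "x0 + exp (l * s) *\<^sub>R apply_bcontfun y s"
            "x0 + exp (l * s) *\<^sub>R apply_bcontfun z s"]
        by (simp add: dist_norm flip: scaleR_diff_right)
      also have "\<dots> \<le> L * (exp (l * s) * dist y z)"
        using L0 by (intro mult_left_mono dist_bounded) auto
      finally show "norm (g y s - g z s) \<le> L * dist y z * exp (l * s)"
        by (simp add: algebra_simps)
    qed (use L0 l in \<open>auto intro!: continuous_intros\<close>)
    finally show "dist (apply_bcontfun (Bcontfun (T y)) t) (apply_bcontfun (Bcontfun (T z)) t)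
        \<le> L / l * dist y z"
      by (simp add: Bcontfun_inverse T_bcont dist_norm)
  qed
  then have "\<exists>!y. Bcontfun (T y) = y"
    using L0 l by (intro banach_fix_type[of "L / l"]) (auto simp: l_def)
  then obtain y where "Bcontfun (T y) = y"
    by blast
  then have y: "apply_bcontfun y = T y"
    by (metis Bcontfun_inverse T_bcont)
  define x where "x t = x0 + integral {0..t} (g y)" for t
  have x_g: "F (x t) = g y t" if "0 \<le> t" for t
    using that by (simp add: g_def x_def y T_def exp_minus)
  have "solution F {0..} x"
    unfolding solution_def
  proof
    fix t :: real assume "t \<in> {0..}"
    then have "0 \<le> t" by simp
    then show "(x has_vector_derivative F (x t)) (at t within {0..})"
      unfolding x_g[OF \<open>0 \<le> t\<close>] unfolding x_def
      by (auto intro!: derivative_eq_intros integral_has_vector_derivative_atLeast g_cont)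
  qed
  moreover have "x 0 = x0"
    by (simp add: x_def)
  ultimately show ?thesis
    by blast
qed

text \<open>Bootstrap argument: \<open>Q\<close> consists of strict bounds, \<open>C\<close> of
  relaxed ones, and \<open>step\<close> improves the relaxed bounds up to time \<open>t\<close> to
  strict ones at \<open>t\<close>. At a first exit time from \<open>Q\<close> the left limit still
  lies in \<open>C\<close>, so \<open>step\<close> contradicts the exit.\<close>

lemma stays_in_open:
  fixes x :: "real \<Rightarrow> 'a::topological_space"
  assumes x: "continuous_on {0..T} x" and Q: "open Q" and C: "closed C" and QC: "Q \<subseteq> C"
    and init: "x 0 \<in> Q"
    and step: "\<And>t. 0 \<le> t \<Longrightarrow> t \<le> T \<Longrightarrow> (\<And>s. 0 \<le> s \<Longrightarrow> s \<le> t \<Longrightarrow> x s \<in> C) \<Longrightarrow> x t \<in> Q"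
    and t: "0 \<le> t" "t \<le> T"
  shows "x t \<in> Q"
proof (rule ccontr)
  assume nt: "x t \<notin> Q"
  define S where "S = {0..T} \<inter> x -` (- Q)"
  have "closed S"
    unfolding S_def using x Q by (intro continuous_closed_preimage) auto
  moreover have bb: "bdd_below S"
    by (auto simp: S_def bdd_below_def)
  moreover have "S \<noteq> {}"
    using nt t by (auto simp: S_def)
  ultimately have Inf: "Inf S \<in> S"
    by (intro closed_contains_Inf)
  define t0 where "t0 = Inf S"
  have t0: "0 \<le> t0" "t0 \<le> T" "x t0 \<notin> Q"
    using Inf by (auto simp: S_def t0_def)
  have before: "x r \<in> Q" if "0 \<le> r" "r < t0" for r
    using that t0 cInf_lower[OF _ bb, of r] by (force simp: S_def t0_def)
  have "t0 > 0"
    using t0 init by (cases "t0 = 0") auto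
  have "x t0 \<in> C"
  proof -
    have "(x \<longlongrightarrow> x t0) (at t0 within {0..T})"
      using x t0 by (auto simp: continuous_on)
    then have "(x \<longlongrightarrow> x t0) (at t0 within {0..<t0})"
      by (rule tendsto_within_subset) (use t0 in auto)
    moreover have "at t0 within {0..<t0} \<noteq> bot"
      using \<open>t0 > 0\<close> by (simp add: at_within_eq_bot_iff)
    moreover have "\<forall>\<^sub>F r in at t0 within {0..<t0}. x r \<in> C"
      using before QC by (auto simp: eventually_at_filter intro!: always_eventually)
    ultimately show ?thesis
      using C by (intro Lim_in_closed_set)
  qed
  then have "x r \<in> C" if "0 \<le> r" "r \<le> t0" for r
    using before[of r] that QC by (cases "r = t0") auto
  then show False
    using step[of t0] t0 by auto
qed

text \<open>The points of \<open>S\<close> whose image is at distance at least \<open>r\<close> from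
  \<open>B\<close> form a compact set, and its image under \<open>G\<close> misses \<open>l\<close>.
  Thus convergence of the invariants \<open>G\<close> suffices, and the phase along the limit orbit
  need not be tracked.\<close>

lemma infdist_tendsto_0_compact:
  fixes x :: "real \<Rightarrow> 'a::metric_space" and G :: "'a \<Rightarrow> 'b::t2_space" and e :: "'a \<Rightarrow> 'c::metric_space"
  assumes S: "compact S" and G: "continuous_on S G" and e: "continuous_on S e"
    and xS: "\<And>t. 0 \<le> t \<Longrightarrow> x t \<in> S" and lim: "((\<lambda>t. G (x t)) \<longlongrightarrow> l) at_top"
    and B: "\<And>z. z \<in> S \<Longrightarrow> G z = l \<Longrightarrow> e z \<in> B"
  shows "((\<lambda>t. infdist (e (x t)) B) \<longlongrightarrow> 0) at_top"
proof (rule tendstoI)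
  fix r :: real assume r: "0 < r"
  define Z where "Z = S \<inter> (\<lambda>z. infdist (e z) B) -` {r..}"
  have "closedin (top_of_set S) Z"
    unfolding Z_def by (intro continuous_closedin_preimage continuous_intros e)
  then have "compact Z"
    using S closedin_compact by blast
  then have "compact (G ` Z)"
    by (intro compact_continuous_image continuous_on_subset[OF G]) (auto simp: Z_def)
  then have "open (- (G ` Z))"
    by (simp add: compact_imp_closed open_Compl)
  moreover have "l \<notin> G ` Z"
    using B r by (auto simp: Z_def)
  ultimately have "\<forall>\<^sub>F t in at_top. G (x t) \<in> - (G ` Z)"
    using lim topological_tendstoD by fastforce
  then show "\<forall>\<^sub>F t in at_top. dist (infdist (e (x t)) B) 0 < r"
    using eventually_ge_at_top[of 0]
  proof eventually_elim
    case (elim t)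
    then have "\<not> r \<le> infdist (e (x t)) B"
      using xS[of t] by (auto simp: Z_def)
    then show ?case
      by (simp add: infdist_nonneg)
  qed
qed

subsection \<open>Potential wells\<close>

lemma nonincreasing_within:
  fixes f :: "real \<Rightarrow> real"
  assumes "a \<le> b"
    and "\<And>t. a \<le> t \<Longrightarrow> t \<le> b \<Longrightarrow> (f has_real_derivative f' t) (at t within {a..b})"
    and "\<And>t. a \<le> t \<Longrightarrow> t \<le> b \<Longrightarrow> f' t \<le> 0"
  shows "f b \<le> f a"
proof -
  have "\<exists>x\<in>{a..b}. f b - f a = f' x * (b - a)"
    using assms by (intro mvt_very_simple) (auto simp: has_field_derivative_def)
  then obtain x where "x \<in> {a..b}" "f b - f a = f' x * (b - a)"
    by blast
  moreover have "f' x * (b - a) \<le> 0"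
    using assms calculation by (intro mult_nonpos_nonneg) auto
  ultimately show ?thesis by simp
qed

lemma has_real_derivative_interval_integral:
  fixes f :: "real \<Rightarrow> real"
  assumes f: "continuous_on UNIV f"
  shows "((\<lambda>x. LBINT r=0..ereal x. f r) has_real_derivative f x) (at x)"
proof -
  define a b where "a = min 0 x - 1" and "b = max 0 x + 1"
  have "((\<lambda>u. LBINT r=ereal 0..ereal u. f r) has_vector_derivative f x) (at x within {a..b})"
    by (rule interval_integral_FTC2) (auto simp: a_def b_def intro: continuous_on_subset[OF f])
  moreover have "at x within {a..b} = at x"
    by (rule at_within_Icc_at) (auto simp: a_def b_def)
  ultimately show ?thesis
    by (simp add: has_real_derivative_iff_has_vector_derivative zero_ereal_def)
qed

text \<open>l'Hopital's rule for the difference quotient. It supplies the derivative of the velocity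
  at turning points, where a square root formula breaks down.\<close>

lemma DERIV_of_limit:
  fixes f :: "real \<Rightarrow> real"
  assumes f: "isCont f t" and f': "isCont f' t"
    and D: "\<forall>\<^sub>F u in at t. (f has_real_derivative f' u) (at u)"
  shows "(f has_real_derivative f' t) (at t)"
proof -
  have "((\<lambda>u. (f u - f t) / (u - t)) \<longlongrightarrow> f' t) (at t)"
  proof (rule lhopital[where f' = f' and g' = "\<lambda>_. 1"])
    show "((\<lambda>u. f u - f t) \<longlongrightarrow> 0) (at t)"
      using f LIM_zero isCont_def by blast
    show "((\<lambda>u. u - t) \<longlongrightarrow> 0) (at t)"
      by (simp add: LIM_zero)
    show "\<forall>\<^sub>F u in at t. u - t \<noteq> 0"
      by (auto simp: eventually_at_filter)
    show "\<forall>\<^sub>F u in at t. ((\<lambda>u. f u - f t) has_real_derivative f' u) (at u)"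
      using D by eventually_elim (auto intro!: derivative_eq_intros)
    show "\<forall>\<^sub>F u in at t. ((\<lambda>u. u - t) has_real_derivative 1) (at u)"
      by (intro always_eventually) (auto intro!: derivative_eq_intros)
    show "((\<lambda>u. f' u / 1) \<longlongrightarrow> f' t) (at t)"
      using f' by (simp add: isCont_def)
  qed auto
  then show ?thesis
    by (simp add: has_field_derivative_iff)
qed

lemma first_crossing:
  fixes f :: "real \<Rightarrow> real"
  assumes f: "continuous_on {p..q} f" and pq: "p \<le> q" and d: "f p < d" "d \<le> f q"
  obtains z where "p < z" "z \<le> q" "f z = d" "\<And>x. p \<le> x \<Longrightarrow> x < z \<Longrightarrow> f x < d"
proof -
  define S where "S = {p..q} \<inter> f -` {d..}"
  have "closed S"
    unfolding S_def using f by (intro continuous_closed_preimage) auto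
  moreover have bb: "bdd_below S"
    by (auto simp: S_def bdd_below_def)
  moreover have "S \<noteq> {}"
    using d pq by (auto simp: S_def)
  ultimately have Inf: "Inf S \<in> S"
    by (intro closed_contains_Inf)
  define z where "z = Inf S"
  have z: "p \<le> z" "z \<le> q" "d \<le> f z"
    using Inf by (auto simp: S_def z_def)
  have before: "f x < d" if "p \<le> x" "x < z" for x
    using that z cInf_lower[OF _ bb, of x] by (force simp: S_def z_def)
  have "\<exists>x. p \<le> x \<and> x \<le> z \<and> f x = d"
    using z d by (intro IVT' continuous_on_subset[OF f]) auto
  then obtain x where "p \<le> x" "x \<le> z" "f x = d"
    by blast
  with before[of x] have "f z = d"
    by (cases "x = z") auto
  moreover have "p < z"
    using z d by (cases "p = z") auto
  ultimately show ?thesis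
    using that z before by blast
qed

text \<open>A point where \<open>f\<close> minus a small linear function first reaches a given level is regular
  for \<open>f\<close>; this replaces Sard's theorem.\<close>

lemma regular_first_crossing:
  fixes f :: "real \<Rightarrow> real"
  assumes f: "\<And>x. (f has_real_derivative f' x) (at x)" and pq: "p < q" and less: "f p < f q"
  obtains z where "p < z" "z \<le> q" "f p < f z" "f z < f q" "f' z > 0"
    "\<And>x. p \<le> x \<Longrightarrow> x < z \<Longrightarrow> f x < f z"
proof -
  \<comment> \<open>Half the mean slope: after subtracting \<open>k * (x - p)\<close> the function
    still rises from \<open>p\<close> to \<open>q\<close>.\<close>
  define k where "k = (f q - f p) / 2 / (q - p)"
  have k: "0 < k"
    using pq less by (simp add: k_def)
  have k2: "k * (q - p) = (f q - f p) / 2"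
    by (rule iffD1[OF nonzero_eq_divide_eq]) (use pq k_def in auto)
  define g where "g x = f x - k * (x - p)" for x
  define d where "d = (g p + g q) / 2"
  have g: "(g has_real_derivative f' x - k) (at x)" for x
    unfolding g_def by (auto intro!: derivative_eq_intros f)
  have "g q - g p = k * (q - p)"
    using k2 by (simp add: g_def)
  moreover have "k * (q - p) > 0"
    using k pq by simp
  ultimately have d: "g p < d" "d < g q"
    by (auto simp: d_def)
  obtain z where z: "p < z" "z \<le> q" "g z = d" and before: "\<And>x. p \<le> x \<Longrightarrow> x < z \<Longrightarrow> g x < d"
    using first_crossing[of p q g d] pq d g
    by (metis DERIV_isCont continuous_at_imp_continuous_on less_imp_le)
  \<comment> \<open>Otherwise \<open>g\<close> would exceed its level just to the left of its first
    crossing. So \<open>f' z\<close> is at least \<open>k\<close>.\<close>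
  have "\<not> f' z - k < 0"
  proof
    assume "f' z - k < 0"
    then obtain e where e: "0 < e" "\<And>h. 0 < h \<Longrightarrow> h < e \<Longrightarrow> g z < g (z - h)"
      using DERIV_neg_dec_left[OF g] by blast
    define h where "h = min (e / 2) (z - p)"
    have "0 < h" "h < e" "p \<le> z - h"
      using e z by (auto simp: h_def)
    then show False
      using e(2)[of h] before[of "z - h"] z by auto
  qed
  then have "f' z > 0"
    using k by simp
  moreover have "f x < f z" if "p \<le> x" "x < z" for x
  proof -
    have "k * (x - p) < k * (z - p)"
      using k that by simp
    then show ?thesis
      using before[OF that] z by (simp add: g_def)
  qed
  moreover have "f p < f z"
    using calculation z by auto
  moreover have "f z < f q"
  proof -
    have "k * (z - p) \<le> k * (q - p)"
      using k z by simp
    then show ?thesis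
      using d z by (simp add: g_def)
  qed
  ultimately show ?thesis
    using that z by blast
qed

text \<open>Inside, \<open>U\<close> is only required to stay below the level and may have several
  critical points. The signs of \<open>U'\<close> at the ends make the turning points
  regular.\<close>

definition well :: "(real \<Rightarrow> real) \<Rightarrow> (real \<Rightarrow> real) \<Rightarrow> real \<Rightarrow> real \<Rightarrow> real \<Rightarrow> bool" where
  "well U U' a b c \<longleftrightarrow> a < b \<and> U a = c \<and> U b = c \<and> (\<forall>x. a < x \<and> x < b \<longrightarrow> U x < c) \<and>
     U' a < 0 \<and> U' b > 0"

text \<open>Both ends must be regular at the same level. A regular point \<open>b0\<close> on the
  right yields a whole window of levels whose right end is regular, because \<open>U'\<close> is
  positive near \<open>b0\<close>; a regular point on the left is then sought with its level in that
  window.\<close>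

lemma well_near_strict_local_min:
  fixes U :: "real \<Rightarrow> real"
  assumes U: "\<And>x. (U has_real_derivative U' x) (at x)" and U': "continuous_on UNIV U'"
    and min: "strict_local_min U x0"
  shows "\<exists>a b c. well U U' a b c"
proof -
  have U_cont: "continuous_on A U" for A
    using U by (meson DERIV_isCont continuous_at_imp_continuous_on)
  obtain e0 where e0: "e0 > 0" "\<And>y. y \<noteq> x0 \<Longrightarrow> dist y x0 < e0 \<Longrightarrow> U x0 < U y"
    using min unfolding strict_local_min_def eventually_at by auto
  define e where "e = e0 / 2"
  have e: "0 < e" "U x0 < U (x0 - e)" "U x0 < U (x0 + e)"
    using e0(1) e0(2)[of "x0 - e"] e0(2)[of "x0 + e"] by (auto simp: e_def dist_real_def)
  define v where "v = min (U (x0 - e)) (U (x0 + e))"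
  have v: "U x0 < v" "v \<le> U (x0 - e)" "v \<le> U (x0 + e)"
    using e by (auto simp: v_def)
  obtain q where q: "x0 < q" "U q = v"
    using first_crossing[OF U_cont, of x0 "x0 + e" v] e v by (metis less_add_same_cancel1 less_imp_le)
  obtain b0 where b0: "x0 < b0" "b0 \<le> q" "U x0 < U b0" "U b0 < v" "U' b0 > 0"
    and b0_first: "\<And>x. x0 \<le> x \<Longrightarrow> x < b0 \<Longrightarrow> U x < U b0"
    using regular_first_crossing[OF U q(1)] v q by metis
  have "\<forall>\<^sub>F x in nhds b0. U' x > 0"
    using U' b0 by (intro order_tendstoD(1)[of U' "U' b0"])
      (auto simp: continuous_on_eq_continuous_at isCont_def tendsto_nhds_iff)
  then obtain h where h: "h > 0" "\<And>x. dist x b0 < h \<Longrightarrow> U' x > 0"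
    by (auto simp: eventually_nhds_metric)
  define p1 where "p1 = max x0 (b0 - h / 2)"
  have p1: "x0 \<le> p1" "p1 < b0"
    using b0 h by (auto simp: p1_def)
  have U'_pos: "U' x > 0" if "p1 \<le> x" "x \<le> b0" for x
    using that h by (auto simp: p1_def dist_real_def)
  obtain M where M: "M \<in> {x0..p1}" "\<And>x. x \<in> {x0..p1} \<Longrightarrow> U x \<le> U M"
    using continuous_attains_sup[of "{x0..p1}" U] p1 U_cont by auto
  have UM: "U M < U b0"
    using M p1 b0_first by auto
  define c1 where "c1 = (U M + U b0) / 2"
  have c1: "U M < c1" "c1 < U b0"
    using UM by (auto simp: c1_def)
  \<comment> \<open>Reflection, so that the crossing lemmas for rising functions apply on the left
    of \<open>x0\<close>.\<close>
  define f where "f y = U (- y)" for y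
  have f: "(f has_real_derivative - U' (- y)) (at y)" for y
  proof -
    have "(uminus has_real_derivative - 1) (at y)"
      by (auto intro!: derivative_eq_intros)
    from DERIV_chain2[OF U this] show ?thesis
      by (simp add: f_def[abs_def])
  qed
  have f_cont: "continuous_on A f" for A
    using f by (meson DERIV_isCont continuous_at_imp_continuous_on)
  have fx0: "f (- x0) < c1"
    using M(2)[of x0] p1 c1 by (auto simp: f_def)
  \<comment> \<open>Starting the search for the left end at the first crossing of \<open>c1\<close>
    forces its level above \<open>c1\<close>, the bottom of the window, and leaves no higher point
    between \<open>- z1\<close> and \<open>x0\<close>.\<close>
  obtain z1 where z1: "- x0 < z1" "z1 \<le> - x0 + e" "f z1 = c1"
    and z1_first: "\<And>x. - x0 \<le> x \<Longrightarrow> x < z1 \<Longrightarrow> f x < c1"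
    using first_crossing[of "- x0" "- x0 + e" f c1] f_cont e fx0 v b0 c1 by (auto simp: f_def)
  have "f z1 < U b0"
    using z1 c1 by simp
  moreover have "U b0 \<le> f (- x0 + e)"
    using b0 v by (simp add: f_def)
  ultimately obtain z2 where z2: "z1 < z2" "f z2 = U b0"
    using first_crossing[of z1 "- x0 + e" f "U b0"] f_cont z1 by metis
  obtain z3 where z3: "z1 < z3" "c1 < f z3" "f z3 < U b0" "- U' (- z3) > 0"
    and z3_first: "\<And>x. z1 \<le> x \<Longrightarrow> x < z3 \<Longrightarrow> f x < f z3"
    using regular_first_crossing[OF f z2(1)] z2 z1 c1 by metis
  define a c where "a = - z3" and "c = f z3"
  have "U p1 < c"
    using M(2)[of p1] p1 c1 z3 by (auto simp: c_def)
  then obtain b where b: "p1 < b" "b \<le> b0" "U b = c"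
    and b_first: "\<And>x. p1 \<le> x \<Longrightarrow> x < b \<Longrightarrow> U x < c"
    using first_crossing[of p1 b0 U c] U_cont p1 z3 c_def by (metis less_imp_le)
  have "U x < c" if "a < x" "x < b" for x
  proof -
    consider "x < - z1" | "- z1 \<le> x" "x \<le> x0" | "x0 \<le> x" "x \<le> p1" | "p1 \<le> x"
      by linarith
    then show ?thesis
    proof cases
      case 1
      then show ?thesis
        using z3_first[of "- x"] that by (auto simp: a_def c_def f_def)
    next
      case 2
      then have "f (- x) < c1 \<or> f (- x) = c1"
        using z1_first[of "- x"] z1 by (cases "x = - z1") auto
      then show ?thesis
        using z3 by (auto simp: c_def f_def)
    next
      case 3
      then show ?thesis
        using M(2)[of x] c1 z3 by (auto simp: c_def)
    next
      case 4
      then show ?thesis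
        using b_first that by auto
    qed
  qed
  then have "well U U' a b c"
    using z3 z1 b p1 U'_pos[of b] unfolding well_def by (auto simp: a_def c_def f_def)
  then show ?thesis
    by blast
qed

text \<open>Near each end \<open>U\<close> is strictly monotone, so a nearby level crosses once
  there, while the part in between stays below all these levels. The values at \<open>a - r\<close>
  and \<open>b + r\<close> serve as energy barriers; the last clause says that limit points of a
  confined trajectory can only lie over the perturbed well.\<close>

lemma nearby_wells:
  fixes U :: "real \<Rightarrow> real"
  assumes U: "\<And>x. (U has_real_derivative U' x) (at x)" and U': "continuous_on UNIV U'"
    and w: "well U U' a b c"
  obtains r h where "0 < r" "0 < h" "c + h < U (a - r)" "c + h < U (b + r)"
    "\<And>d. \<bar>d - c\<bar> \<le> h \<Longrightarrow> \<exists>a' b'. well U U' a' b' d \<and> a - r < a' \<and> b' < b + r \<and>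
       (\<forall>x\<in>{a - r..b + r}. U x \<le> d \<longrightarrow> x \<in> {a'..b'})"
proof -
  have ab: "a < b" "U a = c" "U b = c" "\<And>x. a < x \<Longrightarrow> x < b \<Longrightarrow> U x < c" "U' a < 0" "U' b > 0"
    using w by (auto simp: well_def)
  have U_cont: "continuous_on A U" for A
    using U by (meson DERIV_isCont continuous_at_imp_continuous_on)
  have "\<forall>\<^sub>F x in nhds a. U' x < 0"
    using U' ab by (intro order_tendstoD(2)[of U' "U' a"])
      (auto simp: continuous_on_eq_continuous_at isCont_def tendsto_nhds_iff)
  then obtain r1 where r1: "r1 > 0" "\<And>x. dist x a < r1 \<Longrightarrow> U' x < 0"
    by (auto simp: eventually_nhds_metric)
  have "\<forall>\<^sub>F x in nhds b. U' x > 0"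
    using U' ab by (intro order_tendstoD(1)[of U' "U' b"])
      (auto simp: continuous_on_eq_continuous_at isCont_def tendsto_nhds_iff)
  then obtain r2 where r2: "r2 > 0" "\<And>x. dist x b < r2 \<Longrightarrow> U' x > 0"
    by (auto simp: eventually_nhds_metric)
  \<comment> \<open>The factor 1/3 keeps the neighbourhoods of \<open>a\<close> and \<open>b\<close>
    disjoint and inside the regions where \<open>U'\<close> has a fixed sign.\<close>
  define r where "r = min (min r1 r2) (b - a) / 3"
  have r: "0 < r" "r < r1" "r < r2" "a + r < b - r"
    using r1 r2 ab by (auto simp: r_def min_def field_simps)
  have dec: "U y < U x" if "a - r \<le> x" "x < y" "y \<le> a + r" for x y
    by (rule DERIV_neg_imp_decreasing[OF that(2)])
      (use that r r1 U in \<open>auto simp: dist_real_def intro!: exI[of _ "U' _"]\<close>)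
  have inc: "U x < U y" if "b - r \<le> x" "x < y" "y \<le> b + r" for x y
    by (rule DERIV_pos_imp_increasing[OF that(2)])
      (use that r r2 U in \<open>auto simp: dist_real_def intro!: exI[of _ "U' _"]\<close>)
  obtain M where M: "M \<in> {a + r..b - r}" "\<And>x. x \<in> {a + r..b - r} \<Longrightarrow> U x \<le> U M"
    using continuous_attains_sup[of "{a + r..b - r}" U] r U_cont by auto
  have UM: "U M < c"
    using M r by (intro ab) auto
  \<comment> \<open>Half of the smallest gap between \<open>c\<close> and the two barriers or the
    interior maximum, so that all comparisons for levels within \<open>h\<close> of \<open>c\<close>
    stay strict.\<close>
  define h where "h = min (min (U (a - r) - c) (U (b + r) - c)) (c - U M) / 2"
  have h: "0 < h" "c + h < U (a - r)" "c + h < U (b + r)" "U M < c - h"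
    using UM dec[of "a - r" a] inc[of b "b + r"] r ab by (auto simp: h_def min_def field_simps)
  have "\<exists>a' b'. well U U' a' b' d \<and> a - r < a' \<and> b' < b + r \<and>
       (\<forall>x\<in>{a - r..b + r}. U x \<le> d \<longrightarrow> x \<in> {a'..b'})" if "\<bar>d - c\<bar> \<le> h" for d
  proof -
    have d: "U M < d" "d < U (a - r)" "d < U (b + r)"
      using that h by auto
    have "\<exists>x. a - r \<le> x \<and> x \<le> a + r \<and> U x = d"
      using d M(2)[of "a + r"] r by (intro IVT2' U_cont) auto
    then obtain a' where a': "a - r \<le> a'" "a' \<le> a + r" "U a' = d"
      by blast
    have "\<exists>x. b - r \<le> x \<and> x \<le> b + r \<and> U x = d"
      using d M(2)[of "b - r"] r by (intro IVT' U_cont) auto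
    then obtain b' where b': "b - r \<le> b'" "b' \<le> b + r" "U b' = d"
      by blast
    have ne: "a' \<noteq> a - r" "b' \<noteq> b + r"
      using a' b' d by auto
    have "U x < d" if x: "a' < x" "x < b'" for x
    proof -
      consider "x \<le> a + r" | "b - r \<le> x" | "x \<in> {a + r..b - r}"
        by fastforce
      then show ?thesis
        using dec[of a' x] inc[of x b'] M(2)[of x] x a' b' d by cases auto
    qed
    then have "well U U' a' b' d"
      using a' b' r r1(2)[of a'] r2(2)[of b'] unfolding well_def by (auto simp: dist_real_def)
    moreover have "x \<in> {a'..b'}" if x: "x \<in> {a - r..b + r}" "U x \<le> d" for x
      using dec[of x a'] inc[of b' x] x a' b' by fastforce
    ultimately show ?thesis
      using a' b' ne by (intro exI[of _ a'] exI[of _ b']) auto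
  qed
  with r h that show ?thesis
    by blast
qed

subsection \<open>Periodic orbits around a well\<close>

text \<open>Separation of variables: \<open>G y\<close>, the integral of \<open>1 / g\<close>, is
  the time needed to reach the angle \<open>y\<close>, \<open>\<Theta>\<close> is its inverse, and
  the period is the time of one revolution.\<close>

lemma increasing_reparametrization:
  fixes g :: "real \<Rightarrow> real"
  assumes g: "continuous_on UNIV g" and pos: "\<And>y. 0 < g y" and bdd: "\<And>y. g y \<le> Q"
    and per: "\<And>y. g (y + 2 * pi) = g y"
  obtains T \<Theta> G where "0 < T" "\<And>t. (\<Theta> has_real_derivative g (\<Theta> t)) (at t)"
    "\<And>t. \<Theta> (t + T) = \<Theta> t + 2 * pi" "\<And>y. \<Theta> (G y) = y" "strict_mono G" "G 0 = 0" "G (2 * pi) = T"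
proof -
  define G where "G y = (LBINT r=0..ereal y. 1 / g r)" for y
  have G: "(G has_real_derivative 1 / g y) (at y)" for y
    unfolding G_def[abs_def]
    by (intro has_real_derivative_interval_integral continuous_intros g) (use pos in \<open>auto simp: less_imp_neq[symmetric]\<close>)
  have Q: "0 < Q"
    using pos[of 0] bdd[of 0] by simp
  have mono: "strict_mono G"
    by (intro strict_monoI DERIV_pos_imp_increasing[of _ _ G])
      (use G pos in \<open>auto intro!: exI[of _ "1 / g _"]\<close>)
  have G0: "G 0 = 0"
    by (simp add: G_def zero_ereal_def)
  define T where "T = G (2 * pi)"
  have T: "0 < T"
    using strict_monoD[OF mono, of 0 "2 * pi"] G0 by (simp add: T_def)
  have "((\<lambda>y. G (y + 2 * pi) - G y) has_real_derivative 0) (at y)" for y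
  proof -
    have "((\<lambda>y. G (y + 2 * pi) - G y) has_real_derivative 1 / g (y + 2 * pi) * 1 - 1 / g y) (at y)"
      by (intro DERIV_diff G DERIV_chain2[where f = G]) (auto intro!: derivative_eq_intros)
    then show ?thesis
      by (simp add: per)
  qed
  then have "G (y + 2 * pi) - G y = G (0 + 2 * pi) - G 0" for y
    using DERIV_isconst_all[of "\<lambda>y. G (y + 2 * pi) - G y" y 0] by simp
  then have GT: "G (y + 2 * pi) = G y + T" for y
    using G0 by (simp add: T_def algebra_simps)
  \<comment> \<open>The upper bound on \<open>g\<close> makes \<open>G\<close> grow at least
    linearly, hence onto; so \<open>\<Theta>\<close> is defined for all times.\<close>
  have lower: "(y - z) / Q \<le> G y - G z" if "z \<le> y" for y z
  proof -
    have "G z - z / Q \<le> G y - y / Q"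
    proof (rule DERIV_nonneg_imp_nondecreasing[OF that])
      fix x
      have "((\<lambda>y. G y - y / Q) has_real_derivative 1 / g x - 1 / Q) (at x)"
        using Q by (auto intro!: derivative_eq_intros G)
      moreover have "0 \<le> 1 / g x - 1 / Q"
        using pos[of x] bdd[of x] by (simp add: frac_le)
      ultimately show "\<exists>d. ((\<lambda>y. G y - y / Q) has_real_derivative d) (at x) \<and> 0 \<le> d"
        by blast
    qed
    then show ?thesis
      by (simp add: diff_divide_distrib)
  qed
  have G_cont: "continuous_on A G" for A
    using G by (meson DERIV_isCont continuous_at_imp_continuous_on)
  have "\<exists>y. G y = t" for t
  proof -
    have "\<exists>y. - (\<bar>t\<bar> * Q) \<le> y \<and> y \<le> \<bar>t\<bar> * Q \<and> G y = t"
    proof (rule IVT')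
      show "G (- (\<bar>t\<bar> * Q)) \<le> t"
        using lower[of "- (\<bar>t\<bar> * Q)" 0] Q G0 by simp
      show "t \<le> G (\<bar>t\<bar> * Q)"
        using lower[of 0 "\<bar>t\<bar> * Q"] Q G0 by simp
    qed (use Q G_cont in auto)
    then show ?thesis
      by blast
  qed
  then obtain \<Theta> where \<Theta>: "G (\<Theta> t) = t" for t
    by metis
  have inv: "\<Theta> (G y) = y" for y
    using \<Theta>[of "G y"] strict_mono_eq[OF mono] by blast
  have \<Theta>_cont: "isCont \<Theta> t" for t
    using isCont_inverse_function[of 1 "\<Theta> t" \<Theta> G] inv \<Theta> G DERIV_isCont by fastforce
  have "(\<Theta> has_real_derivative inverse (1 / g (\<Theta> t))) (at t)" for t
    by (rule DERIV_inverse_function[where f = G and a = "t - 1" and b = "t + 1"])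
      (use G pos \<Theta> \<Theta>_cont in \<open>auto simp: less_imp_neq[symmetric]\<close>)
  moreover have "\<Theta> (t + T) = \<Theta> t + 2 * pi" for t
    using inv[of "\<Theta> t + 2 * pi"] by (simp add: GT \<Theta>)
  ultimately show ?thesis
    using that[OF T _ _ inv mono G0 T_def[symmetric]] by simp
qed

text \<open>The level curve \<open>m x * y\<^sup>2 / 2 + U x = c\<close> over a well is parametrized by
  \<open>x = (a + b) / 2 - (b - a) / 2 * cos \<theta>\<close>; on it the target dynamics becomes \<open>\<theta>' = g \<theta>\<close> with
  \<open>g\<close> positive and continuous even at the turning points. At these, \<open>y' = \<rho> + \<beta> * y\<^sup>2\<close> holds by
  continuity.\<close>

lemma level_curve:
  fixes U m rho beta :: "real \<Rightarrow> real"
  assumes U: "\<And>x. (U has_real_derivative U' x) (at x)" and U'_eq: "\<And>x. U' x = - (rho x * m x)"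
    and m: "\<And>x. (m has_real_derivative - 2 * beta x * m x) (at x)" and m_pos: "\<And>x. 0 < m x"
    and rho: "continuous_on UNIV rho" and beta: "continuous_on UNIV beta"
    and w: "well U U' a b c"
  obtains x y T where "0 < T"
    "\<And>t. (x has_real_derivative y t) (at t)"
    "\<And>t. (y has_real_derivative rho (x t) + beta (x t) * (y t)\<^sup>2) (at t)"
    "\<And>t. x (t + T) = x t" "\<And>t. y (t + T) = y t"
    "\<And>t. x t \<in> {a..b}" "\<And>t. m (x t) * (y t)\<^sup>2 / 2 + U (x t) = c"
    "\<And>p q. p \<in> {a..b} \<Longrightarrow> m p * q\<^sup>2 / 2 + U p = c \<Longrightarrow> \<exists>t\<in>{0..T}. x t = p \<and> y t = q"
proof -
  have ab: "a < b" "U a = c" "U b = c" "\<And>x. a < x \<Longrightarrow> x < b \<Longrightarrow> U x < c" "U' a < 0" "U' b > 0"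
    using w by (auto simp: well_def)
  have U_cont: "continuous_on A U" for A
    using U by (meson DERIV_isCont continuous_at_imp_continuous_on)
  have m_cont: "continuous_on A m" for A
    using m by (meson DERIV_isCont continuous_at_imp_continuous_on)
  \<comment> \<open>The simple zeros of \<open>c - U\<close> at the ends are divided out. The end
    values are the limits of the quotient, and they are positive because of the signs of
    \<open>U'\<close> there.\<close>
  define k where "k x = (if x = a then - U' a / (b - a) else if x = b then U' b / (b - a)
      else (c - U x) / ((x - a) * (b - x)))" for x
  have k_pos: "0 < k x" if "x \<in> {a..b}" for x
    using that ab by (auto simp: k_def divide_neg_pos intro!: divide_pos_pos mult_pos_pos)
  have k_eq: "(x - a) * (b - x) * k x = c - U x" if "x \<in> {a..b}" for x
    using that ab by (auto simp: k_def)
  have k_cont: "continuous_on {a..b} k"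
    unfolding continuous_on_def
  proof
    fix x assume x: "x \<in> {a..b}"
    consider "x = a" | "x = b" | "a < x" "x < b"
      using x by fastforce
    then show "(k \<longlongrightarrow> k x) (at x within {a..b})"
    proof cases
      case 1
      have "((\<lambda>y. - ((U y - U a) / (y - a)) / (b - y)) \<longlongrightarrow> - U' a / (b - a)) (at a)"
        using U[of a] ab unfolding has_field_derivative_iff by (intro tendsto_intros) auto
      then have "((\<lambda>y. - ((U y - U a) / (y - a)) / (b - y)) \<longlongrightarrow> k a) (at a within {a..b})"
        by (auto simp: k_def intro: tendsto_within_subset)
      moreover have "\<forall>\<^sub>F y in at a within {a..b}. - ((U y - U a) / (y - a)) / (b - y) = k y"
        unfolding eventually_at using ab
        by (intro exI[of _ "b - a"]) (auto simp: k_def dist_real_def field_simps, auto simp: diff_divide_distrib)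
      ultimately show ?thesis
        using 1 by (auto intro: Lim_transform_eventually)
    next
      case 2
      have "((\<lambda>y. (U y - U b) / (y - b) / (y - a)) \<longlongrightarrow> U' b / (b - a)) (at b)"
        using U[of b] ab unfolding has_field_derivative_iff by (intro tendsto_intros) auto
      then have "((\<lambda>y. (U y - U b) / (y - b) / (y - a)) \<longlongrightarrow> k b) (at b within {a..b})"
        using ab by (auto simp: k_def intro: tendsto_within_subset)
      moreover have "\<forall>\<^sub>F y in at b within {a..b}. (U y - U b) / (y - b) / (y - a) = k y"
        unfolding eventually_at using ab
        by (intro exI[of _ "b - a"]) (auto simp: k_def dist_real_def divide_simps, auto simp: algebra_simps)
      ultimately show ?thesis
        using 2 by (auto intro: Lim_transform_eventually)
    next
      case 3
      have "((\<lambda>y. (c - U y) / ((y - a) * (b - y))) \<longlongrightarrow> (c - U x) / ((x - a) * (b - x))) (at x)"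
        using 3 DERIV_isCont[OF U] by (intro tendsto_intros) (auto simp: isCont_def)
      then have "((\<lambda>y. (c - U y) / ((y - a) * (b - y))) \<longlongrightarrow> k x) (at x within {a..b})"
        using 3 by (auto simp: k_def intro: tendsto_within_subset)
      moreover have "\<forall>\<^sub>F y in at x within {a..b}. (c - U y) / ((y - a) * (b - y)) = k y"
        unfolding eventually_at using 3
        by (intro exI[of _ "min (x - a) (b - x)"]) (auto simp: k_def dist_real_def)
      ultimately show ?thesis
        by (auto intro: Lim_transform_eventually)
    qed
  qed
  \<comment> \<open>Here \<open>(x - a) * (b - x)\<close> equals
    \<open>r\<^sup>2 * (sin \<theta>)\<^sup>2\<close> and the velocity is
    \<open>r * sin \<theta>\<close> times the angular speed. In the energy equation the sines
    cancel, leaving \<open>2 * k / m\<close> as the squared angular speed, also at the turning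
    points.\<close>
  define q where "q x = sqrt (2 * k x / m x)" for x
  have q_cont: "continuous_on {a..b} q"
    unfolding q_def using m_pos by (intro continuous_intros k_cont m_cont) (auto simp: less_imp_neq[symmetric])
  have q_pos: "0 < q x" if "x \<in> {a..b}" for x
    using k_pos[OF that] m_pos by (simp add: q_def)
  have "\<exists>Q. \<forall>x\<in>{a..b}. q x \<le> Q"
    using continuous_attains_sup[OF _ _ q_cont] ab by auto
  then obtain Q where Q: "\<And>x. x \<in> {a..b} \<Longrightarrow> q x \<le> Q"
    by blast
  define r where "r = (b - a) / 2"
  have r: "0 < r"
    using ab by (simp add: r_def)
  define p where "p \<theta> = (a + b) / 2 - r * cos \<theta>" for \<theta>
  have p_in: "p \<theta> \<in> {a..b}" for \<theta>
  proof -
    have "r * cos \<theta> \<le> r * 1" "r * (- 1) \<le> r * cos \<theta>"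
      using r by (intro mult_left_mono; simp)+
    then show ?thesis
      by (simp add: p_def r_def field_simps)
  qed
  define g where "g \<theta> = q (p \<theta>)" for \<theta>
  have g_cont: "continuous_on UNIV g"
    unfolding g_def
    by (intro continuous_on_compose2[OF q_cont]) (use p_in in \<open>auto simp: p_def intro!: continuous_intros\<close>)
  have g_pos: "0 < g \<theta>" and g_le: "g \<theta> \<le> Q" and g_per: "g (\<theta> + 2 * pi) = g \<theta>" for \<theta>
    using q_pos[OF p_in] Q[OF p_in] by (auto simp: g_def p_def)
  obtain \<Theta> G T where T: "0 < T" and \<Theta>: "\<And>t. (\<Theta> has_real_derivative g (\<Theta> t)) (at t)"
    and \<Theta>_per: "\<And>t. \<Theta> (t + T) = \<Theta> t + 2 * pi" and \<Theta>_G: "\<And>y. \<Theta> (G y) = y"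
    and G: "strict_mono G" "G 0 = 0" "G (2 * pi) = T"
    by (rule increasing_reparametrization[OF g_cont g_pos g_le g_per]) blast
  define x where "x t = p (\<Theta> t)" for t
  define y where "y t = r * sin (\<Theta> t) * g (\<Theta> t)" for t
  have x_in: "x t \<in> {a..b}" for t
    unfolding x_def by (rule p_in)
  have x: "(x has_real_derivative y t) (at t)" for t
    unfolding x_def[abs_def] y_def p_def by (auto intro!: derivative_eq_intros \<Theta>)
  have energy: "m (x t) * (y t)\<^sup>2 / 2 + U (x t) = c" for t
  proof -
    have "x t - a = r - r * cos (\<Theta> t)" "b - x t = r + r * cos (\<Theta> t)"
      by (simp_all add: x_def p_def r_def field_simps)
    then have "(x t - a) * (b - x t) = (r - r * cos (\<Theta> t)) * (r + r * cos (\<Theta> t))"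
      by simp
    also have "\<dots> = r\<^sup>2 * (1 - (cos (\<Theta> t))\<^sup>2)"
      by (simp add: power2_eq_square algebra_simps)
    finally have "(x t - a) * (b - x t) = r\<^sup>2 * (sin (\<Theta> t))\<^sup>2"
      by (simp add: sin_squared_eq)
    moreover have "(g (\<Theta> t))\<^sup>2 = 2 * k (x t) / m (x t)"
      using k_pos[OF x_in[of t]] m_pos[of "x t"] by (simp add: g_def q_def x_def)
    ultimately have "m (x t) * (y t)\<^sup>2 / 2 = (x t - a) * (b - x t) * k (x t)"
      using m_pos[of "x t"] by (simp add: y_def power_mult_distrib)
    then show ?thesis
      using k_eq[OF x_in[of t]] by linarith
  qed
  have y_sq: "(y t)\<^sup>2 = 2 * (c - U (x t)) / m (x t)" for t
    using energy[of t] m_pos[of "x t"] by (simp add: field_simps)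
  define y' where "y' t = rho (x t) + beta (x t) * (y t)\<^sup>2" for t
  have g\<Theta>_cont: "continuous_on UNIV (\<lambda>t. g (\<Theta> t))"
    by (rule continuous_on_compose2[OF g_cont])
      (use \<Theta> DERIV_isCont in \<open>blast intro: continuous_at_imp_continuous_on\<close>)+
  have \<Theta>_cont: "continuous_on UNIV \<Theta>"
    using \<Theta> DERIV_isCont by (blast intro: continuous_at_imp_continuous_on)
  have x_cont: "continuous_on UNIV x"
    using x DERIV_isCont by (blast intro: continuous_at_imp_continuous_on)
  have y_cont: "continuous_on UNIV y"
    unfolding y_def by (intro continuous_intros g\<Theta>_cont \<Theta>_cont)
  have y'_cont: "continuous_on UNIV y'"
    unfolding y'_def
    by (intro continuous_intros y_cont continuous_on_compose2[OF rho x_cont] continuous_on_compose2[OF beta x_cont]) auto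
  have y_regular: "(y has_real_derivative y' t) (at t)" if nz: "sin (\<Theta> t) \<noteq> 0" for t
  proof -
    \<comment> \<open>Away from turning points the sign of \<open>y\<close> is locally constant, so
      \<open>y\<close> is \<open>sg\<close> times the root of the energy expression
      \<open>N\<close>, which is positive at \<open>t\<close>.\<close>
    define sg where "sg = sgn (sin (\<Theta> t))"
    have sg: "sg \<noteq> 0" "sg * sg = 1"
      using nz by (auto simp: sg_def sgn_if)
    define N where "N u = 2 * (c - U (x u)) / m (x u)" for u
    have "isCont (\<lambda>u. sg * sin (\<Theta> u)) t"
      using \<Theta>_cont by (auto intro!: continuous_intros simp: continuous_on_eq_continuous_at)
    moreover have "sg * sin (\<Theta> t) > 0"
      using nz by (auto simp: sg_def sgn_if)
    ultimately have "\<forall>\<^sub>F u in nhds t. sg * sin (\<Theta> u) > 0"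
      by (intro order_tendstoD(1)) (auto simp: isCont_def tendsto_nhds_iff)
    then have y_ev: "\<forall>\<^sub>F u in nhds t. y u = sg * sqrt (N u)"
    proof eventually_elim
      case (elim u)
      have "0 < r * g (\<Theta> u) * (sg * sin (\<Theta> u))"
        using elim r g_pos by simp
      then have "0 < sg * y u"
        by (simp add: y_def mult_ac)
      moreover have "(sg * y u)\<^sup>2 = N u"
        using sg y_sq[of u] by (simp add: N_def power2_eq_square mult_ac)
      ultimately have "sqrt (N u) = sg * y u"
        by (metis abs_of_pos real_sqrt_abs)
      then show ?case
        using sg by (simp flip: mult.assoc)
    qed
    have yt: "y t = sg * sqrt (N t)"
      using y_ev by (rule eventually_nhds_x_imp_x)
    have yt0: "y t \<noteq> 0"
      using nz r g_pos[of "\<Theta> t"] by (auto simp: y_def)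
    have Nt: "N t = (y t)\<^sup>2"
      by (simp add: N_def y_sq)
    have Npos: "N t > 0"
      using yt0 by (simp add: Nt)
    have Ux: "((\<lambda>u. U (x u)) has_real_derivative U' (x t) * y t) (at t)"
      by (rule DERIV_chain2[OF U x])
    have mx: "((\<lambda>u. m (x u)) has_real_derivative - 2 * beta (x t) * m (x t) * y t) (at t)"
      by (rule DERIV_chain2[OF m x])
    have "(N has_real_derivative (2 * (0 - U' (x t) * y t) * m (x t)
        - 2 * (c - U (x t)) * (- 2 * beta (x t) * m (x t) * y t)) / (m (x t) * m (x t))) (at t)"
      unfolding N_def[abs_def] using m_pos[of "x t"]
      by (intro DERIV_divide DERIV_cmult DERIV_diff DERIV_const Ux mx) auto
    moreover have "(2 * (0 - U' (x t) * y t) * m (x t)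
        - 2 * (c - U (x t)) * (- 2 * beta (x t) * m (x t) * y t)) / (m (x t) * m (x t))
        = 2 * y t * (rho (x t) + beta (x t) * (2 * (c - U (x t)) / m (x t)))"
      using m_pos[of "x t"] by (simp add: U'_eq field_simps)
    ultimately have "(N has_real_derivative 2 * y t * y' t) (at t)"
      by (simp add: y'_def y_sq)
    then have "((\<lambda>u. sg * sqrt (N u)) has_real_derivative
        sg * (inverse (sqrt (N t)) / 2 * (2 * y t * y' t))) (at t)"
      using Npos by (intro DERIV_cmult DERIV_chain2[OF DERIV_real_sqrt])
    moreover have "sg * (inverse (sqrt (N t)) / 2 * (2 * y t * y' t)) = y' t"
      using Npos sg by (simp add: yt field_simps)
    ultimately have "((\<lambda>u. sg * sqrt (N u)) has_real_derivative y' t) (at t)"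
      by (simp only:)
    then show ?thesis
      using y_ev by (subst DERIV_cong_ev[OF refl _ refl])
  qed
  have y: "(y has_real_derivative y' t) (at t)" for t
  proof (rule DERIV_of_limit)
    show "isCont y t" "isCont y' t"
      using y_cont y'_cont by (auto simp: continuous_on_eq_continuous_at)
    \<comment> \<open>Turning points are isolated because \<open>\<Theta>\<close> moves with
      positive speed.\<close>
    have "\<forall>\<^sub>F u in at t. sin (\<Theta> u) \<noteq> 0"
    proof (cases "sin (\<Theta> t) = 0")
      case False
      have "isCont (\<lambda>u. sin (\<Theta> u)) t"
        using \<Theta>_cont by (auto intro!: continuous_intros simp: continuous_on_eq_continuous_at)
      then show ?thesis
        using False by (auto simp: isCont_def intro: tendsto_imp_eventually_ne)
    next
      case True
      have "((\<lambda>u. sin (\<Theta> u)) has_real_derivative cos (\<Theta> t) * g (\<Theta> t)) (at t)"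
        by (auto intro!: derivative_eq_intros \<Theta>)
      then have "((\<lambda>u. sin (\<Theta> u) / (u - t)) \<longlongrightarrow> cos (\<Theta> t) * g (\<Theta> t)) (at t)"
        using True by (simp add: has_field_derivative_iff)
      moreover have "cos (\<Theta> t) * g (\<Theta> t) \<noteq> 0"
        using True g_pos[of "\<Theta> t"] sin_cos_squared_add[of "\<Theta> t"] by auto
      ultimately have "\<forall>\<^sub>F u in at t. sin (\<Theta> u) / (u - t) \<noteq> 0"
        by (rule tendsto_imp_eventually_ne)
      then show ?thesis
        by eventually_elim auto
    qed
    then show "\<forall>\<^sub>F u in at t. (y has_real_derivative y' u) (at u)"
      by eventually_elim (rule y_regular)
  qed
  have cover: "\<exists>t\<in>{0..T}. x t = u \<and> y t = v" if u: "u \<in> {a..b}" and uv: "m u * v\<^sup>2 / 2 + U u = c" for u v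
  proof -
    define z where "z = ((a + b) / 2 - u) / r"
    have z: "- 1 \<le> z" "z \<le> 1"
      using u r by (simp_all add: z_def le_divide_eq divide_le_eq) (simp_all add: r_def field_simps)
    \<comment> \<open>On the first half revolution the position moves from \<open>a\<close> to
      \<open>b\<close>, on the second it moves back; the sign of \<open>v\<close> selects the
      half.\<close>
    define \<theta> where "\<theta> = (if 0 \<le> v then arccos z else 2 * pi - arccos z)"
    have \<theta>: "cos \<theta> = z" "0 \<le> \<theta>" "\<theta> \<le> 2 * pi"
      using z arccos_lbound[OF z] arccos_ubound[OF z] by (auto simp: \<theta>_def cos_diff)
    have "0 \<le> sin (arccos z)"
      using z arccos_lbound[OF z] arccos_ubound[OF z] by (intro sin_ge_zero)
    then have sin: "0 \<le> v \<Longrightarrow> 0 \<le> sin \<theta>" "v < 0 \<Longrightarrow> sin \<theta> \<le> 0"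
      by (auto simp: \<theta>_def sin_diff)
    have xu: "x (G \<theta>) = u"
      using r \<theta> by (simp add: x_def \<Theta>_G p_def z_def)
    have "m u * (y (G \<theta>))\<^sup>2 = m u * v\<^sup>2"
      using energy[of "G \<theta>", unfolded xu] uv by linarith
    then have "(y (G \<theta>))\<^sup>2 = v\<^sup>2"
      using m_pos[of u] by simp
    moreover have "0 \<le> v \<Longrightarrow> 0 \<le> y (G \<theta>)" "v < 0 \<Longrightarrow> y (G \<theta>) \<le> 0"
      using sin r g_pos[of \<theta>] by (auto simp: y_def \<Theta>_G mult_le_0_iff)
    ultimately have "y (G \<theta>) = v"
      by (cases "0 \<le> v") (auto simp: power2_eq_iff)
    moreover have "G \<theta> \<in> {0..T}"
      using strict_mono_less_eq[OF G(1)] \<theta> G(2,3) by (metis atLeastAtMost_iff)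
    ultimately show ?thesis
      using xu by blast
  qed
  have per: "x (t + T) = x t" "y (t + T) = y t" for t
    by (simp_all add: x_def y_def \<Theta>_per p_def g_per)
  show ?thesis
    by (rule that[OF T x y[unfolded y'_def] per x_in energy cover])
qed

subsection \<open>Periodic coefficients\<close>

definition C1_real :: "(real \<Rightarrow> real) \<Rightarrow> bool" where
  "C1_real f \<longleftrightarrow> (\<forall>x. (f has_real_derivative deriv f x) (at x)) \<and> continuous_on UNIV (deriv f)"

lemma C1_realI:
  assumes f: "\<And>x. (f has_real_derivative f' x) (at x)" and f': "continuous_on UNIV f'"
  shows "C1_real f"
proof -
  have "deriv f = f'"
    using f DERIV_imp_deriv by blast
  then show ?thesis
    using assms by (simp add: C1_real_def)
qed

lemma C1_realD:
  assumes "C1_real f"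
  shows "(f has_real_derivative deriv f x) (at x)" "continuous_on A (deriv f)" "continuous_on A f"
proof -
  show D: "(f has_real_derivative deriv f x) (at x)" for x
    using assms by (simp add: C1_real_def)
  show "continuous_on A (deriv f)"
    using assms by (auto simp: C1_real_def intro: continuous_on_subset)
  show "continuous_on A f"
    using DERIV_isCont[OF D] by (simp add: continuous_at_imp_continuous_on)
qed

lemma C1_real_const: "C1_real (\<lambda>_. c)"
  by (rule C1_realI[where f' = "\<lambda>_. 0"]) auto

lemma C1_real_diff:
  assumes f: "C1_real f" and g: "C1_real g"
  shows "C1_real (\<lambda>x. f x - g x)"
  by (rule C1_realI[OF DERIV_diff[OF C1_realD(1)[OF f] C1_realD(1)[OF g]]])
    (intro continuous_intros C1_realD f g)

lemma C1_real_mult: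
  assumes f: "C1_real f" and g: "C1_real g"
  shows "C1_real (\<lambda>x. f x * g x)"
  by (rule C1_realI[OF DERIV_mult'[OF C1_realD(1)[OF f] C1_realD(1)[OF g]]])
    (intro continuous_intros C1_realD f g)

lemma C1_real_divide:
  assumes f: "C1_real f" and g: "C1_real g" and nz: "\<And>x. g x \<noteq> 0"
  shows "C1_real (\<lambda>x. f x / g x)"
  by (rule C1_realI[OF DERIV_divide[OF C1_realD(1)[OF f] C1_realD(1)[OF g] nz]])
    (intro continuous_on_divide continuous_on_diff continuous_on_mult C1_realD f g, simp add: nz)

lemma C2E:
  fixes f :: "'a::real_normed_vector \<Rightarrow> 'b::real_normed_vector"
  assumes "C2 f"
  obtains f' :: "'a \<Rightarrow> 'a \<Rightarrow>\<^sub>L 'b" and f'' :: "'a \<Rightarrow> 'a \<Rightarrow>\<^sub>L ('a \<Rightarrow>\<^sub>L 'b)"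
  where "\<And>x. (f has_derivative blinfun_apply (f' x)) (at x)"
    "\<And>x. (f' has_derivative blinfun_apply (f'' x)) (at x)" "continuous_on UNIV f''"
  using assms unfolding C2_def by (elim exE conjE) (rule that, erule spec, erule spec)

lemma C2_imp_C1_real:
  fixes f :: "real \<Rightarrow> real"
  assumes "C2 f"
  shows "C1_real f" "C1_real (deriv f)"
proof -
  obtain f' :: "real \<Rightarrow> real \<Rightarrow>\<^sub>L real" and f'' where
    1: "\<And>x. (f has_derivative blinfun_apply (f' x)) (at x)" and
    2: "\<And>x. (f' has_derivative blinfun_apply (f'' x)) (at x)" and
    3: "continuous_on UNIV f''"
    by (rule C2E[OF assms]) (rule that)
  have f': "(f has_real_derivative blinfun_apply (f' x) 1) (at x)" for x
  proof -
    have "blinfun_apply (f' x) h = blinfun_apply (f' x) 1 * h" for h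
      using blinfun.scaleR_right[of "f' x" h 1] by (simp add: mult.commute)
    then have "blinfun_apply (f' x) = (*) (blinfun_apply (f' x) 1)"
      by blast
    then show ?thesis
      using 1[of x] by (simp add: has_field_derivative_def)
  qed
  have f'': "((\<lambda>x. blinfun_apply (f' x) 1) has_real_derivative blinfun_apply (blinfun_apply (f'' x) 1) 1) (at x)" for x
  proof -
    have "((\<lambda>x. blinfun_apply (f' x) 1) has_derivative (\<lambda>h. blinfun_apply (blinfun_apply (f'' x) h) 1)) (at x)"
      using 2[of x] by (auto intro!: derivative_eq_intros)
    moreover have "(\<lambda>h. blinfun_apply (blinfun_apply (f'' x) h) 1) = (*) (blinfun_apply (blinfun_apply (f'' x) 1) 1)"
    proof
      fix h
      show "blinfun_apply (blinfun_apply (f'' x) h) 1 = blinfun_apply (blinfun_apply (f'' x) 1) 1 * h"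
        using blinfun.scaleR_right[of "f'' x" h 1] by (simp add: mult.commute blinfun.scaleR_left)
    qed
    ultimately show ?thesis
      by (simp only: has_field_derivative_def)
  qed
  have d: "deriv f = (\<lambda>x. blinfun_apply (f' x) 1)"
    using DERIV_imp_deriv[OF f'] by blast
  show "C1_real (deriv f)"
    unfolding d by (rule C1_realI[OF f'']) (intro continuous_intros 3)
  show "C1_real f"
    using f' f'' unfolding C1_real_def d
    by (meson DERIV_isCont continuous_at_imp_continuous_on)
qed

lemma periodic_fun_simple_deriv:
  assumes "periodic_fun_simple f p"
  shows "periodic_fun_simple (deriv f) p"
proof
  fix x
  have "(\<lambda>x. f (x + p)) = f"
    using assms by (simp add: periodic_fun_simple_def)
  then show "deriv f (x + p) = deriv f x"
    unfolding deriv_def by (simp add: DERIV_shift)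
qed

lemma periodic_reduce:
  fixes f :: "real \<Rightarrow> 'a"
  assumes f: "periodic_fun_simple f p" and p: "0 < p"
  shows "\<exists>y\<in>{0..p}. f x = f y"
proof -
  define n where "n = \<lfloor>x / p\<rfloor>"
  have "0 \<le> x / p - of_int n" "x / p - of_int n \<le> 1"
    unfolding n_def by linarith+
  then have "0 \<le> x - of_int n * p" "x - of_int n * p \<le> p"
    using p by (simp_all add: field_simps)
  moreover have "f x = f (x - of_int n * p)"
  proof -
    interpret periodic_fun_simple f p by (rule f)
    show ?thesis
      using plus_of_int[of "x - of_int n * p" n] by simp
  qed
  ultimately show ?thesis
    by (intro bexI[of _ "x - of_int n * p"]) auto
qed

lemma periodic_attains_bounds:
  fixes f :: "real \<Rightarrow> real"
  assumes f: "periodic_fun_simple f p" and p: "0 < p" and cont: "continuous_on UNIV f"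
  obtains y z where "\<And>x. f y \<le> f x" "\<And>x. f x \<le> f z"
proof -
  have c: "continuous_on {0..p} f"
    using cont continuous_on_subset by blast
  obtain y where y: "\<And>x. x \<in> {0..p} \<Longrightarrow> f y \<le> f x"
    using continuous_attains_inf[OF _ _ c] p by fastforce
  obtain z where z: "\<And>x. x \<in> {0..p} \<Longrightarrow> f x \<le> f z"
    using continuous_attains_sup[OF _ _ c] p by fastforce
  show ?thesis
    by (rule that[of y z]) (metis periodic_reduce[OF f p] y z)+
qed

lemma periodic_bounded:
  fixes f :: "real \<Rightarrow> real"
  assumes f: "periodic_fun_simple f p" and p: "0 < p" and cont: "continuous_on UNIV f"
  shows "\<exists>B\<ge>0. \<forall>x. \<bar>f x\<bar> \<le> B"
proof -
  obtain y z where "\<And>x. f y \<le> f x" "\<And>x. f x \<le> f z"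
    using periodic_attains_bounds[OF assms] by blast
  then show ?thesis
    by (intro exI[of _ "\<bar>f y\<bar> + \<bar>f z\<bar>"]) (auto simp: abs_le_iff, smt+)
qed

text \<open>Boundedness is bundled in because a product of Lipschitz functions need not be Lipschitz
  otherwise. The class is closed under arithmetic, so membership of the feedback follows from its
  syntax.\<close>

definition bounded_lipschitz_on :: "'a::metric_space set \<Rightarrow> ('a \<Rightarrow> real) \<Rightarrow> bool" where
  "bounded_lipschitz_on S f \<longleftrightarrow> (\<exists>B. \<forall>x\<in>S. \<bar>f x\<bar> \<le> B) \<and> (\<exists>L. L-lipschitz_on S f)"

lemma bounded_lipschitz_on_const: "bounded_lipschitz_on S (\<lambda>_. c)"
  unfolding bounded_lipschitz_on_def using lipschitz_on_constant by blast

lemma bounded_lipschitz_on_minus: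
  "bounded_lipschitz_on S f \<Longrightarrow> bounded_lipschitz_on S (\<lambda>x. - f x)"
  unfolding bounded_lipschitz_on_def by simp

lemma bounded_lipschitz_on_add:
  assumes f: "bounded_lipschitz_on S f" and g: "bounded_lipschitz_on S g"
  shows "bounded_lipschitz_on S (\<lambda>x. f x + g x)"
proof -
  obtain B C where "\<forall>x\<in>S. \<bar>f x\<bar> \<le> B" "\<forall>x\<in>S. \<bar>g x\<bar> \<le> C"
    using f g by (auto simp: bounded_lipschitz_on_def)
  then have "\<forall>x\<in>S. \<bar>f x + g x\<bar> \<le> B + C"
    by (auto intro: order_trans[OF abs_triangle_ineq] add_mono)
  then show ?thesis
    using f g lipschitz_on_add unfolding bounded_lipschitz_on_def by blast
qed

lemma bounded_lipschitz_on_diff: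
  assumes f: "bounded_lipschitz_on S f" and g: "bounded_lipschitz_on S g"
  shows "bounded_lipschitz_on S (\<lambda>x. f x - g x)"
  using bounded_lipschitz_on_add[OF f bounded_lipschitz_on_minus[OF g]] by simp

lemma bounded_lipschitz_on_mult:
  assumes f: "bounded_lipschitz_on S f" and g: "bounded_lipschitz_on S g"
  shows "bounded_lipschitz_on S (\<lambda>x. f x * g x)"
proof -
  obtain B C where BC: "\<And>x. x \<in> S \<Longrightarrow> \<bar>f x\<bar> \<le> B" "\<And>x. x \<in> S \<Longrightarrow> \<bar>g x\<bar> \<le> C"
    using f g by (auto simp: bounded_lipschitz_on_def)
  obtain L M where LM: "L-lipschitz_on S f" "M-lipschitz_on S g"
    using f g by (auto simp: bounded_lipschitz_on_def)
  have "(\<bar>B\<bar> * M + \<bar>C\<bar> * L)-lipschitz_on S (\<lambda>x. f x * g x)"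
  proof (rule lipschitz_onI)
    fix x y assume xy: "x \<in> S" "y \<in> S"
    have "f x * g x - f y * g y = f x * (g x - g y) + g y * (f x - f y)"
      by (simp add: algebra_simps)
    then have "\<bar>f x * g x - f y * g y\<bar> \<le> \<bar>f x\<bar> * \<bar>g x - g y\<bar> + \<bar>g y\<bar> * \<bar>f x - f y\<bar>"
      by (metis abs_mult abs_triangle_ineq)
    also have "\<dots> \<le> \<bar>B\<bar> * (M * dist x y) + \<bar>C\<bar> * (L * dist x y)"
      using BC xy lipschitz_onD[OF LM(1) xy] lipschitz_onD[OF LM(2) xy]
      by (intro add_mono mult_mono) (auto simp: dist_real_def intro: order_trans[OF _ abs_ge_self])
    finally show "dist (f x * g x) (f y * g y) \<le> (\<bar>B\<bar> * M + \<bar>C\<bar> * L) * dist x y"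
      by (simp add: dist_real_def algebra_simps)
  qed (use LM[THEN lipschitz_on_nonneg] in simp)
  moreover have "\<forall>x\<in>S. \<bar>f x * g x\<bar> \<le> \<bar>B\<bar> * \<bar>C\<bar>"
    using BC by (auto simp: abs_mult intro!: mult_mono intro: order_trans[OF _ abs_ge_self])
  ultimately show ?thesis
    unfolding bounded_lipschitz_on_def by blast
qed

lemma bounded_lipschitz_on_divide:
  assumes "bounded_lipschitz_on S f" and "bounded_lipschitz_on S (\<lambda>x. inverse (g x))"
  shows "bounded_lipschitz_on S (\<lambda>x. f x / g x)"
  using bounded_lipschitz_on_mult[OF assms] by (simp add: divide_inverse)

lemma bounded_lipschitz_on_power2:
  "bounded_lipschitz_on S f \<Longrightarrow> bounded_lipschitz_on S (\<lambda>x. (f x)\<^sup>2)"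
  by (simp add: power2_eq_square bounded_lipschitz_on_mult)

lemma bounded_lipschitz_on_compose:
  assumes f: "bounded_lipschitz_on T f" and g: "L-lipschitz_on S g" and gS: "g ` S \<subseteq> T"
  shows "bounded_lipschitz_on S (\<lambda>x. f (g x))"
proof -
  obtain M where "M-lipschitz_on T f"
    using f by (auto simp: bounded_lipschitz_on_def)
  then have "(M * L)-lipschitz_on S (\<lambda>x. f (g x))"
    using g gS by (intro lipschitz_on_compose2[of L S g M f]) (auto intro: lipschitz_on_subset)
  then show ?thesis
    using f gS unfolding bounded_lipschitz_on_def by blast
qed

lemma bounded_lipschitz_on_periodic:
  assumes f: "C1_real f" and per: "periodic_fun_simple f (2 * pi)"
  shows "bounded_lipschitz_on S f"
proof -
  obtain B where B: "0 \<le> B" "\<And>x. \<bar>deriv f x\<bar> \<le> B"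
    using periodic_bounded[OF periodic_fun_simple_deriv[OF per] _ C1_realD(2)[OF f]] by auto
  have "B-lipschitz_on UNIV f"
    by (rule bounded_derivative_imp_lipschitz[where f' = "\<lambda>x. (*) (deriv f x)"])
      (use B C1_realD(1)[OF f] in \<open>auto simp: has_field_derivative_def intro!: onorm_le simp: abs_mult mult_right_mono\<close>)
  then have "B-lipschitz_on S f"
    by (rule lipschitz_on_subset) simp
  moreover have "\<exists>C. \<forall>x\<in>S. \<bar>f x\<bar> \<le> C"
    using periodic_bounded[OF per _ C1_realD(3)[OF f]] by auto
  ultimately show ?thesis
    unfolding bounded_lipschitz_on_def by blast
qed

section \<open>The potential gradient for bounded actuated coordinate\<close>

lemma grad_u_has_derivative:
  assumes "C2 (V P)"
  obtains D N where "\<And>x. ((\<lambda>(q, a). grad_u P q a) has_derivative D x) (at x)"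
    "\<And>x. onorm (D x) \<le> N x" "continuous_on UNIV N"
proof -
  obtain f' :: "real \<times> real \<Rightarrow> (real \<times> real) \<Rightarrow>\<^sub>L real" and f'' where
    1: "\<And>x. (V P has_derivative blinfun_apply (f' x)) (at x)" and
    2: "\<And>x. (f' has_derivative blinfun_apply (f'' x)) (at x)" and
    3: "continuous_on UNIV f''"
    by (rule C2E[OF assms]) (rule that)
  have G: "((\<lambda>q. V P (q, a)) has_real_derivative blinfun_apply (f' (q, a)) (1, 0)) (at q)" for q a
  proof -
    have "((\<lambda>q. V P (q, a)) has_derivative (\<lambda>h. blinfun_apply (f' (q, a)) (h, 0))) (at q)"
      by (rule has_derivative_compose[OF _ 1]) (auto intro!: derivative_eq_intros)
    moreover have "(\<lambda>h. blinfun_apply (f' (q, a)) (h, 0)) = (*) (blinfun_apply (f' (q, a)) (1, 0))"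
    proof
      fix h
      show "blinfun_apply (f' (q, a)) (h, 0) = blinfun_apply (f' (q, a)) (1, 0) * h"
        using blinfun.scaleR_right[of "f' (q, a)" h "(1, 0)"] by (simp add: mult.commute)
    qed
    ultimately show ?thesis
      by (simp only: has_field_derivative_def)
  qed
  have eq: "(\<lambda>(q, a). grad_u P q a) = (\<lambda>x. blinfun_apply (f' x) (1, 0))"
    using G by (auto simp: grad_u_def fun_eq_iff dest: DERIV_imp_deriv)
  show ?thesis
  proof (rule that[of "\<lambda>x h. blinfun_apply (blinfun_apply (f'' x) h) (1, 0)" "\<lambda>x. norm (f'' x)"])
    fix x
    show "((\<lambda>(q, a). grad_u P q a) has_derivative
        (\<lambda>h. blinfun_apply (blinfun_apply (f'' x) h) (1, 0))) (at x)"
      unfolding eq using 2[of x] by (auto intro!: derivative_eq_intros)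
    show "onorm (\<lambda>h. blinfun_apply (blinfun_apply (f'' x) h) (1, 0)) \<le> norm (f'' x)"
    proof (rule onorm_le)
      fix h
      have "norm (blinfun_apply (blinfun_apply (f'' x) h) (1, 0)) \<le> norm (blinfun_apply (f'' x) h) * norm ((1, 0) :: real \<times> real)"
        by (rule norm_blinfun)
      also have "\<dots> \<le> norm (f'' x) * norm h"
        using norm_blinfun[of "f'' x" h] by (simp add: norm_Pair)
      finally show "norm (blinfun_apply (blinfun_apply (f'' x) h) (1, 0)) \<le> norm (f'' x) * norm h" .
    qed
  qed (intro continuous_intros 3)
qed

text \<open>Periodicity in the angle reduces every point of the strip to a compact rectangle, where
  the continuous bound on the derivative is bounded. The strip is convex, so the mean value estimate
  applies.\<close>

lemma grad_u_bounded_lipschitz: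
  assumes V: "C2 (V P)" and per: "\<And>a. periodic_fun_simple (\<lambda>q. V P (q, a)) (2 * pi)"
  shows "bounded_lipschitz_on (UNIV \<times> {- R..R}) (\<lambda>(q, a). grad_u P q a)"
proof -
  define g where "g = (\<lambda>(q, a). grad_u P q a)"
  obtain D N where D: "\<And>x. (g has_derivative D x) (at x)"
    and N: "\<And>x. onorm (D x) \<le> N x" "continuous_on UNIV N"
    using grad_u_has_derivative[OF V] unfolding g_def by metis
  have g_per: "periodic_fun_simple (\<lambda>q. g (q, a)) (2 * pi)" for a
    using periodic_fun_simple_deriv[OF per[of a]] by (simp add: g_def grad_u_def[abs_def])
  define red where "red q = q - 2 * pi * of_int \<lfloor>q / (2 * pi)\<rfloor>" for q :: real
  have red: "red q \<in> {0..2 * pi}" for q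
  proof -
    have "0 \<le> q / (2 * pi) - of_int \<lfloor>q / (2 * pi)\<rfloor>" "q / (2 * pi) - of_int \<lfloor>q / (2 * pi)\<rfloor> \<le> 1"
      by linarith+
    then show ?thesis
      by (simp add: red_def field_simps)
  qed
  have g_shift: "g (q - 2 * pi * of_int n, a) = g (q, a)" for q a n
  proof -
    interpret periodic_fun_simple "\<lambda>q. g (q, a)" "2 * pi" by (rule g_per)
    show ?thesis
      using minus_of_int[of q n] by (simp add: mult_ac)
  qed
  have K: "compact ({0..2 * pi} \<times> {- R..R} :: (real \<times> real) set)"
    by (intro compact_Times) auto
  obtain B where B: "\<And>x. x \<in> {0..2 * pi} \<times> {- R..R} \<Longrightarrow> \<bar>N x\<bar> \<le> B"
    using compact_imp_bounded[OF compact_continuous_image[OF continuous_on_subset[OF N(2)] K]]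
    by (force simp: bounded_iff)
  have "continuous_on UNIV g"
    using D has_derivative_continuous by (blast intro: continuous_at_imp_continuous_on)
  then obtain C where C: "\<And>x. x \<in> {0..2 * pi} \<times> {- R..R} \<Longrightarrow> \<bar>g x\<bar> \<le> C"
    using compact_imp_bounded[OF compact_continuous_image[OF continuous_on_subset K]]
    by (force simp: bounded_iff)
  \<comment> \<open>The derivative at a far point is transported from the reduced one by a shift, so
    \<open>D\<close> need only be bounded on the rectangle.\<close>
  have D_shift: "(g has_derivative D (red q, a)) (at (q, a))" for q a
  proof -
    define n where "n = \<lfloor>q / (2 * pi)\<rfloor>"
    have "((\<lambda>x. x - (2 * pi * of_int n, 0)) has_derivative (\<lambda>h. h)) (at (q, a))"
      by (auto intro!: derivative_eq_intros)
    moreover have "(g has_derivative D (red q, a)) (at ((q, a) - (2 * pi * of_int n, 0)))"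
      using D[of "(red q, a)"] by (simp add: red_def n_def)
    ultimately have "((\<lambda>x. g (x - (2 * pi * of_int n, 0))) has_derivative D (red q, a)) (at (q, a))"
      by (rule has_derivative_compose)
    moreover have "(\<lambda>x. g (x - (2 * pi * of_int n, 0))) = g"
      by (auto simp: fun_eq_iff g_shift)
    ultimately show ?thesis
      by simp
  qed
  have "\<bar>B\<bar>-lipschitz_on (UNIV \<times> {- R..R}) g"
  proof (rule bounded_derivative_imp_lipschitz)
    fix x :: "real \<times> real" assume x: "x \<in> UNIV \<times> {- R..R}"
    show "(g has_derivative D (red (fst x), snd x)) (at x within UNIV \<times> {- R..R})"
      using D_shift[of "fst x" "snd x"] by (simp add: has_derivative_at_withinI)
    show "onorm (D (red (fst x), snd x)) \<le> \<bar>B\<bar>"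
      using N(1)[of "(red (fst x), snd x)"] B[of "(red (fst x), snd x)"] red x by fastforce
  qed (auto intro!: convex_Times)
  moreover have "\<bar>g x\<bar> \<le> C" if "x \<in> UNIV \<times> {- R..R}" for x
    using C[of "(red (fst x), snd x)"] red that g_shift[of "fst x" _ "snd x"] by (auto simp: red_def)
  ultimately show ?thesis
    unfolding bounded_lipschitz_on_def g_def by blast
qed

subsection \<open>The closed loop in transverse coordinates\<close>

locale constrained_plant =
  fixes P :: plant and s K :: "real \<Rightarrow> real" and \<gamma>1 \<gamma>2 :: real
  assumes C2_plant: "C2 (m_uu P)" "C2 (m_au P)" "C2 (m_aa P)" "C2 (c_a P)" "C2 (c_u P)" "C2 (V P)"
    and circle_plant:
      "periodic_fun_simple (m_uu P) (2 * pi)" "periodic_fun_simple (m_au P) (2 * pi)"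
      "periodic_fun_simple (m_aa P) (2 * pi)" "periodic_fun_simple (c_a P) (2 * pi)"
      "periodic_fun_simple (c_u P) (2 * pi)"
      "\<And>q_a. periodic_fun_simple (\<lambda>q_u. V P (q_u, q_a)) (2 * pi)"
    and pos_def: "\<And>q. positive_definite (inertia P q)"
    and m_au_nz: "\<And>q. m_au P q \<noteq> 0"
    and C2_constraint: "C2 s" "C2 K"
    and circle_constraint: "periodic_fun_simple s (2 * pi)" "periodic_fun_simple K (2 * pi)"
    and s_nz: "\<And>q. s q \<noteq> 0"
    and matching: "\<And>q. deriv K q = (s q - m_uu P q) / m_au P q"
    and gains: "\<gamma>1 > 0" "\<gamma>2 > 0"
begin

abbreviation "F \<equiv> closed_loop P s K \<gamma>1 \<gamma>2"
abbreviation "m \<equiv> m_target P s K"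
abbreviation "U \<equiv> U_target P s K"
abbreviation "U' x \<equiv> - (rho P s K x * m x)"

lemma m_uu_pos: "0 < m_uu P q"
proof -
  have "0 < axis 1 1 \<bullet> (inertia P q *v axis 1 (1::real))"
    using pos_def[of q] by (simp add: positive_definite_def axis_eq_0_iff)
  then show ?thesis
    by (simp add: inertia_def inner_axis' matrix_vector_mult_def sum_2 axis_def inner_vec_def)
qed

lemma s_eq: "s q = m_uu P q + m_au P q * deriv K q"
  using matching[of q] m_au_nz[of q] by simp

text \<open>The feedback contains \<open>K''\<close>, and a Lipschitz field needs \<open>K''\<close>
  to be C1 although \<open>K\<close> is only assumed C2. The missing derivative comes from the
  matching relation: \<open>K'\<close> is a quotient of C2 functions, so \<open>K''\<close> is a
  quotient of C1 functions.\<close>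

lemma C1_coefficients:
  "C1_real (m_uu P)" "C1_real (m_au P)" "C1_real (c_a P)" "C1_real (c_u P)" "C1_real s" "C1_real K"
  "C1_real (deriv K)" "C1_real (deriv (deriv K))"
  "C1_real (\<lambda>q. 1 / s q)" "C1_real (\<lambda>q. 1 / m_uu P q)"
proof -
  show C1: "C1_real (m_uu P)" "C1_real (m_au P)" "C1_real (c_a P)" "C1_real (c_u P)" "C1_real s"
    "C1_real K" "C1_real (deriv K)"
    by (intro C2_imp_C1_real C2_plant C2_constraint)+
  have num: "C1_real (\<lambda>q. s q - m_uu P q)"
    by (intro C1_real_diff C1)
  have "deriv (deriv K) q = ((deriv s q - deriv (m_uu P) q) * m_au P q
      - (s q - m_uu P q) * deriv (m_au P) q) / (m_au P q * m_au P q)" for q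
  proof (rule DERIV_imp_deriv)
    have "(deriv K has_real_derivative ((deriv s q - deriv (m_uu P) q) * m_au P q
      - (s q - m_uu P q) * deriv (m_au P) q) / (m_au P q * m_au P q)) (at q)
      = ((\<lambda>q. (s q - m_uu P q) / m_au P q) has_real_derivative ((deriv s q - deriv (m_uu P) q) * m_au P q
      - (s q - m_uu P q) * deriv (m_au P) q) / (m_au P q * m_au P q)) (at q)"
      using matching by (intro arg_cong[where f = "\<lambda>f. (f has_real_derivative _) _"]) (simp add: fun_eq_iff)
    then show "(deriv K has_real_derivative ((deriv s q - deriv (m_uu P) q) * m_au P q
      - (s q - m_uu P q) * deriv (m_au P) q) / (m_au P q * m_au P q)) (at q)"
      using DERIV_divide[OF DERIV_diff[OF C1_realD(1)[OF C1(5)] C1_realD(1)[OF C1(1)]]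
          C1_realD(1)[OF C1(2)] m_au_nz] by blast
  qed
  then have "deriv (deriv K) = (\<lambda>q. ((deriv s q - deriv (m_uu P) q) * m_au P q
      - (s q - m_uu P q) * deriv (m_au P) q) / (m_au P q * m_au P q))"
    by (rule ext)
  then show "C1_real (deriv (deriv K))"
    using m_au_nz
    by (simp only:) (intro C1_real_divide C1_real_diff C1_real_mult C1 num C2_imp_C1_real
        C2_plant C2_constraint, simp)
  show "C1_real (\<lambda>q. 1 / s q)" "C1_real (\<lambda>q. 1 / m_uu P q)"
    using s_nz m_uu_pos by (intro C1_real_divide C1_real_const C1; simp add: less_imp_neq[symmetric])+
qed

lemma periodic_coefficients:
  "periodic_fun_simple (deriv K) (2 * pi)" "periodic_fun_simple (deriv (deriv K)) (2 * pi)"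
  "periodic_fun_simple (\<lambda>q. 1 / s q) (2 * pi)" "periodic_fun_simple (\<lambda>q. 1 / m_uu P q) (2 * pi)"
proof -
  show "periodic_fun_simple (deriv K) (2 * pi)" "periodic_fun_simple (deriv (deriv K)) (2 * pi)"
    by (intro periodic_fun_simple_deriv circle_constraint)+
  show "periodic_fun_simple (\<lambda>q. 1 / s q) (2 * pi)" "periodic_fun_simple (\<lambda>q. 1 / m_uu P q) (2 * pi)"
    using circle_plant(1) circle_constraint(1) by (simp_all add: periodic_fun_simple_def)
qed

lemma grad_u_periodic: "grad_u P (q + 2 * pi) a = grad_u P q a"
  using periodic_fun_simple_deriv[OF circle_plant(6)[of a]]
  by (simp add: grad_u_def periodic_fun_simple_def)

lemma grad_u_continuous: "continuous_on A (\<lambda>(q, a). grad_u P q a)"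
  using grad_u_has_derivative[OF C2_plant(6)] has_derivative_continuous
  by (metis continuous_at_imp_continuous_on)

lemma beta_continuous: "continuous_on UNIV (beta P s K)"
  unfolding beta_def[abs_def] using s_nz
  by (intro continuous_intros C1_realD(3) C1_coefficients) auto

lemma rho_continuous: "continuous_on UNIV (rho P s K)"
proof -
  have "continuous_on UNIV (\<lambda>q. (\<lambda>(q, a). grad_u P q a) (q, K q))"
    by (rule continuous_on_compose2[OF grad_u_continuous[of UNIV]])
      (auto intro!: continuous_intros C1_realD(3) C1_coefficients)
  then have "continuous_on UNIV (\<lambda>q. grad_u P q (K q))"
    by simp
  then show ?thesis
    unfolding rho_def[abs_def] using s_nz
    by (intro continuous_on_minus continuous_on_divide C1_realD(3)[OF C1_coefficients(5)]) auto
qed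

lemma m_pos: "0 < m x"
  by (simp add: m_target_def)

lemma m_has_derivative: "(m has_real_derivative - 2 * beta P s K x * m x) (at x)"
  unfolding m_target_def[abs_def]
  by (auto intro!: derivative_eq_intros has_real_derivative_interval_integral beta_continuous)

lemma m_continuous: "continuous_on A m"
  using m_has_derivative DERIV_isCont by (blast intro: continuous_at_imp_continuous_on)

lemma U_has_derivative: "(U has_real_derivative U' x) (at x)"
  unfolding U_target_def[abs_def]
  by (intro DERIV_minus has_real_derivative_interval_integral continuous_intros rho_continuous m_continuous)

lemma U_continuous: "continuous_on A U"
  using U_has_derivative DERIV_isCont by (blast intro: continuous_at_imp_continuous_on)

lemma U'_continuous: "continuous_on UNIV (\<lambda>x. U' x)"
  by (intro continuous_intros rho_continuous m_continuous)

definition accel :: "state \<Rightarrow> real" where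
  "accel = (\<lambda>(x1, x2, x3, x4). - (1 / m_uu P x1) * (c_u P x1 * x4\<^sup>2 + c_a P x1 * x3\<^sup>2 + grad_u P x1 x2)
     + controller P s K \<gamma>1 \<gamma>2 (x1, x2, x3, x4) * - (m_au P x1 / m_uu P x1))"

lemma closed_loop_eq:
  "F (x1, x2, x3, x4) = (x3, x4, accel (x1, x2, x3, x4), controller P s K \<gamma>1 \<gamma>2 (x1, x2, x3, x4))"
  by (simp add: closed_loop_def drift_def input_field_def accel_def)

definition pert :: "state \<Rightarrow> real" where
  "pert = (\<lambda>(x1, x2, x3, x4). accel (x1, x2, x3, x4) - (rho P s K x1 + beta P s K x1 * x3\<^sup>2))"

text \<open>This is the requirement that the derivative of \<open>phi2\<close> be
  \<open>- \<gamma>1 * phi1 - \<gamma>2 * phi2\<close>. As \<open>accel\<close> itself contains the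
  input, it is a linear equation for the input with coefficient
  \<open>1 + K' * m_au / m_uu = s / m_uu\<close>, which never vanishes; the control law is its
  solution.\<close>

lemma controller_eq:
  "controller P s K \<gamma>1 \<gamma>2 (x1, x2, x3, x4)
     = deriv (deriv K) x1 * x3\<^sup>2 + deriv K x1 * accel (x1, x2, x3, x4)
       - \<gamma>1 * phi1 K (x1, x2, x3, x4) - \<gamma>2 * phi2 K (x1, x2, x3, x4)"
proof -
  define W where "W = c_u P x1 * x4\<^sup>2 + c_a P x1 * x3\<^sup>2 + grad_u P x1 x2"
  define E where "E = \<gamma>1 * phi1 K (x1, x2, x3, x4) + \<gamma>2 * phi2 K (x1, x2, x3, x4)"
  define u where "u = controller P s K \<gamma>1 \<gamma>2 (x1, x2, x3, x4)"
  have nz: "m_uu P x1 \<noteq> 0" "s x1 \<noteq> 0"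
    using m_uu_pos[of x1] s_nz[of x1] by auto
  have "u = (m_uu P x1 * deriv (deriv K) x1 * x3\<^sup>2 - deriv K x1 * W - m_uu P x1 * E) / s x1"
    using nz by (simp add: u_def controller_def W_def E_def field_simps)
  then have us: "u * s x1 = m_uu P x1 * deriv (deriv K) x1 * x3\<^sup>2 - deriv K x1 * W - m_uu P x1 * E"
    using nz by simp
  have "m_uu P x1 * accel (x1, x2, x3, x4) = - W - m_au P x1 * u"
    using nz by (simp add: accel_def W_def u_def field_simps)
  then have "deriv K x1 * (m_uu P x1 * accel (x1, x2, x3, x4)) = deriv K x1 * (- W - m_au P x1 * u)"
    by simp
  then have "m_uu P x1 * (deriv (deriv K) x1 * x3\<^sup>2 + deriv K x1 * accel (x1, x2, x3, x4) - E)
      = m_uu P x1 * deriv (deriv K) x1 * x3\<^sup>2 + deriv K x1 * (- W - m_au P x1 * u) - m_uu P x1 * E"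
    by (simp add: algebra_simps)
  also have "\<dots> = m_uu P x1 * u"
    using us s_eq[of x1] by (simp add: algebra_simps)
  finally show ?thesis
    using nz by (simp add: u_def E_def)
qed

text \<open>With the input eliminated and \<open>x2\<close>, \<open>x4\<close> expressed through
  \<open>e1\<close>, \<open>e2\<close>, the terms free of \<open>e1\<close>, \<open>e2\<close>
  cancel against \<open>rho\<close> and \<open>beta\<close>. What is left vanishes with
  \<open>e1\<close>, \<open>e2\<close> and is at most linear in \<open>x3\<close>, since the
  difference of \<open>x4\<^sup>2\<close> and \<open>(K' * x3)\<^sup>2\<close> has the factor
  \<open>e2\<close>.\<close>

lemma pert_eq:
  "pert (x1, x2, x3, x4) =
     - (c_u P x1 * (1 / s x1) * (2 * deriv K x1 * x3 + e2) * e2)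
     - (grad_u P x1 (K x1 + e1) - grad_u P x1 (K x1)) * (1 / s x1)
     + m_au P x1 * (1 / s x1) * (\<gamma>1 * e1 + \<gamma>2 * e2)"
  if e: "e1 = phi1 K (x1, x2, x3, x4)" "e2 = phi2 K (x1, x2, x3, x4)"
proof -
  define A where "A = accel (x1, x2, x3, x4)"
  have nz: "m_uu P x1 \<noteq> 0" "s x1 \<noteq> 0"
    using m_uu_pos[of x1] s_nz[of x1] by auto
  have x2: "x2 = K x1 + e1" and x4: "x4 = deriv K x1 * x3 + e2"
    using e by (auto simp: phi1_def phi2_def)
  define u where "u = deriv (deriv K) x1 * x3\<^sup>2 + deriv K x1 * A - \<gamma>1 * e1 - \<gamma>2 * e2"
  have "controller P s K \<gamma>1 \<gamma>2 (x1, x2, x3, x4) = u"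
    by (simp add: controller_eq u_def A_def e)
  then have "m_uu P x1 * A = - (c_u P x1 * x4\<^sup>2 + c_a P x1 * x3\<^sup>2 + grad_u P x1 x2) - m_au P x1 * u"
    using nz by (simp add: A_def accel_def field_simps)
  \<comment> \<open>The multiples of \<open>A\<close> from both sides add up to
    \<open>m_uu + m_au * K'\<close>, which is \<open>s\<close>.\<close>
  then have "s x1 * A = - (c_u P x1 * x4\<^sup>2 + c_a P x1 * x3\<^sup>2 + grad_u P x1 x2)
      - m_au P x1 * (deriv (deriv K) x1 * x3\<^sup>2 - \<gamma>1 * e1 - \<gamma>2 * e2)"
    by (simp add: s_eq u_def algebra_simps)
  then have A: "A = (- (c_u P x1 * x4\<^sup>2 + c_a P x1 * x3\<^sup>2 + grad_u P x1 x2)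
      - m_au P x1 * (deriv (deriv K) x1 * x3\<^sup>2 - \<gamma>1 * e1 - \<gamma>2 * e2)) / s x1"
    using nz by (simp add: field_simps)
  have "pert (x1, x2, x3, x4) = A - (rho P s K x1 + beta P s K x1 * x3\<^sup>2)"
    by (simp add: pert_def A_def)
  also have "\<dots> = - (c_u P x1 * (1 / s x1) * (2 * deriv K x1 * x3 + e2) * e2)
     - (grad_u P x1 (K x1 + e1) - grad_u P x1 (K x1)) * (1 / s x1)
     + m_au P x1 * (1 / s x1) * (\<gamma>1 * e1 + \<gamma>2 * e2)"
    unfolding A rho_def beta_def x2 x4 using nz
    by (simp add: divide_simps) (simp add: power2_eq_square algebra_simps)
  finally show ?thesis .
qed

text \<open>Linear growth in \<open>x3\<close> is the point: multiplied by the velocity,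
  \<open>pert\<close> is then dominated by the kinetic energy up to a constant, which a Gronwall
  estimate can absorb.\<close>

lemma pert_bound:
  obtains C where "0 \<le> C"
    "\<And>x1 x2 x3 x4. \<bar>phi1 K (x1, x2, x3, x4)\<bar> \<le> r \<Longrightarrow> \<bar>phi2 K (x1, x2, x3, x4)\<bar> \<le> r \<Longrightarrow>
      \<bar>pert (x1, x2, x3, x4)\<bar> \<le>
        C * (\<bar>phi1 K (x1, x2, x3, x4)\<bar> + \<bar>phi2 K (x1, x2, x3, x4)\<bar>) * (1 + \<bar>x3\<bar>)"
proof -
  have bd: "\<exists>B\<ge>0. \<forall>x. \<bar>f x\<bar> \<le> B" if "C1_real f" "periodic_fun_simple f (2 * pi)" for f
    using periodic_bounded[OF that(2) _ C1_realD(3)[OF that(1)]] by simp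
  obtain Bc where Bc: "0 \<le> Bc" "\<And>q. \<bar>c_u P q\<bar> \<le> Bc"
    using bd[OF C1_coefficients(4) circle_plant(5)] by blast
  obtain Bm where Bm: "0 \<le> Bm" "\<And>q. \<bar>m_au P q\<bar> \<le> Bm"
    using bd[OF C1_coefficients(2) circle_plant(2)] by blast
  obtain Bs where Bs: "0 \<le> Bs" "\<And>q. \<bar>1 / s q\<bar> \<le> Bs"
    using bd[OF C1_coefficients(9) periodic_coefficients(3)] by blast
  obtain Bd where Bd: "0 \<le> Bd" "\<And>q. \<bar>deriv K q\<bar> \<le> Bd"
    using bd[OF C1_coefficients(7) periodic_coefficients(1)] by blast
  obtain BK where BK: "0 \<le> BK" "\<And>q. \<bar>K q\<bar> \<le> BK"
    using bd[OF C1_coefficients(6) circle_constraint(2)] by blast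
  \<comment> \<open>The strip is wide enough to contain both \<open>K x1\<close> and
    \<open>K x1 + e1\<close>; \<open>\<bar>r\<bar>\<close> is used because \<open>r\<close> is not
    assumed non-negative.\<close>
  obtain L where L: "L-lipschitz_on (UNIV \<times> {- (BK + \<bar>r\<bar>)..BK + \<bar>r\<bar>}) (\<lambda>(q, a). grad_u P q a)"
    using grad_u_bounded_lipschitz[OF C2_plant(6) circle_plant(6)] unfolding bounded_lipschitz_on_def by blast
  have L0: "0 \<le> L"
    using L by (rule lipschitz_on_nonneg)
  define C where "C = Bc * Bs * (2 * Bd + \<bar>r\<bar>) + L * Bs + Bm * Bs * (\<gamma>1 + \<gamma>2)"
  have C0: "0 \<le> C"
    using Bc Bm Bs Bd L0 gains by (simp add: C_def)
  have "\<bar>pert (x1, x2, x3, x4)\<bar> \<le> C * (\<bar>e1\<bar> + \<bar>e2\<bar>) * (1 + \<bar>x3\<bar>)"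
    if e: "e1 = phi1 K (x1, x2, x3, x4)" "e2 = phi2 K (x1, x2, x3, x4)" and r: "\<bar>e1\<bar> \<le> r" "\<bar>e2\<bar> \<le> r"
    for x1 x2 x3 x4 e1 e2
  proof -
    define S where "S = (\<bar>e1\<bar> + \<bar>e2\<bar>) * (1 + \<bar>x3\<bar>)"
    have S0: "0 \<le> S"
      by (simp add: S_def)
    have S1: "\<bar>e1\<bar> + \<bar>e2\<bar> \<le> S"
      using mult_left_mono[of 1 "1 + \<bar>x3\<bar>" "\<bar>e1\<bar> + \<bar>e2\<bar>"] by (simp add: S_def)
    have "\<bar>2 * deriv K x1 * x3 + e2\<bar> \<le> 2 * Bd * \<bar>x3\<bar> + \<bar>r\<bar>"
    proof -
      have "\<bar>2 * deriv K x1 * x3 + e2\<bar> \<le> 2 * (\<bar>deriv K x1\<bar> * \<bar>x3\<bar>) + \<bar>e2\<bar>"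
        by (rule order_trans[OF abs_triangle_ineq]) (simp add: abs_mult)
      also have "\<dots> \<le> 2 * (Bd * \<bar>x3\<bar>) + \<bar>r\<bar>"
        using Bd(2)[of x1] r by (intro add_mono mult_left_mono mult_right_mono) auto
      finally show ?thesis by simp
    qed
    also have "\<dots> \<le> (2 * Bd + \<bar>r\<bar>) * (1 + \<bar>x3\<bar>)"
      using Bd by (simp add: algebra_simps)
    finally have "\<bar>c_u P x1\<bar> * \<bar>1 / s x1\<bar> * \<bar>2 * deriv K x1 * x3 + e2\<bar> * \<bar>e2\<bar>
        \<le> Bc * Bs * ((2 * Bd + \<bar>r\<bar>) * (1 + \<bar>x3\<bar>)) * (\<bar>e1\<bar> + \<bar>e2\<bar>)"
      using Bc Bs Bd by (intro mult_mono mult_nonneg_nonneg) auto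
    then have 1: "\<bar>c_u P x1 * (1 / s x1) * (2 * deriv K x1 * x3 + e2) * e2\<bar> \<le> Bc * Bs * (2 * Bd + \<bar>r\<bar>) * S"
      by (simp add: abs_mult S_def mult_ac)
    have "\<bar>grad_u P x1 (K x1 + e1) - grad_u P x1 (K x1)\<bar> \<le> L * \<bar>e1\<bar>"
      using lipschitz_onD[OF L, of "(x1, K x1 + e1)" "(x1, K x1)"] BK(2)[of x1] r
      by (simp add: dist_Pair_Pair dist_real_def abs_le_iff)
    also have "\<dots> \<le> L * S"
      using S1 L0 by (intro mult_left_mono) auto
    finally have "\<bar>grad_u P x1 (K x1 + e1) - grad_u P x1 (K x1)\<bar> * \<bar>1 / s x1\<bar> \<le> L * S * Bs"
      using Bs L0 S0 by (intro mult_mono) auto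
    then have 2: "\<bar>(grad_u P x1 (K x1 + e1) - grad_u P x1 (K x1)) * (1 / s x1)\<bar> \<le> L * Bs * S"
      by (simp add: abs_mult mult_ac)
    have "\<bar>\<gamma>1 * e1 + \<gamma>2 * e2\<bar> \<le> \<gamma>1 * \<bar>e1\<bar> + \<gamma>2 * \<bar>e2\<bar>"
      using gains by (intro order_trans[OF abs_triangle_ineq]) (simp add: abs_mult)
    also have "\<dots> \<le> (\<gamma>1 + \<gamma>2) * (\<bar>e1\<bar> + \<bar>e2\<bar>)"
      using gains by (simp add: algebra_simps)
    also have "\<dots> \<le> (\<gamma>1 + \<gamma>2) * S"
      using S1 gains by (intro mult_left_mono) auto
    finally have "\<bar>m_au P x1\<bar> * \<bar>1 / s x1\<bar> * \<bar>\<gamma>1 * e1 + \<gamma>2 * e2\<bar> \<le> Bm * Bs * ((\<gamma>1 + \<gamma>2) * S)"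
      using Bm Bs by (intro mult_mono mult_nonneg_nonneg) auto
    then have 3: "\<bar>m_au P x1 * (1 / s x1) * (\<gamma>1 * e1 + \<gamma>2 * e2)\<bar> \<le> Bm * Bs * (\<gamma>1 + \<gamma>2) * S"
      by (simp add: abs_mult mult_ac)
    have "\<bar>pert (x1, x2, x3, x4)\<bar> \<le> Bc * Bs * (2 * Bd + \<bar>r\<bar>) * S + L * Bs * S + Bm * Bs * (\<gamma>1 + \<gamma>2) * S"
      unfolding pert_eq[OF e] using 1 2 3 by linarith
    also have "\<dots> = C * S"
      by (simp add: C_def algebra_simps)
    finally show ?thesis
      by (simp add: S_def mult_ac)
  qed
  then show ?thesis
    by (intro that[of C] C0) auto
qed

lemma pert_zero: "pert (pi_map K \<xi>) = 0"
  by (cases \<xi>) (simp add: pi_map_def pert_eq[OF refl refl] phi1_def phi2_def)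

lemma phi_pi_map: "phi1 K (pi_map K \<xi>) = 0" "phi2 K (pi_map K \<xi>) = 0"
  by (cases \<xi>; simp add: pi_map_def phi1_def phi2_def)+

end

subsection \<open>Existence of trajectories and decay of the transverse coordinates\<close>

lemma exp_neg_tendsto_0:
  fixes l :: real
  assumes "0 < l"
  shows "((\<lambda>t. exp (- l * t)) \<longlongrightarrow> 0) at_top"
proof -
  have "filterlim (\<lambda>t. - l * t) at_bot at_top"
    using assms by (intro filterlim_tendsto_neg_mult_at_bot[OF tendsto_const _ filterlim_ident]) simp
  then show ?thesis
    by (rule filterlim_compose[OF exp_at_bot])
qed

text \<open>The added term is the integral of the bound from the current time to infinity; its
  decrease compensates the largest possible growth of \<open>f\<close>.\<close>

lemma exp_bounded_derivative_upper:
  fixes f :: "real \<Rightarrow> real"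
  assumes st: "s \<le> t" and l: "0 < l"
    and f: "\<And>u. s \<le> u \<Longrightarrow> u \<le> t \<Longrightarrow> (f has_real_derivative f' u) (at u within {s..t})"
    and f': "\<And>u. s \<le> u \<Longrightarrow> u \<le> t \<Longrightarrow> f' u \<le> D * exp (- l * u)"
  shows "f t + D / l * exp (- l * t) \<le> f s + D / l * exp (- l * s)"
proof (rule nonincreasing_within[OF st])
  fix u assume u: "s \<le> u" "u \<le> t"
  show "((\<lambda>u. f u + D / l * exp (- l * u)) has_real_derivative f' u - D * exp (- l * u)) (at u within {s..t})"
    using l by (auto intro!: derivative_eq_intros f u)
  show "f' u - D * exp (- l * u) \<le> 0"
    using f'[OF u] by simp
qed

lemma exp_bounded_derivative_dist:
  fixes f :: "real \<Rightarrow> real"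
  assumes t: "0 \<le> t" and l: "0 < l"
    and f: "\<And>u. 0 \<le> u \<Longrightarrow> u \<le> t \<Longrightarrow> (f has_real_derivative f' u) (at u within {0..t})"
    and f': "\<And>u. 0 \<le> u \<Longrightarrow> u \<le> t \<Longrightarrow> \<bar>f' u\<bar> \<le> D * exp (- l * u)"
  shows "\<bar>f t - f 0\<bar> \<le> D / l"
proof -
  have "0 \<le> D"
    using f'[of 0] t by auto
  then have "0 \<le> D / l * exp (- l * t)"
    using l by simp
  moreover have "f t + D / l * exp (- l * t) \<le> f 0 + D / l * exp (- l * 0)"
    using f f' by (intro exp_bounded_derivative_upper[OF t l]) (auto simp: abs_le_iff)
  moreover have "- f t + D / l * exp (- l * t) \<le> - f 0 + D / l * exp (- l * 0)"
    using f f' by (intro exp_bounded_derivative_upper[OF t l DERIV_minus]) (auto simp: abs_le_iff)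
  ultimately show ?thesis
    by (simp add: abs_le_iff)
qed

lemma exp_bounded_derivative_converges:
  fixes f :: "real \<Rightarrow> real"
  assumes l: "0 < l"
    and f: "\<And>u. 0 \<le> u \<Longrightarrow> (f has_real_derivative f' u) (at u within {0..})"
    and f': "\<And>u. 0 \<le> u \<Longrightarrow> \<bar>f' u\<bar> \<le> D * exp (- l * u)"
  shows "\<exists>d. (f \<longlongrightarrow> d) at_top"
proof -
  \<comment> \<open>\<open>g\<close> is nonincreasing and bounded below, hence convergent, and its
    difference from \<open>f\<close> tends to 0.\<close>
  define g where "g u = f u + D / l * exp (- l * u)" for u
  have f_sub: "(f has_real_derivative f' u) (at u within {a..b})" if "0 \<le> a" "a \<le> u" for a b u
    using that by (intro has_field_derivative_subset[OF f]) auto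
  have D: "0 \<le> D"
    using f'[of 0] by auto
  have anti: "g t \<le> g u" if "0 \<le> u" "u \<le> t" for u t
    unfolding g_def using that f'
    by (intro exp_bounded_derivative_upper[OF _ l f_sub]) (auto simp: abs_le_iff)
  have lower: "f 0 - D / l \<le> g t" if "0 \<le> t" for t
  proof -
    have "\<bar>f t - f 0\<bar> \<le> D / l"
      using that f' by (intro exp_bounded_derivative_dist[OF _ l f_sub]) auto
    moreover have "0 \<le> D / l * exp (- l * t)"
      using D l by simp
    ultimately show ?thesis
      by (simp add: g_def abs_le_iff)
  qed
  then have bdd: "bdd_below (g ` {0..})"
    by (auto simp: bdd_below_def)
  define d where "d = Inf (g ` {0..})"
  have "(g \<longlongrightarrow> d) at_top"
  proof (rule order_tendstoI)
    fix e assume "e < d"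
    have "e < g t" if "0 \<le> t" for t
      using cINF_lower[OF bdd, of t] that \<open>e < d\<close> by (simp add: d_def)
    then show "\<forall>\<^sub>F t in at_top. e < g t"
      using eventually_at_top_linorder by blast
  next
    fix e assume "d < e"
    then obtain u where "0 \<le> u" "g u < e"
      using cINF_less_iff[OF _ bdd, of e] by (auto simp: d_def)
    then have "g t < e" if "u \<le> t" for t
      using anti[of u t] that by simp
    then show "\<forall>\<^sub>F t in at_top. g t < e"
      using eventually_at_top_linorder by blast
  qed
  then have "((\<lambda>t. g t - D / l * exp (- l * t)) \<longlongrightarrow> d - D / l * 0) at_top"
    by (intro tendsto_intros exp_neg_tendsto_0 l)
  then show ?thesis
    by (auto simp: g_def)
qed

section \<open>Trajectories from a truncated field\<close>

lemma solution_subset: "solution F J x \<Longrightarrow> I \<subseteq> J \<Longrightarrow> solution F I x"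
  unfolding solution_def by (meson has_vector_derivative_within_subset subsetD)

lemma solution_continuous_on: "solution F J x \<Longrightarrow> continuous_on J x"
  unfolding solution_def by (meson continuous_on_eq_continuous_within has_vector_derivative_continuous)

text \<open>The angle is not truncated: the coefficients are periodic in it, so uniform bounds hold
  in that direction anyway.\<close>

definition clip :: "real \<Rightarrow> state \<Rightarrow> state" where
  "clip R = (\<lambda>(x1, x2, x3, x4). (x1, max (- R) (min R x2), max (- R) (min R x3), max (- R) (min R x4)))"

definition slab :: "real \<Rightarrow> state set" where
  "slab R = {(x1, x2, x3, x4). \<bar>x2\<bar> \<le> R \<and> \<bar>x3\<bar> \<le> R \<and> \<bar>x4\<bar> \<le> R}"

lemma clip_in_slab: "0 \<le> R \<Longrightarrow> clip R x \<in> slab R"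
  by (auto simp: clip_def slab_def split: prod.split)

lemma clip_id: "x \<in> slab R \<Longrightarrow> clip R x = x"
  by (auto simp: clip_def slab_def)

lemma lipschitz_on_clip: "1-lipschitz_on UNIV (clip R)"
proof (rule lipschitz_onI)
  fix x y :: state
  have c: "(dist (max (- R) (min R u)) (max (- R) (min R v)))\<^sup>2 \<le> (dist u v)\<^sup>2" for u v :: real
    by (intro power_mono) (auto simp: dist_real_def)
  obtain x1 x2 x3 x4 y1 y2 y3 y4 where "x = (x1, x2, x3, x4)" "y = (y1, y2, y3, y4)"
    by (metis prod.exhaust)
  then show "dist (clip R x) (clip R y) \<le> 1 * dist x y"
    using c by (auto simp: clip_def dist_Pair_Pair intro!: real_sqrt_le_mono add_mono)
qed simp

context constrained_plant
begin

lemma lipschitz_on_slab: "\<exists>L. L-lipschitz_on (slab R) F"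
proof -
  let ?S = "slab R"
  have proj: "1-lipschitz_on ?S fst" "1-lipschitz_on ?S (\<lambda>x. fst (snd x))"
    "1-lipschitz_on ?S (\<lambda>x. fst (snd (snd x)))" "1-lipschitz_on ?S (\<lambda>x. snd (snd (snd x)))"
    using dist_fst_le order_trans[OF dist_fst_le dist_snd_le]
      order_trans[OF order_trans[OF dist_fst_le dist_snd_le] dist_snd_le]
      order_trans[OF order_trans[OF dist_snd_le dist_snd_le] dist_snd_le]
    by (auto intro!: lipschitz_onI)
  have coord: "bounded_lipschitz_on ?S (\<lambda>x. fst (snd x))"
    "bounded_lipschitz_on ?S (\<lambda>x. fst (snd (snd x)))" "bounded_lipschitz_on ?S (\<lambda>x. snd (snd (snd x)))"
    unfolding bounded_lipschitz_on_def using proj by (force simp: slab_def)+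
  have coeff: "bounded_lipschitz_on ?S (\<lambda>x. f (fst x))" if "C1_real f" "periodic_fun_simple f (2 * pi)" for f
    by (rule bounded_lipschitz_on_compose[OF bounded_lipschitz_on_periodic[OF that, of UNIV] proj(1)]) simp
  have grad: "bounded_lipschitz_on ?S (\<lambda>x. grad_u P (fst x) (fst (snd x)))"
  proof -
    have "(sqrt (1\<^sup>2 + 1\<^sup>2))-lipschitz_on ?S (\<lambda>x. (fst x, fst (snd x)))"
      by (intro lipschitz_on_Pair proj)
    moreover have "(\<lambda>x. (fst x, fst (snd x))) ` ?S \<subseteq> UNIV \<times> {- R..R}"
      by (auto simp: slab_def)
    ultimately show ?thesis
      using bounded_lipschitz_on_compose[OF grad_u_bounded_lipschitz[OF C2_plant(6) circle_plant(6)]] by force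
  qed
  note rules = bounded_lipschitz_on_add bounded_lipschitz_on_diff bounded_lipschitz_on_mult
    bounded_lipschitz_on_minus bounded_lipschitz_on_power2 bounded_lipschitz_on_const
    bounded_lipschitz_on_divide coord grad
    coeff[OF C1_coefficients(1) circle_plant(1)] coeff[OF C1_coefficients(2) circle_plant(2)]
    coeff[OF C1_coefficients(3) circle_plant(4)] coeff[OF C1_coefficients(4) circle_plant(5)]
    coeff[OF C1_coefficients(6) circle_constraint(2)]
    coeff[OF C1_coefficients(7) periodic_coefficients(1)] coeff[OF C1_coefficients(8) periodic_coefficients(2)]
    coeff[OF C1_coefficients(9) periodic_coefficients(3), folded inverse_eq_divide]
    coeff[OF C1_coefficients(10) periodic_coefficients(4), folded inverse_eq_divide]
  have u: "bounded_lipschitz_on ?S (controller P s K \<gamma>1 \<gamma>2)"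
    unfolding controller_def phi1_def phi2_def split_beta fst_conv snd_conv by (intro rules)
  have a: "bounded_lipschitz_on ?S accel"
    unfolding accel_def split_beta prod.collapse by (intro rules u)
  obtain L1 L2 where L: "L1-lipschitz_on ?S accel" "L2-lipschitz_on ?S (controller P s K \<gamma>1 \<gamma>2)"
    using u a unfolding bounded_lipschitz_on_def by blast
  have "\<exists>L. L-lipschitz_on ?S (\<lambda>x. (fst (snd (snd x)), snd (snd (snd x)), accel x, controller P s K \<gamma>1 \<gamma>2 x))"
    using lipschitz_on_Pair[OF proj(3) lipschitz_on_Pair[OF proj(4) lipschitz_on_Pair[OF L]]] by blast
  moreover have "F = (\<lambda>x. (fst (snd (snd x)), snd (snd (snd x)), accel x, controller P s K \<gamma>1 \<gamma>2 x))"
    by (auto simp: fun_eq_iff closed_loop_eq)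
  ultimately show ?thesis
    by simp
qed

text \<open>The truncated field is globally Lipschitz and has a solution for all times. As long as
  this solution stays in a slab larger than \<open>slab B\<close> it solves the true equation, so
  the a priori bound returns it to \<open>slab B\<close> and it never reaches the
  truncation.\<close>

lemma solution_exists:
  assumes apriori: "\<And>T x t. solution F {0..T} x \<Longrightarrow> x 0 = x0 \<Longrightarrow> 0 \<le> t \<Longrightarrow> t \<le> T \<Longrightarrow> x t \<in> slab B"
  shows "\<exists>x. solution F {0..} x \<and> x 0 = x0"
proof -
  \<comment> \<open>On the degenerate time interval any constant is a solution, so the a priori
    bound covers the initial state itself.\<close>
  have "solution F {0..0} (\<lambda>_. x0)"
    by (auto simp: solution_def has_vector_derivative_def has_derivative_within_singleton_iff
        bounded_linear_scaleR_left)
  then have x0: "x0 \<in> slab B"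
    using apriori[of 0 "\<lambda>_. x0" 0] by simp
  define R where "R = B + 1"
  have R: "0 \<le> R" "B < R"
    using x0 by (auto simp: R_def slab_def)
  obtain L where "L-lipschitz_on (slab R) F"
    using lipschitz_on_slab by blast
  then have "(L * 1)-lipschitz_on UNIV (\<lambda>x. F (clip R x))"
    using clip_in_slab[OF R(1)]
    by (intro lipschitz_on_compose2 lipschitz_on_clip) (auto intro: lipschitz_on_subset)
  then obtain x where x: "solution (\<lambda>x. F (clip R x)) {0..} x" "x 0 = x0"
    using global_solution_lipschitz by blast
  define Q :: "state set" where "Q = {x. \<bar>fst (snd x)\<bar> < R \<and> \<bar>fst (snd (snd x))\<bar> < R \<and> \<bar>snd (snd (snd x))\<bar> < R}"
  have Q: "open Q"
    unfolding Q_def by (intro open_Collect_conj open_Collect_less continuous_intros)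
  have slab_eq: "slab r = {x. \<bar>fst (snd x)\<bar> \<le> r \<and> \<bar>fst (snd (snd x))\<bar> \<le> r \<and> \<bar>snd (snd (snd x))\<bar> \<le> r}" for r
    by (auto simp: slab_def)
  have C: "closed (slab R)"
    unfolding slab_eq by (intro closed_Collect_conj closed_Collect_le continuous_intros)
  have BQ: "slab B \<subseteq> Q" and QC: "Q \<subseteq> slab R"
    using R by (auto simp: Q_def slab_def)
  have sol: "solution F I x" if "I \<subseteq> {0..}" "\<And>t. t \<in> I \<Longrightarrow> x t \<in> slab R" for I
    using solution_subset[OF x(1) that(1)] that(2) by (simp add: solution_def clip_id)
  have "x t \<in> Q" if t: "0 \<le> t" for t
  proof (rule stays_in_open[of t x Q "slab R"])
    show "continuous_on {0..t} x"
      using solution_continuous_on[OF x(1)] by (rule continuous_on_subset) auto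
    show "x 0 \<in> Q"
      using x0 x BQ by auto
    show "x v \<in> Q" if "0 \<le> v" "\<And>s. 0 \<le> s \<Longrightarrow> s \<le> v \<Longrightarrow> x s \<in> slab R" for v
      using apriori[of v x v] sol[of "{0..v}"] x(2) that BQ by auto
  qed (use Q C QC t in auto)
  then have "solution F {0..} x"
    using QC by (intro sol) auto
  then show ?thesis
    using x by blast
qed

lemma solution_derivatives:
  assumes x: "solution F J x" and t: "t \<in> J"
  shows "((\<lambda>t. fst (x t)) has_real_derivative fst (snd (snd (x t)))) (at t within J)"
    "((\<lambda>t. fst (snd (snd (x t)))) has_real_derivative accel (x t)) (at t within J)"
    "((\<lambda>t. phi1 K (x t)) has_real_derivative phi2 K (x t)) (at t within J)"
    "((\<lambda>t. phi2 K (x t)) has_real_derivative - \<gamma>1 * phi1 K (x t) - \<gamma>2 * phi2 K (x t)) (at t within J)"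
proof -
  obtain x1 x2 x3 x4 where xt: "x t = (x1, x2, x3, x4)"
    by (metis prod.exhaust)
  have D: "(x has_vector_derivative (x3, x4, accel (x t), controller P s K \<gamma>1 \<gamma>2 (x t))) (at t within J)"
    using x t by (auto simp: solution_def xt closed_loop_eq)
  note D2 = bounded_linear.has_vector_derivative[OF bounded_linear_snd D]
  note D3 = bounded_linear.has_vector_derivative[OF bounded_linear_snd D2]
  show 1: "((\<lambda>t. fst (x t)) has_real_derivative fst (snd (snd (x t)))) (at t within J)"
    using bounded_linear.has_vector_derivative[OF bounded_linear_fst D]
    by (simp add: has_real_derivative_iff_has_vector_derivative xt)
  have 2: "((\<lambda>t. fst (snd (x t))) has_real_derivative x4) (at t within J)"
    using bounded_linear.has_vector_derivative[OF bounded_linear_fst D2]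
    by (simp add: has_real_derivative_iff_has_vector_derivative)
  show 3: "((\<lambda>t. fst (snd (snd (x t)))) has_real_derivative accel (x t)) (at t within J)"
    using bounded_linear.has_vector_derivative[OF bounded_linear_fst D3]
    by (simp add: has_real_derivative_iff_has_vector_derivative)
  have 4: "((\<lambda>t. snd (snd (snd (x t)))) has_real_derivative controller P s K \<gamma>1 \<gamma>2 (x t)) (at t within J)"
    using bounded_linear.has_vector_derivative[OF bounded_linear_snd D3]
    by (simp add: has_real_derivative_iff_has_vector_derivative)
  have K1: "((\<lambda>t. K (fst (x t))) has_real_derivative deriv K x1 * x3) (at t within J)"
    using DERIV_chain2[OF C1_realD(1)[OF C1_coefficients(6)] 1] by (simp add: xt)
  have K2: "((\<lambda>t. deriv K (fst (x t))) has_real_derivative deriv (deriv K) x1 * x3) (at t within J)"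
    using DERIV_chain2[OF C1_realD(1)[OF C1_coefficients(7)] 1] by (simp add: xt)
  have phi: "phi1 K z = fst (snd z) - K (fst z)" "phi2 K z = snd (snd (snd z)) - deriv K (fst z) * fst (snd (snd z))" for z
    by (simp_all add: phi1_def phi2_def split_beta)
  show "((\<lambda>t. phi1 K (x t)) has_real_derivative phi2 K (x t)) (at t within J)"
    using DERIV_diff[OF 2 K1] by (simp add: phi xt)
  show "((\<lambda>t. phi2 K (x t)) has_real_derivative - \<gamma>1 * phi1 K (x t) - \<gamma>2 * phi2 K (x t)) (at t within J)"
    using DERIV_diff[OF 4 DERIV_mult'[OF K2 3]]
    by (simp add: phi xt controller_eq power2_eq_square algebra_simps)
qed

section \<open>Energy and the Lyapunov function of the transverse coordinates\<close>

definition energy :: "state \<Rightarrow> real" where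
  "energy x = m (fst x) * (fst (snd (snd x)))\<^sup>2 / 2 + U (fst x)"

text \<open>\<open>m\<close> is the integrating factor that removes the velocity-squared term: its
  derivative cancels \<open>beta\<close>, and that of \<open>U\<close> cancels \<open>rho\<close>,
  leaving only the power of \<open>pert\<close>.\<close>

lemma energy_derivative:
  assumes x: "solution F J x" and t: "t \<in> J"
  shows "((\<lambda>t. energy (x t)) has_real_derivative m (fst (x t)) * fst (snd (snd (x t))) * pert (x t)) (at t within J)"
proof -
  define q v where "q = fst (x t)" and "v = fst (snd (snd (x t)))"
  note 1 = solution_derivatives(1,2)[OF x t]
  have a: "accel (x t) = rho P s K q + beta P s K q * v\<^sup>2 + pert (x t)"
    by (simp add: pert_def q_def v_def split_beta)
  have "((\<lambda>t. energy (x t)) has_real_derivative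
      (- 2 * beta P s K q * m q * v * v\<^sup>2 + 2 * v * accel (x t) * m q) / 2 + U' q * v) (at t within J)"
    unfolding energy_def
    by (auto intro!: derivative_eq_intros DERIV_chain2[OF m_has_derivative 1(1)] DERIV_chain2[OF U_has_derivative 1(1)] 1(2)
        simp: q_def v_def field_simps)
  moreover have "(- 2 * beta P s K q * m q * v * v\<^sup>2 + 2 * v * accel (x t) * m q) / 2 + U' q * v = m q * v * pert (x t)"
    unfolding a by (simp add: power2_eq_square algebra_simps)
  ultimately show ?thesis
    by (simp add: q_def v_def)
qed

lemma energy_continuous: "continuous_on A energy"
  unfolding energy_def[abs_def]
  by (intro continuous_intros continuous_on_compose2[OF m_continuous[of UNIV]]
      continuous_on_compose2[OF U_continuous[of UNIV]]) auto

lemma phi_continuous: "continuous_on A (phi1 K)" "continuous_on A (phi2 K)"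
  unfolding phi1_def phi2_def split_beta
  by (intro continuous_intros continuous_on_compose2[OF C1_realD(3)[OF C1_coefficients(6), of UNIV]]
      continuous_on_compose2[OF C1_realD(3)[OF C1_coefficients(7), of UNIV]]; simp)+

text \<open>The cross term produces dissipation in \<open>phi1\<close> as well: along the closed
  loop the derivative is \<open>- \<gamma>2 * (phi2\<^sup>2 + \<gamma>1 * phi1\<^sup>2)\<close>.
  This treats all positive gains alike, without distinguishing real and complex eigenvalues.\<close>

definition lyap :: "state \<Rightarrow> real" where
  "lyap x = (\<gamma>1 + \<gamma>2\<^sup>2 / 2) * (phi1 K x)\<^sup>2 + (phi2 K x)\<^sup>2 + \<gamma>2 * phi1 K x * phi2 K x"

lemma lyap_continuous: "continuous_on A lyap"
  unfolding lyap_def[abs_def] by (intro continuous_intros phi_continuous)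

lemma lyap_eq:
  "lyap x = \<gamma>1 * (phi1 K x)\<^sup>2 + (\<gamma>2 / 2 * phi1 K x)\<^sup>2 + (\<gamma>2 / 2 * phi1 K x + phi2 K x)\<^sup>2"
  by (simp add: lyap_def power2_eq_square algebra_simps)

lemma lyap_nonneg: "0 \<le> lyap x"
  using gains by (simp add: lyap_eq)

lemma phi_decay:
  obtains k l where "0 < k" "0 < l"
    "\<And>T x t. solution F {0..T} x \<Longrightarrow> 0 \<le> t \<Longrightarrow> t \<le> T \<Longrightarrow>
      \<bar>phi1 K (x t)\<bar> + \<bar>phi2 K (x t)\<bar> \<le> k * sqrt (lyap (x 0)) * exp (- l * t)"
proof -
  \<comment> \<open>\<open>c\<close> bounds \<open>lyap\<close> by the sum of squares, and the
    dissipation is at least \<open>\<gamma>2 * min 1 \<gamma>1\<close> times that sum. So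
    \<open>lyap\<close> decays at rate \<open>2 * l\<close> and its root at rate
    \<open>l\<close>.\<close>
  define c where "c = \<gamma>1 + \<gamma>2\<^sup>2 / 2 + 1 + \<gamma>2 / 2"
  have c: "0 < c"
    using gains by (simp add: c_def add_pos_nonneg)
  define l where "l = \<gamma>2 * min 1 \<gamma>1 / (2 * c)"
  have l: "0 < l"
    using gains c by (simp add: l_def)
  \<comment> \<open>The two summands come from \<open>\<gamma>1 * phi1\<^sup>2 \<le> lyap\<close>
    and \<open>phi2\<^sup>2 \<le> 2 * lyap\<close>, the latter by the parallelogram
    identity.\<close>
  define k where "k = 1 / sqrt \<gamma>1 + sqrt 2"
  have k: "0 < k"
    using gains by (simp add: k_def add_pos_pos)
  have rate: "2 * l * lyap x \<le> \<gamma>2 * ((phi2 K x)\<^sup>2 + \<gamma>1 * (phi1 K x)\<^sup>2)" for x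
  proof -
    define S where "S = (phi1 K x)\<^sup>2 + (phi2 K x)\<^sup>2"
    have "2 * (phi1 K x * phi2 K x) \<le> S"
      using sum_squares_bound[of "phi1 K x" "phi2 K x"] by (simp add: S_def)
    then have "\<gamma>2 / 2 * (2 * (phi1 K x * phi2 K x)) \<le> \<gamma>2 / 2 * S"
      using gains by (intro mult_left_mono) auto
    moreover have "(\<gamma>1 + \<gamma>2\<^sup>2 / 2) * (phi1 K x)\<^sup>2 \<le> (\<gamma>1 + \<gamma>2\<^sup>2 / 2) * S"
      using gains by (intro mult_left_mono) (auto simp: S_def)
    moreover have "(phi2 K x)\<^sup>2 \<le> S"
      by (simp add: S_def)
    ultimately have "lyap x \<le> c * S"
      by (simp add: lyap_def c_def algebra_simps)
    then have "2 * l * lyap x \<le> 2 * l * (c * S)"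
      using l by (intro mult_left_mono) auto
    also have "\<dots> = \<gamma>2 * (min 1 \<gamma>1 * S)"
      using c by (simp add: l_def)
    also have "\<dots> \<le> \<gamma>2 * ((phi2 K x)\<^sup>2 + \<gamma>1 * (phi1 K x)\<^sup>2)"
      using gains mult_right_mono[of "min 1 \<gamma>1" \<gamma>1 "(phi1 K x)\<^sup>2"] mult_right_mono[of "min 1 \<gamma>1" 1 "(phi2 K x)\<^sup>2"]
      by (intro mult_left_mono) (auto simp: S_def distrib_left)
    finally show ?thesis .
  qed
  have phi_le: "\<bar>phi1 K x\<bar> + \<bar>phi2 K x\<bar> \<le> k * sqrt (lyap x)" for x
  proof -
    have "(phi1 K x)\<^sup>2 * \<gamma>1 \<le> lyap x"
      by (simp add: lyap_eq)
    then have "(phi1 K x)\<^sup>2 \<le> lyap x / \<gamma>1"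
      using gains by (simp add: pos_le_divide_eq)
    then have "\<bar>phi1 K x\<bar> \<le> sqrt (lyap x / \<gamma>1)"
      by (rule real_le_rsqrt[of "\<bar>phi1 K x\<bar>", simplified])
    moreover have "(phi2 K x)\<^sup>2 \<le> 2 * lyap x"
    proof -
      define p where "p = \<gamma>2 / 2 * phi1 K x"
      have "(phi2 K x)\<^sup>2 + (2 * p + phi2 K x)\<^sup>2 = 2 * (p\<^sup>2 + (p + phi2 K x)\<^sup>2)"
        by (simp add: power2_eq_square algebra_simps)
      moreover have "p\<^sup>2 + (p + phi2 K x)\<^sup>2 \<le> lyap x"
        using gains by (simp add: lyap_eq p_def)
      ultimately show ?thesis
        by (smt (verit) zero_le_power2)
    qed
    then have "\<bar>phi2 K x\<bar> \<le> sqrt (2 * lyap x)"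
      by (rule real_le_rsqrt[of "\<bar>phi2 K x\<bar>", simplified])
    ultimately show ?thesis
      by (simp add: k_def real_sqrt_divide real_sqrt_mult algebra_simps)
  qed
  have "\<bar>phi1 K (x t)\<bar> + \<bar>phi2 K (x t)\<bar> \<le> k * sqrt (lyap (x 0)) * exp (- l * t)"
    if x: "solution F {0..T} x" and t: "0 \<le> t" "t \<le> T" for T x t
  proof -
    have x': "solution F {0..t} x"
      using t by (intro solution_subset[OF x]) auto
    have "lyap (x t) * exp (2 * l * t) \<le> lyap (x 0) * exp (2 * l * 0)"
    proof (rule nonincreasing_within[OF t(1)])
      fix u assume u: "0 \<le> u" "u \<le> t"
      then have "u \<in> {0..t}" by simp
      note D = solution_derivatives(3,4)[OF x' this]
      define W' where "W' = - (\<gamma>2 * ((phi2 K (x u))\<^sup>2 + \<gamma>1 * (phi1 K (x u))\<^sup>2))"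
      have "((\<lambda>t. lyap (x t)) has_real_derivative W') (at u within {0..t})"
        unfolding lyap_def W'_def
        by (auto intro!: derivative_eq_intros D simp: power2_eq_square algebra_simps)
      then show "((\<lambda>t. lyap (x t) * exp (2 * l * t)) has_real_derivative
          (W' + 2 * l * lyap (x u)) * exp (2 * l * u)) (at u within {0..t})"
        by (auto intro!: derivative_eq_intros simp: algebra_simps)
      show "(W' + 2 * l * lyap (x u)) * exp (2 * l * u) \<le> 0"
        using rate[of "x u"] by (simp add: mult_le_0_iff W'_def)
    qed
    then have "lyap (x t) \<le> lyap (x 0) * (exp (- l * t))\<^sup>2"
      by (simp add: exp_minus field_simps flip: exp_double)
    from real_sqrt_le_mono[OF this] have "sqrt (lyap (x t)) \<le> sqrt (lyap (x 0)) * exp (- l * t)"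
      by (simp add: real_sqrt_mult)
    then have "k * sqrt (lyap (x t)) \<le> k * (sqrt (lyap (x 0)) * exp (- l * t))"
      using k by (intro mult_left_mono) auto
    then show ?thesis
      using phi_le[of "x t"] by (simp add: mult.assoc)
  qed
  with that k l show ?thesis
    by blast
qed


text \<open>\<open>K\<close> and \<open>K'\<close> are bounded, so \<open>x2\<close> and
  \<open>x4\<close> are controlled by \<open>phi\<close> and \<open>x3\<close>; the unactuated
  velocity is the only coordinate that needs an energy estimate.\<close>

lemma slab_of_bounds:
  obtains B where "\<And>x. \<bar>phi1 K x\<bar> + \<bar>phi2 K x\<bar> \<le> r \<Longrightarrow> \<bar>fst (snd (snd x))\<bar> \<le> R \<Longrightarrow> x \<in> slab B"
proof -
  obtain BK where BK: "0 \<le> BK" "\<And>q. \<bar>K q\<bar> \<le> BK"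
    using periodic_bounded[OF circle_constraint(2) _ C1_realD(3)[OF C1_coefficients(6)]] by auto
  obtain Bd where Bd: "0 \<le> Bd" "\<And>q. \<bar>deriv K q\<bar> \<le> Bd"
    using periodic_bounded[OF periodic_coefficients(1) _ C1_realD(3)[OF C1_coefficients(7)]] by auto
  define B where "B = BK + r + R + Bd * R + r"
  have "(x1, x2, x3, x4) \<in> slab B"
    if "\<bar>phi1 K (x1, x2, x3, x4)\<bar> + \<bar>phi2 K (x1, x2, x3, x4)\<bar> \<le> r" "\<bar>x3\<bar> \<le> R" for x1 x2 x3 x4
  proof -
    have R: "0 \<le> R" "0 \<le> r" "0 \<le> Bd * R"
      using that Bd by auto
    have "\<bar>deriv K x1 * x3\<bar> \<le> Bd * R"
      unfolding abs_mult using Bd R that by (intro mult_mono) auto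
    then have "\<bar>x4\<bar> \<le> Bd * R + r" "\<bar>x2\<bar> \<le> BK + r"
      using that BK(2)[of x1] by (auto simp: phi1_def phi2_def)
    then show ?thesis
      using BK Bd R that by (auto simp: slab_def B_def)
  qed
  then show ?thesis
    by (intro that[of B]) (metis fst_conv snd_conv prod.collapse)
qed

lemma bounded_cyl_slab:
  assumes "\<And>t. t \<in> J \<Longrightarrow> x t \<in> slab B"
  shows "bounded ((\<lambda>t. cyl (x t)) ` J)"
proof (rule bounded_subset)
  show "bounded (cball (0::complex) 1 \<times> {- B..B} \<times> {- B..B} \<times> {- B..B})"
    by (intro bounded_Times bounded_cball bounded_closed_interval)
  show "(\<lambda>t. cyl (x t)) ` J \<subseteq> cball (0::complex) 1 \<times> {- B..B} \<times> {- B..B} \<times> {- B..B}"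
  proof (rule image_subsetI)
    fix t assume "t \<in> J"
    then have "x t \<in> slab B"
      by (rule assms)
    then show "cyl (x t) \<in> cball (0::complex) 1 \<times> {- B..B} \<times> {- B..B} \<times> {- B..B}"
      by (cases "x t") (auto simp: cyl_def slab_def abs_le_iff)
  qed
qed

section \<open>Energy drift: confinement to a strip and global bounds\<close>

definition energy_rate :: "state \<Rightarrow> real" where
  "energy_rate x = m (fst x) * fst (snd (snd x)) * pert x"

lemma pert_bound':
  obtains C where "0 \<le> C"
    "\<And>x. \<bar>phi1 K x\<bar> + \<bar>phi2 K x\<bar> \<le> r \<Longrightarrow>
      \<bar>pert x\<bar> \<le> C * (\<bar>phi1 K x\<bar> + \<bar>phi2 K x\<bar>) * (1 + \<bar>fst (snd (snd x))\<bar>)"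
proof -
  obtain C where C: "0 \<le> C"
    "\<And>x1 x2 x3 x4. \<bar>phi1 K (x1, x2, x3, x4)\<bar> \<le> r \<Longrightarrow> \<bar>phi2 K (x1, x2, x3, x4)\<bar> \<le> r \<Longrightarrow>
      \<bar>pert (x1, x2, x3, x4)\<bar> \<le>
        C * (\<bar>phi1 K (x1, x2, x3, x4)\<bar> + \<bar>phi2 K (x1, x2, x3, x4)\<bar>) * (1 + \<bar>x3\<bar>)"
    by (rule pert_bound[of r]) (rule that)
  have "\<bar>pert x\<bar> \<le> C * (\<bar>phi1 K x\<bar> + \<bar>phi2 K x\<bar>) * (1 + \<bar>fst (snd (snd x))\<bar>)"
    if "\<bar>phi1 K x\<bar> + \<bar>phi2 K x\<bar> \<le> r" for x
    using C(2)[of "fst x" "fst (snd x)" "fst (snd (snd x))" "snd (snd (snd x))"] that by simp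
  with C(1) that show ?thesis
    by blast
qed

text \<open>In the well, the energy changes by at most a multiple of the initial size of \<open>\<phi>\<close>, since its
  rate is bounded by the exponentially decaying \<open>\<phi>\<close>; hence the energy barriers at the ends of the
  strip \<open>[a, b]\<close> cannot be crossed.\<close>

lemma trapping:
  assumes ab: "a < b" and h: "0 < h" and barrier: "c + h < U a" "c + h < U b"
  obtains w B D l where "0 < w" "0 < l"
    "\<And>T x t. solution F {0..T} x \<Longrightarrow> 0 \<le> t \<Longrightarrow> t \<le> T \<Longrightarrow>
      a < fst (x 0) \<Longrightarrow> fst (x 0) < b \<Longrightarrow> \<bar>energy (x 0) - c\<bar> < h / 2 \<Longrightarrow> lyap (x 0) < w \<Longrightarrow>
      fst (x t) \<in> {a..b} \<and> \<bar>energy (x t) - c\<bar> \<le> h \<and> x t \<in> slab B \<and>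
      \<bar>phi1 K (x t)\<bar> + \<bar>phi2 K (x t)\<bar> \<le> D * exp (- l * t) \<and> \<bar>energy_rate (x t)\<bar> \<le> D * exp (- l * t)"
proof -
  have "\<exists>q0. \<forall>q\<in>{a..b}. m q0 \<le> m q"
    using continuous_attains_inf[OF compact_Icc _ m_continuous, of a b] ab by auto
  then obtain q0 where q0: "\<And>q. q \<in> {a..b} \<Longrightarrow> m q0 \<le> m q"
    by blast
  have "\<exists>q1. \<forall>q\<in>{a..b}. m q \<le> m q1"
    using continuous_attains_sup[OF compact_Icc _ m_continuous, of a b] ab by auto
  then obtain q1 where q1: "\<And>q. q \<in> {a..b} \<Longrightarrow> m q \<le> m q1"
    by blast
  have "\<exists>q2. \<forall>q\<in>{a..b}. U q2 \<le> U q"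
    using continuous_attains_inf[OF compact_Icc _ U_continuous, of a b] ab by auto
  then obtain q2 where q2: "\<And>q. q \<in> {a..b} \<Longrightarrow> U q2 \<le> U q"
    by blast
  \<comment> \<open>A speed bound from the energy, using
    \<open>\<bar>v\<bar> \<le> 1 + v\<^sup>2\<close> in place of a square root.\<close>
  define R where "R = 1 + 2 * (\<bar>c + h - U q2\<bar>) / m q0"
  have R: "0 < R"
    using m_pos[of q0] by (auto simp: R_def intro!: add_pos_nonneg)
  have speed: "\<bar>fst (snd (snd x))\<bar> \<le> R" if x: "fst x \<in> {a..b}" "energy x \<le> c + h" for x
  proof -
    define v where "v = fst (snd (snd x))"
    have "m q0 * v\<^sup>2 \<le> m (fst x) * v\<^sup>2"
      using q0[OF x(1)] by (intro mult_right_mono) auto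
    also have "\<dots> \<le> 2 * (c + h - U q2)"
      using x(2) q2[OF x(1)] by (simp add: energy_def v_def)
    also have "\<dots> \<le> 2 * \<bar>c + h - U q2\<bar>"
      by (intro mult_left_mono) auto
    finally have "v\<^sup>2 \<le> 2 * \<bar>c + h - U q2\<bar> / m q0"
      using m_pos[of q0] by (simp add: pos_le_divide_eq mult.commute)
    moreover have "\<bar>v\<bar> \<le> 1 + v\<^sup>2"
      using zero_le_power2[of "\<bar>v\<bar> - 1"] by (simp add: power2_diff)
    ultimately show ?thesis
      by (simp add: R_def v_def)
  qed
  obtain C where C: "0 \<le> C" "\<And>x. \<bar>phi1 K x\<bar> + \<bar>phi2 K x\<bar> \<le> 1 \<Longrightarrow>
      \<bar>pert x\<bar> \<le> C * (\<bar>phi1 K x\<bar> + \<bar>phi2 K x\<bar>) * (1 + \<bar>fst (snd (snd x))\<bar>)"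
    by (rule pert_bound'[of 1]) (rule that)
  obtain B where B: "\<And>x. \<bar>phi1 K x\<bar> + \<bar>phi2 K x\<bar> \<le> 1 \<Longrightarrow> \<bar>fst (snd (snd x))\<bar> \<le> R \<Longrightarrow> x \<in> slab B"
    by (rule slab_of_bounds[of 1 R]) (rule that)
  obtain k l where k: "0 < k" and l: "0 < l"
    and decay: "\<And>T x t. solution F {0..T} x \<Longrightarrow> 0 \<le> t \<Longrightarrow> t \<le> T \<Longrightarrow>
      \<bar>phi1 K (x t)\<bar> + \<bar>phi2 K (x t)\<bar> \<le> k * sqrt (lyap (x 0)) * exp (- l * t)"
    by (rule phi_decay) (rule that)
  \<comment> \<open>The largest energy rate on the strip per unit of
    \<open>\<bar>phi1\<bar> + \<bar>phi2\<bar>\<close>.\<close>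
  define D0 where "D0 = m q1 * R * C * (1 + R)"
  have D0: "0 \<le> D0"
    using m_pos[of q1] R C by (simp add: D0_def)
  define d where "d = D0 * k + 1"
  have pos: "0 < d"
    using D0 k by (simp add: d_def add_nonneg_pos)
  \<comment> \<open>\<open>e\<close> bounds the root of the initial \<open>lyap\<close>. The first
    entry keeps the transverse error below 1, as the bound on \<open>pert\<close> requires; the
    second limits the total energy drift \<open>D0 * (k * e) / l\<close> to \<open>h / 4\<close>.
    The 1 in \<open>d\<close> avoids division by zero.\<close>
  define e where "e = min (1 / k) (h * l / (4 * d))"
  have e: "0 < e"
    using k h l pos by (simp add: e_def)
  have ke: "k * e \<le> 1"
  proof -
    have "k * e \<le> k * (1 / k)"
      using k by (intro mult_left_mono) (auto simp: e_def)
    then show ?thesis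
      using k by simp
  qed
  have De: "D0 * (k * e) / l < h / 2"
  proof -
    have "d * e \<le> d * (h * l / (4 * d))"
      using pos by (intro mult_left_mono) (auto simp: e_def)
    also have "\<dots> = h * l / 4"
      using pos by simp
    finally have "D0 * (k * e) \<le> h * l / 4"
      using e by (simp add: d_def algebra_simps)
    also have "\<dots> < h / 2 * l"
      using h l by simp
    finally show ?thesis
      using l by (simp add: divide_less_eq)
  qed
  define D where "D = k * e + D0 * (k * e)"
  show ?thesis
  proof (rule that[of "e\<^sup>2" l B D])
    fix T x t
    assume x: "solution F {0..T} x" and t: "0 \<le> t" "t \<le> T"
      and init: "a < fst (x 0)" "fst (x 0) < b" "\<bar>energy (x 0) - c\<bar> < h / 2" "lyap (x 0) < e\<^sup>2"
    have sq: "sqrt (lyap (x 0)) \<le> e"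
      using init(4) e by (intro real_le_lsqrt) auto
    have phi: "\<bar>phi1 K (x u)\<bar> + \<bar>phi2 K (x u)\<bar> \<le> k * e * exp (- l * u)" if "0 \<le> u" "u \<le> T" for u
    proof -
      have "k * sqrt (lyap (x 0)) * exp (- l * u) \<le> k * e * exp (- l * u)"
        using sq k by (intro mult_right_mono mult_left_mono) auto
      with decay[OF x that] show ?thesis
        by linarith
    qed
    have phi1: "\<bar>phi1 K (x u)\<bar> + \<bar>phi2 K (x u)\<bar> \<le> 1" if "0 \<le> u" "u \<le> T" for u
    proof -
      have "k * e * exp (- l * u) \<le> k * e * 1"
        using k e l that by (intro mult_left_mono) auto
      then show ?thesis
        using phi[OF that] ke by linarith
    qed
    have rate: "\<bar>energy_rate (x u)\<bar> \<le> D0 * (k * e) * exp (- l * u)"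
      if u: "0 \<le> u" "u \<le> T" and in_strip: "fst (x u) \<in> {a..b}" "energy (x u) \<le> c + h" for u
    proof -
      define v where "v = fst (snd (snd (x u)))"
      define p where "p = \<bar>phi1 K (x u)\<bar> + \<bar>phi2 K (x u)\<bar>"
      have v: "\<bar>v\<bar> \<le> R"
        using speed[OF in_strip] by (simp add: v_def)
      have "\<bar>pert (x u)\<bar> \<le> C * p * (1 + \<bar>v\<bar>)"
        using C(2)[OF phi1[OF u]] by (simp add: p_def v_def)
      also have "\<dots> \<le> C * p * (1 + R)"
        using C v by (intro mult_left_mono) (auto simp: p_def)
      finally have pe: "\<bar>pert (x u)\<bar> \<le> C * p * (1 + R)" .
      have "\<bar>energy_rate (x u)\<bar> = m (fst (x u)) * \<bar>v\<bar> * \<bar>pert (x u)\<bar>"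
        using m_pos[of "fst (x u)"] by (simp add: energy_rate_def abs_mult v_def)
      also have "\<dots> \<le> m q1 * R * (C * p * (1 + R))"
        using q1[OF in_strip(1)] v pe R m_pos[of q1] m_pos[of "fst (x u)"]
        by (intro mult_mono mult_nonneg_nonneg) auto
      also have "\<dots> = D0 * p"
        by (simp add: D0_def)
      also have "\<dots> \<le> D0 * (k * e * exp (- l * u))"
        using phi[OF u] D0 unfolding p_def by (rule mult_left_mono)
      finally show ?thesis
        by (simp add: mult.assoc)
    qed
    \<comment> \<open>The initial energy error and the drift are each below \<open>h / 2\<close>, so
      the relaxed bounds \<open>N\<close> improve to the strict bounds \<open>Q\<close>.\<close>
    define Q where "Q = {x. a < fst x \<and> fst x < b \<and> \<bar>energy x - c\<bar> < h}"
    define N where "N = {x. a \<le> fst x \<and> fst x \<le> b \<and> \<bar>energy x - c\<bar> \<le> h}"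
    have inQ: "x u \<in> Q" if u: "0 \<le> u" "u \<le> T" for u
    proof (rule stays_in_open[of T x Q N])
      show "continuous_on {0..T} x"
        using solution_continuous_on[OF x] .
      show "open Q"
        unfolding Q_def
        by (intro open_Collect_conj open_Collect_less continuous_intros energy_continuous)
      show "closed N"
        unfolding N_def
        by (intro closed_Collect_conj closed_Collect_le continuous_intros energy_continuous)
      show "Q \<subseteq> N"
        by (auto simp: Q_def N_def)
      show "x 0 \<in> Q"
        using init h by (auto simp: Q_def)
      fix t assume t: "0 \<le> t" "t \<le> T" and inN: "\<And>s. 0 \<le> s \<Longrightarrow> s \<le> t \<Longrightarrow> x s \<in> N"
      have x': "solution F {0..t} x"
        using t by (intro solution_subset[OF x]) auto
      have "\<bar>energy (x t) - energy (x 0)\<bar> \<le> D0 * (k * e) / l"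
      proof (rule exp_bounded_derivative_dist[OF t(1) l])
        fix u assume u: "0 \<le> u" "u \<le> t"
        then show "((\<lambda>t. energy (x t)) has_real_derivative energy_rate (x u)) (at u within {0..t})"
          unfolding energy_rate_def by (intro energy_derivative[OF x']) auto
        show "\<bar>energy_rate (x u)\<bar> \<le> D0 * (k * e) * exp (- l * u)"
          using inN[OF u] u t by (intro rate) (auto simp: N_def abs_le_iff)
      qed
      then have en: "\<bar>energy (x t) - c\<bar> < h"
        using De init(3) by linarith
      \<comment> \<open>Reaching an end of the strip would require at least the potential there,
        which exceeds \<open>c + h\<close>.\<close>
      have "U (fst (x t)) \<le> energy (x t)"
        using m_pos[of "fst (x t)"] by (simp add: energy_def)
      then have "U (fst (x t)) < c + h"
        using en by linarith
      then have "fst (x t) \<noteq> a" "fst (x t) \<noteq> b"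
        using barrier by auto
      then show "x t \<in> Q"
        using en inN[of t] t by (auto simp: Q_def N_def)
    qed (use u in auto)
    have Qt: "fst (x t) \<in> {a..b}" "\<bar>energy (x t) - c\<bar> \<le> h" "energy (x t) \<le> c + h"
      using inQ[OF t] by (auto simp: Q_def)
    have "k * e * exp (- l * t) \<le> D * exp (- l * t)" "D0 * (k * e) * exp (- l * t) \<le> D * exp (- l * t)"
      using D0 k e by (auto simp: D_def intro!: mult_right_mono)
    moreover have "x t \<in> slab B"
      using Qt by (intro B phi1 t speed) auto
    ultimately show "fst (x t) \<in> {a..b} \<and> \<bar>energy (x t) - c\<bar> \<le> h \<and> x t \<in> slab B \<and>
      \<bar>phi1 K (x t)\<bar> + \<bar>phi2 K (x t)\<bar> \<le> D * exp (- l * t) \<and> \<bar>energy_rate (x t)\<bar> \<le> D * exp (- l * t)"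
      using Qt(1,2) phi[OF t] rate[OF t Qt(1,3)] by (auto intro: order_trans)
  qed (use e l in auto)
qed

text \<open>With \<open>m\<close> and \<open>U\<close> periodic, \<open>Y = 1 + energy - min U\<close> satisfies \<open>Y' \<le> A * exp (- l * t) * Y\<close>.\<close>

lemma global_bound:
  assumes m_per: "periodic_fun_simple m (2 * pi)" and U_per: "periodic_fun_simple U (2 * pi)"
  shows "\<exists>B. \<forall>T x t. solution F {0..T} x \<longrightarrow> x 0 = x0 \<longrightarrow> 0 \<le> t \<longrightarrow> t \<le> T \<longrightarrow> x t \<in> slab B"
proof -
  obtain q0 q1 where q: "\<And>q. m q0 \<le> m q" "\<And>q. m q \<le> m q1"
    using periodic_attains_bounds[OF m_per _ m_continuous] by auto
  obtain q2 where q2: "\<And>q. U q2 \<le> U q"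
    by (rule periodic_attains_bounds[OF U_per _ U_continuous]) (simp, blast)
  obtain k l where k: "0 < k" and l: "0 < l"
    and decay: "\<And>T x t. solution F {0..T} x \<Longrightarrow> 0 \<le> t \<Longrightarrow> t \<le> T \<Longrightarrow>
      \<bar>phi1 K (x t)\<bar> + \<bar>phi2 K (x t)\<bar> \<le> k * sqrt (lyap (x 0)) * exp (- l * t)"
    by (rule phi_decay) (rule that)
  define r where "r = k * sqrt (lyap x0)"
  have r: "0 \<le> r"
    using k lyap_nonneg[of x0] by (simp add: r_def)
  obtain C where C: "0 \<le> C" "\<And>x. \<bar>phi1 K x\<bar> + \<bar>phi2 K x\<bar> \<le> r \<Longrightarrow>
      \<bar>pert x\<bar> \<le> C * (\<bar>phi1 K x\<bar> + \<bar>phi2 K x\<bar>) * (1 + \<bar>fst (snd (snd x))\<bar>)"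
    by (rule pert_bound'[of r]) (rule that)
  \<comment> \<open>The shift by 1 makes \<open>Y\<close> at least 1, so the velocity-independent
    part of the energy rate is also a multiple of \<open>Y\<close>.\<close>
  define Y where "Y x = 1 + energy x - U q2" for x
  \<comment> \<open>The last factor comes from \<open>\<bar>v\<bar> * (1 + \<bar>v\<bar>) \<le> 1 /
    2 + 3 / 2 * v\<^sup>2\<close>: the constant part costs \<open>m q1\<close>, the quadratic part
    three times the kinetic energy.\<close>
  define A where "A = C * r * (m q1 + 3)"
  have A: "0 \<le> A"
    using C r m_pos[of q1] by (simp add: A_def)
  have Y_lower: "1 + m (fst x) * (fst (snd (snd x)))\<^sup>2 / 2 \<le> Y x" for x
    using q2[of "fst x"] by (simp add: Y_def energy_def)
  have Y1: "1 \<le> Y x" for x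
  proof -
    have "0 \<le> m (fst x) * (fst (snd (snd x)))\<^sup>2 / 2"
      using m_pos[of "fst x"] by simp
    then show ?thesis
      using Y_lower[of x] by linarith
  qed
  \<comment> \<open>Gronwall's bound: the growth rate \<open>A * exp (- l * t)\<close> has total
    integral \<open>A / l\<close>.\<close>
  define M where "M = Y x0 * exp (A / l)"
  define R where "R = 1 + 2 * M / m q0"
  have main: "\<bar>phi1 K (x t)\<bar> + \<bar>phi2 K (x t)\<bar> \<le> r \<and> \<bar>fst (snd (snd (x t)))\<bar> \<le> R"
    if x: "solution F {0..T} x" "x 0 = x0" and t: "0 \<le> t" "t \<le> T" for T x t
  proof -
    have phi: "\<bar>phi1 K (x u)\<bar> + \<bar>phi2 K (x u)\<bar> \<le> r * exp (- l * u)" if "0 \<le> u" "u \<le> T" for u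
      using decay[OF x(1) that] by (simp add: x(2) r_def)
    have phi_r: "\<bar>phi1 K (x u)\<bar> + \<bar>phi2 K (x u)\<bar> \<le> r" if "0 \<le> u" "u \<le> T" for u
    proof -
      have "r * exp (- l * u) \<le> r * 1"
        using r l that by (intro mult_left_mono) auto
      then show ?thesis
        using phi[OF that] by linarith
    qed
    have rate: "energy_rate (x u) \<le> A * exp (- l * u) * Y (x u)" if u: "0 \<le> u" "u \<le> T" for u
    proof -
      define v where "v = fst (snd (snd (x u)))"
      define p where "p = \<bar>phi1 K (x u)\<bar> + \<bar>phi2 K (x u)\<bar>"
      define mu where "mu = m (fst (x u))"
      have mu: "0 < mu" "mu \<le> m q1"
        using m_pos q by (auto simp: mu_def)
      have pe: "\<bar>pert (x u)\<bar> \<le> C * p * (1 + \<bar>v\<bar>)"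
        using C(2)[OF phi_r[OF u]] by (simp add: p_def v_def)
      have "2 * \<bar>v\<bar> \<le> 1 + v\<^sup>2"
        using zero_le_power2[of "\<bar>v\<bar> - 1"] by (simp add: power2_diff)
      then have "\<bar>v\<bar> * (1 + \<bar>v\<bar>) \<le> 1 / 2 + 3 / 2 * v\<^sup>2"
        by (simp add: distrib_left flip: power2_eq_square)
      then have "mu * (\<bar>v\<bar> * (1 + \<bar>v\<bar>)) \<le> mu * (1 / 2 + 3 / 2 * v\<^sup>2)"
        using mu by (intro mult_left_mono) auto
      also have "\<dots> = mu / 2 + 3 * (mu * v\<^sup>2 / 2)"
        by (simp add: algebra_simps)
      also have "\<dots> \<le> m q1 * Y (x u) + 3 * Y (x u)"
      proof (rule add_mono)
        have "mu / 2 \<le> m q1 * 1"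
          using mu by simp
        also have "\<dots> \<le> m q1 * Y (x u)"
          using Y1 m_pos[of q1] by (intro mult_left_mono) auto
        finally show "mu / 2 \<le> m q1 * Y (x u)" .
        show "3 * (mu * v\<^sup>2 / 2) \<le> 3 * Y (x u)"
          using Y_lower[of "x u"] by (simp add: mu_def v_def)
      qed
      finally have mv: "mu * (\<bar>v\<bar> * (1 + \<bar>v\<bar>)) \<le> (m q1 + 3) * Y (x u)"
        by (simp add: algebra_simps)
      have "energy_rate (x u) \<le> \<bar>mu * v * pert (x u)\<bar>"
        by (simp add: energy_rate_def mu_def v_def)
      also have "\<dots> = mu * \<bar>v\<bar> * \<bar>pert (x u)\<bar>"
        using mu by (simp add: abs_mult)
      also have "\<dots> \<le> mu * \<bar>v\<bar> * (C * p * (1 + \<bar>v\<bar>))"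
        using mu pe by (intro mult_left_mono) auto
      also have "\<dots> = C * p * (mu * (\<bar>v\<bar> * (1 + \<bar>v\<bar>)))"
        by (simp add: mult_ac)
      also have "\<dots> \<le> C * p * ((m q1 + 3) * Y (x u))"
        using mv C by (intro mult_left_mono) (auto simp: p_def)
      also have "\<dots> \<le> C * (r * exp (- l * u)) * ((m q1 + 3) * Y (x u))"
        using phi[OF u] C m_pos[of q1] Y1[of "x u"] by (intro mult_right_mono mult_left_mono) (auto simp: p_def)
      finally show ?thesis
        by (simp add: A_def mult_ac)
    qed
    have x': "solution F {0..t} x"
      using t by (intro solution_subset[OF x(1)]) auto
    define Z where "Z u = Y (x u) * exp (A / l * exp (- l * u))" for u
    have "Z t \<le> Z 0"
    proof (rule nonincreasing_within[OF t(1)])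
      fix u assume u: "0 \<le> u" "u \<le> t"
      have "((\<lambda>t. Y (x t)) has_real_derivative energy_rate (x u)) (at u within {0..t})"
        unfolding Y_def energy_rate_def using u
        by (auto intro!: derivative_eq_intros energy_derivative[OF x'])
      then show "(Z has_real_derivative
          (energy_rate (x u) - A * exp (- l * u) * Y (x u)) * exp (A / l * exp (- l * u))) (at u within {0..t})"
        unfolding Z_def[abs_def] using l by (auto intro!: derivative_eq_intros simp: algebra_simps)
      show "(energy_rate (x u) - A * exp (- l * u) * Y (x u)) * exp (A / l * exp (- l * u)) \<le> 0"
        using rate[of u] u t by (simp add: mult_le_0_iff)
    qed
    then have "Y (x t) * exp (A / l * exp (- l * t)) \<le> M"
      by (simp add: Z_def M_def x(2))
    moreover have "Y (x t) * 1 \<le> Y (x t) * exp (A / l * exp (- l * t))"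
      using Y1[of "x t"] A l by (intro mult_left_mono) auto
    ultimately have YM: "Y (x t) \<le> M"
      by simp
    define v where "v = fst (snd (snd (x t)))"
    have "m q0 * v\<^sup>2 \<le> m (fst (x t)) * v\<^sup>2"
      using q by (intro mult_right_mono) auto
    also have "\<dots> \<le> 2 * M"
      using Y_lower[of "x t"] YM by (simp add: v_def)
    finally have "v\<^sup>2 \<le> 2 * M / m q0"
      using m_pos[of q0] by (simp add: field_simps)
    moreover have "\<bar>v\<bar> \<le> 1 + v\<^sup>2"
      using zero_le_power2[of "\<bar>v\<bar> - 1"] by (simp add: power2_diff)
    ultimately show ?thesis
      using phi_r[OF t] by (simp add: R_def v_def)
  qed
  obtain B where "\<And>x. \<bar>phi1 K x\<bar> + \<bar>phi2 K x\<bar> \<le> r \<Longrightarrow> \<bar>fst (snd (snd x))\<bar> \<le> R \<Longrightarrow> x \<in> slab B"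
    by (rule slab_of_bounds[of r R]) (rule that)
  with main show ?thesis
    by blast
qed

end

subsection \<open>Orbital stability on the cylinder\<close>

text \<open>These are the deck transformations of the covering \<open>cyl\<close>.\<close>

definition turn :: "int \<Rightarrow> state \<Rightarrow> state" where
  "turn n = (\<lambda>(x1, x2, x3, x4). (x1 + 2 * pi * of_int n, x2, x3, x4))"

lemma turn_eq: "turn n x = x + (2 * pi * of_int n, 0)"
  by (cases x) (simp add: turn_def zero_prod_def)

lemma turn_turn_minus: "turn n (turn (- n) x) = x" "turn (- n) (turn n x) = x"
  by (cases x; simp add: turn_def)+

lemma cis_add_turns: "cis (x + 2 * pi * of_int n) = cis x"
proof -
  have "cis (2 * pi * of_int n) = 1"
    by (simp add: cis.ctr complex_eq_iff sin_int_2pin cos_int_2pin)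
  then show ?thesis
    by (simp flip: cis_mult)
qed

lemma cyl_turn: "cyl (turn n x) = cyl x"
  by (cases x) (simp add: turn_def cyl_def cis_add_turns)

lemma cyl_continuous: "continuous_on A cyl"
  unfolding cyl_def split_beta by (intro continuous_intros)

text \<open>\<open>Arg\<close> is continuous at 1, away from its branch cut, and differs from the
  given angle by whole turns.\<close>

lemma angle_close_mod_turns:
  assumes "0 < e"
  obtains d where "0 < d" "\<And>t. dist (cis t) 1 < d \<Longrightarrow> \<exists>n::int. \<bar>t + 2 * pi * of_int n\<bar> < e"
proof -
  have "isCont Arg 1"
    by (rule continuous_at_Arg) simp
  then obtain d where d: "0 < d" "\<And>z. dist z 1 < d \<Longrightarrow> \<bar>Arg z\<bar> < e"
    using assms unfolding continuous_at_eps_delta by (auto simp: dist_real_def)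
  have "\<exists>n::int. \<bar>t + 2 * pi * of_int n\<bar> < e" if "dist (cis t) 1 < d" for t
  proof -
    have "cis (Arg (cis t)) = cis t"
      by (simp add: cis_Arg)
    then have "sin (Arg (cis t)) = sin t \<and> cos (Arg (cis t)) = cos t"
      by (simp add: complex_eq_iff)
    then obtain n where "Arg (cis t) = t + 2 * pi * of_int n"
      using sin_cos_eq_iff by blast
    then show ?thesis
      using d(2)[OF that] by auto
  qed
  with d(1) that show ?thesis
    by blast
qed

text \<open>The lift of an initial state close to the orbit on the cylinder may lie many turns away
  from the lifted orbit; only some translate of it is close.\<close>

lemma infdist_cyl_nbhd:
  assumes G: "compact G" "G \<noteq> {}" and W: "open W" "G \<subseteq> W"
  obtains d where "0 < d" "\<And>x. infdist (cyl x) (cyl ` G) < d \<Longrightarrow> \<exists>n. turn n x \<in> W"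
proof -
  obtain e where e: "0 < e" "(\<Union>x\<in>G. ball x e) \<subseteq> W"
    using compact_subset_open_imp_ball_epsilon_subset[OF G(1) W] by blast
  obtain d0 where d0: "0 < d0" "\<And>t. dist (cis t) 1 < d0 \<Longrightarrow> \<exists>n::int. \<bar>t + 2 * pi * of_int n\<bar> < e / 2"
    using angle_close_mod_turns[of "e / 2"] e by auto
  define d where "d = min d0 (e / 2)"
  have "\<exists>n. turn n x \<in> W" if x: "infdist (cyl x) (cyl ` G) < d" for x
  proof -
    have "(INF a\<in>cyl ` G. dist (cyl x) a) < d"
      using x G(2) by (simp add: infdist_def)
    then obtain g where g: "g \<in> G" "dist (cyl x) (cyl g) < d"
      using G(2) by (subst (asm) cINF_less_iff) (auto intro: bdd_belowI[of _ 0])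
    obtain x1 xs g1 gs where xg: "x = (x1, xs)" "g = (g1, gs)"
      by (metis prod.exhaust)
    have cyl_eq: "cyl (y, ys) = (cis y, ys)" for y ys
      by (cases ys) (simp add: cyl_def)
    have "dist (cis x1) (cis g1) \<le> dist (cyl x) (cyl g)" "dist xs gs \<le> dist (cyl x) (cyl g)"
      using dist_fst_le[of "cyl x" "cyl g"] dist_snd_le[of "cyl x" "cyl g"] by (simp_all add: xg cyl_eq)
    then have c: "dist (cis x1) (cis g1) < d0" "dist xs gs < e / 2"
      using g(2) by (auto simp: d_def)
    \<comment> \<open>Rotation is an isometry, so the comparison of two angles reduces to that of
      their difference with 0.\<close>
    have "cis x1 - cis g1 = cis g1 * (cis (x1 - g1) - 1)"
      by (simp add: right_diff_distrib cis_mult)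
    then have "dist (cis (x1 - g1)) 1 = dist (cis x1) (cis g1)"
      by (simp add: dist_norm norm_mult)
    then obtain n :: int where n: "\<bar>x1 - g1 + 2 * pi * of_int n\<bar> < e / 2"
      using d0(2)[of "x1 - g1"] c(1) by auto
    have "dist (turn n x) g = sqrt ((dist (x1 + 2 * pi * of_int n) g1)\<^sup>2 + (dist xs gs)\<^sup>2)"
      by (simp add: turn_eq xg dist_Pair_Pair)
    also have "\<dots> \<le> dist (x1 + 2 * pi * of_int n) g1 + dist xs gs"
      by (rule sqrt_sum_squares_le_sum) auto
    also have "\<dots> < e"
      using n c(2) by (simp add: dist_real_def algebra_simps)
    finally have "turn n x \<in> ball g e"
      by (simp add: dist_commute)
    then show ?thesis
      using e(2) g(1) by blast
  qed
  moreover have "0 < d"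
    using d0 e by (simp add: d_def)
  ultimately show ?thesis
    using that by blast
qed

lemma periodic_fun_turns:
  fixes f :: "real \<Rightarrow> 'a"
  assumes "periodic_fun_simple f (2 * pi)"
  shows "f (x + 2 * pi * of_int n) = f x"
proof -
  interpret periodic_fun_simple f "2 * pi" by (rule assms)
  show ?thesis
    using plus_of_int[of x n] by (simp add: mult_ac)
qed

context constrained_plant
begin

lemma closed_loop_turn: "F (turn n x) = F x"
proof -
  have "periodic_fun_simple (\<lambda>q. grad_u P q a) (2 * pi)" for a
    by (simp add: periodic_fun_simple_def grad_u_periodic)
  note rules = periodic_fun_turns[OF circle_plant(1)] periodic_fun_turns[OF circle_plant(2)]
    periodic_fun_turns[OF circle_plant(4)] periodic_fun_turns[OF circle_plant(5)]
    periodic_fun_turns[OF circle_constraint(1)] periodic_fun_turns[OF circle_constraint(2)] periodic_fun_turns[OF periodic_coefficients(1)]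
    periodic_fun_turns[OF periodic_coefficients(2)] periodic_fun_turns[OF this]
  show ?thesis
    by (cases x) (simp add: turn_def closed_loop_def drift_def input_field_def controller_def phi1_def phi2_def rules)
qed

lemma phi_turn: "phi K (turn n x) = phi K x"
  by (cases x) (simp add: turn_def phi_def phi1_def phi2_def
      periodic_fun_turns[OF circle_constraint(2)] periodic_fun_turns[OF periodic_coefficients(1)])

lemma solution_turn:
  assumes "solution F J x"
  shows "solution F J (\<lambda>t. turn n (x t))"
  unfolding solution_def closed_loop_turn
  using assms unfolding solution_def turn_eq by (auto intro!: derivative_eq_intros)

text \<open>On \<open>phi = 0\<close> the perturbation vanishes, so the acceleration is that of the
  target, and the input then equals the derivative of \<open>K' * y\<close>; this is the invariance
  of the constraint manifold.\<close>

lemma solution_pi_map: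
  assumes x: "\<And>t. (x has_real_derivative y t) (at t)"
    and y: "\<And>t. (y has_real_derivative rho P s K (x t) + beta P s K (x t) * (y t)\<^sup>2) (at t)"
  shows "solution (target_field P s K) UNIV (\<lambda>t. (x t, y t))"
    and "solution F UNIV (pi_map K \<circ> (\<lambda>t. (x t, y t)))"
proof -
  show "solution (target_field P s K) UNIV (\<lambda>t. (x t, y t))"
    using x y unfolding solution_def target_field_def
    by (auto intro!: has_vector_derivative_Pair simp flip: has_real_derivative_iff_has_vector_derivative)
  show "solution F UNIV (pi_map K \<circ> (\<lambda>t. (x t, y t)))"
    unfolding solution_def
  proof
    fix t :: real
    define z where "z = pi_map K (x t, y t)"
    have z: "z = (x t, K (x t), y t, deriv K (x t) * y t)"
      by (simp add: z_def pi_map_def)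
    have a: "accel z = rho P s K (x t) + beta P s K (x t) * (y t)\<^sup>2"
      using pert_zero[of "(x t, y t)"] unfolding z_def[symmetric] by (simp add: pert_def z)
    have Kx: "((\<lambda>t. K (x t)) has_real_derivative deriv K (x t) * y t) (at t)"
      by (rule DERIV_chain2[OF C1_realD(1)[OF C1_coefficients(6)] x])
    have K'x: "((\<lambda>t. deriv K (x t)) has_real_derivative deriv (deriv K) (x t) * y t) (at t)"
      by (rule DERIV_chain2[OF C1_realD(1)[OF C1_coefficients(7)] x])
    have "phi1 K z = 0" "phi2 K z = 0"
      by (simp_all add: z_def phi_pi_map)
    then have "F z = (y t, deriv K (x t) * y t, accel z, deriv (deriv K) (x t) * (y t)\<^sup>2 + deriv K (x t) * accel z)"
      by (simp add: z closed_loop_eq controller_eq)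
    moreover have "((\<lambda>t. deriv K (x t) * y t) has_real_derivative
        deriv (deriv K) (x t) * (y t)\<^sup>2 + deriv K (x t) * accel z) (at t)"
      using DERIV_mult'[OF K'x y[of t]] by (simp add: a power2_eq_square algebra_simps)
    ultimately show "((pi_map K \<circ> (\<lambda>t. (x t, y t))) has_vector_derivative
        F ((pi_map K \<circ> (\<lambda>t. (x t, y t))) t)) (at t within UNIV)"
      using x[of t] y[of t] Kx a unfolding o_def z_def[symmetric]
      by (auto simp: pi_map_def has_real_derivative_iff_has_vector_derivative intro!: has_vector_derivative_Pair)
  qed
qed

text \<open>The last clause says that the orbit exhausts the common level set of energy and
  transverse coordinates over the well. It converts convergence of these three functions into
  convergence to the orbit.\<close>

lemma well_orbit:
  assumes w: "well U (\<lambda>x. U' x) a b c"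
  obtains X T where "nontrivial_periodic_solution F cyl X T" "orbit X T \<in> orbit_family P s K"
    "continuous_on UNIV X"
    "\<And>t. fst (X t) \<in> {a..b}" "\<And>t. energy (X t) = c" "\<And>t. phi1 K (X t) = 0" "\<And>t. phi2 K (X t) = 0"
    "\<And>z. fst z \<in> {a..b} \<Longrightarrow> energy z = c \<Longrightarrow> phi1 K z = 0 \<Longrightarrow> phi2 K z = 0 \<Longrightarrow> cyl z \<in> orbit X T"
proof -
  obtain x y T where T: "0 < T"
    and x: "\<And>t. (x has_real_derivative y t) (at t)"
    and y: "\<And>t. (y has_real_derivative rho P s K (x t) + beta P s K (x t) * (y t)\<^sup>2) (at t)"
    and per: "\<And>t. x (t + T) = x t" "\<And>t. y (t + T) = y t"
    and range: "\<And>t. x t \<in> {a..b}" and en: "\<And>t. m (x t) * (y t)\<^sup>2 / 2 + U (x t) = c"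
    and cover: "\<And>p q. p \<in> {a..b} \<Longrightarrow> m p * q\<^sup>2 / 2 + U p = c \<Longrightarrow> \<exists>t\<in>{0..T}. x t = p \<and> y t = q"
    by (rule level_curve[OF U_has_derivative refl m_has_derivative m_pos rho_continuous beta_continuous w]) (rule that)
  define \<xi> where "\<xi> = (\<lambda>t. (x t, y t))"
  define X where "X = pi_map K \<circ> \<xi>"
  have sol: "solution (target_field P s K) UNIV \<xi>" "solution F UNIV X"
    unfolding X_def \<xi>_def by (rule solution_pi_map[OF x y])+
  have ab: "a < b" "U a = c" "\<And>x. a < x \<Longrightarrow> x < b \<Longrightarrow> U x < c"
    using w by (auto simp: well_def)
  \<comment> \<open>Non-constancy: the velocity vanishes at the turning point \<open>a\<close> but
    not over the midpoint.\<close>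
  obtain t1 where t1: "y t1 = 0"
    using cover[of a 0] ab by auto
  define p where "p = (a + b) / 2"
  have p: "a < p" "p < b"
    using ab by (auto simp: p_def)
  have "m p * (sqrt (2 * (c - U p) / m p))\<^sup>2 / 2 + U p = c"
    using m_pos[of p] ab(3)[OF p] by (simp add: field_simps)
  then obtain t2 where "y t2 = sqrt (2 * (c - U p) / m p)"
    using cover[of p "sqrt (2 * (c - U p) / m p)"] p by auto
  then have t2: "y t2 \<noteq> 0"
    using m_pos[of p] ab(3)[OF p] by simp
  have nc: "\<not> (\<lambda>t. cyl2 (\<xi> t)) constant_on UNIV" "\<not> (\<lambda>t. cyl (X t)) constant_on UNIV"
    using t1 t2 unfolding constant_on_def by (auto simp: X_def \<xi>_def cyl2_def cyl_def pi_map_def) (metis+)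
  have periodic: "\<xi> (t + T) = \<xi> t" "X (t + T) = X t" for t
    by (simp_all add: X_def \<xi>_def per)
  have "nontrivial_periodic_solution (target_field P s K) cyl2 \<xi> T"
    unfolding nontrivial_periodic_solution_def using T sol nc periodic by simp
  then have fam: "orbit X T \<in> orbit_family P s K"
    unfolding orbit_family_def X_def by blast
  have X: "nontrivial_periodic_solution F cyl X T"
    unfolding nontrivial_periodic_solution_def using T sol nc periodic by simp
  have mem: "cyl z \<in> orbit X T" if z: "fst z \<in> {a..b}" "energy z = c" "phi1 K z = 0" "phi2 K z = 0" for z
  proof -
    obtain z1 z2 z3 z4 where zz: "z = (z1, z2, z3, z4)"
      by (metis prod.exhaust)
    obtain t where t: "t \<in> {0..T}" "x t = z1" "y t = z3"
      using cover[of z1 z3] z by (auto simp: zz energy_def)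
    then have "X t = z"
      using z by (simp add: X_def \<xi>_def pi_map_def zz phi1_def phi2_def)
    then show ?thesis
      using t(1) unfolding orbit_def by auto
  qed
  show ?thesis
  proof (rule that[OF X fam _ _ _ _ _ mem])
    show "continuous_on UNIV X"
      by (rule solution_continuous_on[OF sol(2)])
    show "fst (X t) \<in> {a..b}" for t
      using range[of t] by (simp add: X_def \<xi>_def pi_map_def)
    show "energy (X t) = c" for t
      using en[of t] by (simp add: X_def \<xi>_def pi_map_def energy_def)
    show "phi1 K (X t) = 0" "phi2 K (X t) = 0" for t
      by (simp_all add: X_def phi_pi_map)
  qed auto
qed

text \<open>The a priori bound is needed for one translate of each initial state only, because
  translations map solutions to solutions and leave \<open>cyl\<close> unchanged.\<close>

lemma bounded_fromI:
  assumes "\<And>x0. x0 \<in> D \<Longrightarrow> \<exists>n B. \<forall>T x t. solution F {0..T} x \<longrightarrow> x 0 = turn n x0 \<longrightarrow> 0 \<le> t \<longrightarrow> t \<le> T \<longrightarrow> x t \<in> slab B"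
  shows "bounded_from F D"
  unfolding bounded_from_def
proof
  fix x0 assume "x0 \<in> D"
  then obtain n B where B: "\<And>T x t. solution F {0..T} x \<Longrightarrow> x 0 = turn n x0 \<Longrightarrow> 0 \<le> t \<Longrightarrow> t \<le> T \<Longrightarrow> x t \<in> slab B"
    using assms by metis
  have "\<exists>z. solution F {0..} z \<and> z 0 = turn n x0"
    by (rule solution_exists) (rule B)
  then obtain z where z: "solution F {0..} z" "z 0 = turn n x0"
    by blast
  have "solution F {0..} (\<lambda>t. turn (- n) (z t)) \<and> turn (- n) (z 0) = x0"
    using solution_turn[OF z(1)] z(2) turn_turn_minus by simp
  then have "\<exists>x. solution F {0..} x \<and> x 0 = x0"
    by (intro exI[of _ "\<lambda>t. turn (- n) (z t)"])
  moreover have "bounded ((\<lambda>t. cyl (x t)) ` {0..})" if x: "solution F {0..} x" "x 0 = x0" for x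
  proof -
    have "turn n (x t) \<in> slab B" if "t \<in> {0..}" for t
      using that x(2) by (intro B[of t "\<lambda>t. turn n (x t)"] solution_turn solution_subset[OF x(1)]) auto
    then have "bounded ((\<lambda>t. cyl (turn n (x t))) ` {0..})"
      by (rule bounded_cyl_slab)
    then show ?thesis
      by (simp add: cyl_turn)
  qed
  ultimately show "(\<exists>x. solution F {0..} x \<and> x 0 = x0) \<and>
      (\<forall>x. solution F {0..} x \<and> x 0 = x0 \<longrightarrow> bounded ((\<lambda>t. cyl (x t)) ` {0..}))"
    by blast
qed

lemma orbital_stabilization:
  assumes min: "single_isolated_min U"
  shows "\<exists>X T. nontrivial_periodic_solution F cyl X T \<and> orbit X T \<in> orbit_family P s K \<and>
     orbitally_attractive F (phi K) (orbit_family P s K) (orbit X T) \<and>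
     (\<exists>\<delta>>0. bounded_from F {x0. infdist (cyl x0) (orbit X T) < \<delta>})"
proof -
  obtain x0 where "strict_local_min U x0"
    using min unfolding single_isolated_min_def by blast
  then obtain a b c where w: "well U (\<lambda>x. U' x) a b c"
    using well_near_strict_local_min[OF U_has_derivative U'_continuous] by blast
  obtain r h where r: "0 < r" and h: "0 < h" and barrier: "c + h < U (a - r)" "c + h < U (b + r)"
    and nearby: "\<And>d. \<bar>d - c\<bar> \<le> h \<Longrightarrow> \<exists>a' b'. well U (\<lambda>x. U' x) a' b' d \<and> a - r < a' \<and> b' < b + r \<and>
       (\<forall>x\<in>{a - r..b + r}. U x \<le> d \<longrightarrow> x \<in> {a'..b'})"
    by (rule nearby_wells[OF U_has_derivative U'_continuous w]) (rule that)
  have ab: "a < b"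
    using w by (simp add: well_def)
  obtain w B D l where w0: "0 < w" and l: "0 < l"
    and trap: "\<And>T x t. solution F {0..T} x \<Longrightarrow> 0 \<le> t \<Longrightarrow> t \<le> T \<Longrightarrow>
      a - r < fst (x 0) \<Longrightarrow> fst (x 0) < b + r \<Longrightarrow> \<bar>energy (x 0) - c\<bar> < h / 2 \<Longrightarrow> lyap (x 0) < w \<Longrightarrow>
      fst (x t) \<in> {a - r..b + r} \<and> \<bar>energy (x t) - c\<bar> \<le> h \<and> x t \<in> slab B \<and>
      \<bar>phi1 K (x t)\<bar> + \<bar>phi2 K (x t)\<bar> \<le> D * exp (- l * t) \<and> \<bar>energy_rate (x t)\<bar> \<le> D * exp (- l * t)"
    by (rule trapping[OF _ h barrier]) (use ab r in simp, rule that)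
  obtain X T where X: "nontrivial_periodic_solution F cyl X T" "orbit X T \<in> orbit_family P s K"
    and X_cont: "continuous_on UNIV X"
    and X_on: "\<And>t. fst (X t) \<in> {a..b}" "\<And>t. energy (X t) = c" "\<And>t. phi1 K (X t) = 0" "\<And>t. phi2 K (X t) = 0"
    by (rule well_orbit[OF \<open>well U (\<lambda>x. U' x) a b c\<close>]) (rule that)
  \<comment> \<open>The admissible initial states of the trapping estimate form an open set around
    the lifted orbit, so it contains a neighbourhood of this compact curve.\<close>
  define W where "W = {x. a - r < fst x \<and> fst x < b + r \<and> \<bar>energy x - c\<bar> < h / 2 \<and> lyap x < w}"
  have "open W"
    unfolding W_def
    by (intro open_Collect_conj open_Collect_less continuous_intros energy_continuous lyap_continuous)
  have T: "0 < T"
    using X(1) by (simp add: nontrivial_periodic_solution_def)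
  have "X t \<in> W" for t
    using X_on(1)[of t] w0 h r by (simp add: W_def lyap_def X_on)
  then have sub: "X ` {0..T} \<subseteq> W"
    by blast
  have comp: "compact (X ` {0..T})" "X ` {0..T} \<noteq> {}"
    using T by (auto intro!: compact_continuous_image continuous_on_subset[OF X_cont])
  have orbit_eq: "orbit X T = cyl ` X ` {0..T}"
    by (auto simp: orbit_def)
  obtain \<delta> where \<delta>: "0 < \<delta>" "\<And>x. infdist (cyl x) (orbit X T) < \<delta> \<Longrightarrow> \<exists>n. turn n x \<in> W"
    by (rule infdist_cyl_nbhd[OF comp \<open>open W\<close> sub, folded orbit_eq]) (rule that)
  have bdd: "bounded_from F {x0. infdist (cyl x0) (orbit X T) < \<delta>}"
  proof (rule bounded_fromI)
    fix x0 assume "x0 \<in> {x0. infdist (cyl x0) (orbit X T) < \<delta>}"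
    then obtain n where "turn n x0 \<in> W"
      using \<delta>(2) by blast
    then show "\<exists>n B. \<forall>T x t. solution F {0..T} x \<longrightarrow> x 0 = turn n x0 \<longrightarrow> 0 \<le> t \<longrightarrow> t \<le> T \<longrightarrow> x t \<in> slab B"
      using trap by (intro exI[of _ n] exI[of _ B]) (auto simp: W_def)
  qed
  have attract: "((\<lambda>t. phi K (x t)) \<longlongrightarrow> 0) at_top \<and>
      (\<exists>A\<in>orbit_family P s K. ((\<lambda>t. infdist (cyl (x t)) A) \<longlongrightarrow> 0) at_top)"
    if x0: "infdist (cyl (x 0)) (orbit X T) < \<delta>" and x: "solution F {0..} x" for x
  proof -
    obtain n where n: "turn n (x 0) \<in> W"
      using \<delta>(2)[OF x0] by blast
    \<comment> \<open>The whole trajectory is moved into the strip; neither \<open>cyl\<close> nor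
      \<open>phi\<close> notices the translation.\<close>
    define z where "z t = turn n (x t)" for t
    have z: "solution F {0..} z"
      unfolding z_def by (rule solution_turn[OF x])
    have zt: "fst (z t) \<in> {a - r..b + r}" "\<bar>energy (z t) - c\<bar> \<le> h" "z t \<in> slab B"
      "\<bar>phi1 K (z t)\<bar> + \<bar>phi2 K (z t)\<bar> \<le> D * exp (- l * t)" "\<bar>energy_rate (z t)\<bar> \<le> D * exp (- l * t)"
      if "0 \<le> t" for t
      using trap[of t z t] solution_subset[OF z, of "{0..t}"] n that by (auto simp: W_def z_def)
    have "((\<lambda>t. D * exp (- l * t)) \<longlongrightarrow> D * 0) at_top"
      by (intro tendsto_intros exp_neg_tendsto_0 l)
    then have D0: "((\<lambda>t. D * exp (- l * t)) \<longlongrightarrow> 0) at_top"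
      by simp
    have phi0: "((\<lambda>t. phi1 K (z t)) \<longlongrightarrow> 0) at_top" "((\<lambda>t. phi2 K (z t)) \<longlongrightarrow> 0) at_top"
      by (rule Lim_null_comparison[OF _ D0];
        rule eventually_mono[OF eventually_ge_at_top[of 0]]; use zt(4) in force)+
    have "\<exists>d. ((\<lambda>t. energy (z t)) \<longlongrightarrow> d) at_top"
      by (rule exp_bounded_derivative_converges[OF l energy_derivative[OF z] zt(5)[unfolded energy_rate_def]]) auto
    \<comment> \<open>The limit level \<open>d\<close> may differ from \<open>c\<close>; being
      within \<open>h\<close> of it, it still carries a well and hence a member of the
      family.\<close>
    then obtain d where d: "((\<lambda>t. energy (z t)) \<longlongrightarrow> d) at_top"
      by blast
    have "((\<lambda>t. \<bar>energy (z t) - c\<bar>) \<longlongrightarrow> \<bar>d - c\<bar>) at_top"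
      by (intro tendsto_intros d)
    then have "\<bar>d - c\<bar> \<le> h"
      by (rule tendsto_upperbound[OF _ eventually_mono[OF eventually_ge_at_top[of 0]]]) (use zt(2) in auto)
    then obtain a' b' where w': "well U (\<lambda>x. U' x) a' b' d" "\<And>x. x \<in> {a - r..b + r} \<Longrightarrow> U x \<le> d \<Longrightarrow> x \<in> {a'..b'}"
      using nearby by blast
    obtain Y S where Y: "orbit Y S \<in> orbit_family P s K"
      and Y_on: "\<And>z. fst z \<in> {a'..b'} \<Longrightarrow> energy z = d \<Longrightarrow> phi1 K z = 0 \<Longrightarrow> phi2 K z = 0 \<Longrightarrow> cyl z \<in> orbit Y S"
      by (rule well_orbit[OF w'(1)]) (rule that)
    have "((\<lambda>t. infdist (cyl (z t)) (orbit Y S)) \<longlongrightarrow> 0) at_top"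
    proof (rule infdist_tendsto_0_compact[where G = "\<lambda>x. (energy x, phi1 K x, phi2 K x)" and l = "(d, 0, 0)"])
      show "compact ({a - r..b + r} \<times> {- B..B} \<times> {- B..B} \<times> {- B..B})"
        by (intro compact_Times compact_Icc)
      show "continuous_on ({a - r..b + r} \<times> {- B..B} \<times> {- B..B} \<times> {- B..B}) (\<lambda>x. (energy x, phi1 K x, phi2 K x))"
        by (intro continuous_intros energy_continuous phi_continuous)
      show "((\<lambda>t. (energy (z t), phi1 K (z t), phi2 K (z t))) \<longlongrightarrow> (d, 0, 0)) at_top"
        by (intro tendsto_intros d phi0)
      show "z t \<in> {a - r..b + r} \<times> {- B..B} \<times> {- B..B} \<times> {- B..B}" if "0 \<le> t" for t
        using zt(1,3)[OF that] by (cases "z t") (auto simp: slab_def abs_le_iff)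
      show "cyl x \<in> orbit Y S" if x: "x \<in> {a - r..b + r} \<times> {- B..B} \<times> {- B..B} \<times> {- B..B}"
        and eq: "(energy x, phi1 K x, phi2 K x) = (d, 0, 0)" for x
      proof (rule Y_on)
        have "U (fst x) \<le> energy x"
          using m_pos[of "fst x"] by (simp add: energy_def)
        then show "fst x \<in> {a'..b'}"
          using x eq by (intro w'(2)) auto
      qed (use eq in auto)
    qed (rule cyl_continuous)
    moreover have "((\<lambda>t. phi K (z t)) \<longlongrightarrow> (0, 0)) at_top"
      unfolding phi_def by (intro tendsto_intros phi0)
    ultimately show ?thesis
      using Y by (auto simp: z_def cyl_turn phi_turn zero_prod_def)
  qed
  have "orbitally_attractive F (phi K) (orbit_family P s K) (orbit X T)"
    unfolding orbitally_attractive_def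
  proof (intro exI[of _ \<delta>] conjI allI impI \<delta>(1))
    fix x0 assume x0: "infdist (cyl x0) (orbit X T) < \<delta>"
    then show "\<exists>x. solution F {0..} x \<and> x 0 = x0"
      using bdd unfolding bounded_from_def by blast
    fix x assume "solution F {0..} x \<and> x 0 = x0"
    then show "((\<lambda>t. phi K (x t)) \<longlongrightarrow> 0) at_top"
      "\<exists>A\<in>orbit_family P s K. ((\<lambda>t. infdist (cyl (x t)) A) \<longlongrightarrow> 0) at_top"
      using attract[of x] x0 by auto
  qed
  with X bdd \<delta>(1) show ?thesis
    by blast
qed

lemma bounded_from_UNIV:
  assumes "periodic_fun_simple m (2 * pi)" and "periodic_fun_simple U (2 * pi)"
  shows "bounded_from F UNIV"
  by (intro bounded_fromI exI[of _ 0] global_bound assms)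

end

theorem proposition1:
  fixes P :: plant and s K :: "real \<Rightarrow> real" and \<gamma>1 \<gamma>2 :: real
  assumes C2_plant: "C2 (m_uu P)" "C2 (m_au P)" "C2 (m_aa P)" "C2 (c_a P)" "C2 (c_u P)" "C2 (V P)"
    and circle_plant:
      "periodic_fun_simple (m_uu P) (2 * pi)" "periodic_fun_simple (m_au P) (2 * pi)"
      "periodic_fun_simple (m_aa P) (2 * pi)" "periodic_fun_simple (c_a P) (2 * pi)"
      "periodic_fun_simple (c_u P) (2 * pi)"
      "\<And>q_a. periodic_fun_simple (\<lambda>q_u. V P (q_u, q_a)) (2 * pi)"
    and A1: "\<And>q. positive_definite (inertia P q)"
    and A2: "bounded (range (m_uu P))" "\<And>q. m_au P q \<noteq> 0" "\<And>q. c_u P q \<noteq> 0"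
    and A3: "C2 s" "C2 K"
      "periodic_fun_simple s (2 * pi)" "periodic_fun_simple K (2 * pi)"
      "bounded (range s)" "bounded (range K)"
      "\<And>q. s q \<noteq> 0" "\<exists>q. K q \<noteq> 0"
    and A3a: "\<And>q. deriv K q = (s q - m_uu P q) / m_au P q"
    and A3b: "\<And>q. m_target P s K q > 0"
    and A3c: "single_isolated_min (U_target P s K)"
    and gains: "\<gamma>1 > 0" "\<gamma>2 > 0"
  shows "\<exists>X T.
     nontrivial_periodic_solution (closed_loop P s K \<gamma>1 \<gamma>2) cyl X T \<and>
     orbit X T \<in> orbit_family P s K \<and>
     orbitally_attractive (closed_loop P s K \<gamma>1 \<gamma>2) (phi K) (orbit_family P s K) (orbit X T) \<and>
     (\<exists>\<delta>>0. bounded_from (closed_loop P s K \<gamma>1 \<gamma>2) {x0. infdist (cyl x0) (orbit X T) < \<delta>}) \<and>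
     (periodic_fun_simple (m_target P s K) (2 * pi) \<and>
      periodic_fun_simple (U_target P s K) (2 * pi) \<longrightarrow>
        bounded_from (closed_loop P s K \<gamma>1 \<gamma>2) UNIV)"
proof -
  interpret constrained_plant P s K \<gamma>1 \<gamma>2
    by (intro constrained_plant.intro assms)
  show ?thesis
    using orbital_stabilization[OF A3c] bounded_from_UNIV by blast
qed

end
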